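(* Let $(\mathcal{C},\iota,\lambda)$ be a category with conjugation, $(D,\delta)$ a duality on $\mathcal{C}$ and $\alpha$ a commutation between $(\iota,\lambda)$ and $(D,\delta)$. The morphisms of categories with duality $\widehat\Psi,\check\Psi,\widehat\Theta,\check\Theta$ define equivalences of categories with duality \[\widehat\Psi\colon(\mathcal{C},D,\pm\delta)\to(\mathcal{C}'',\iota''D'',\pm\delta''_{\alpha''}),\qquad \check\Theta\colon(\mathcal{C}'',\iota''D'',\pm\delta''_{\alpha''})\to(\mathcal{C},D,\pm\delta)\] (mutually inverse), and \[\check\Psi\colon(\mathcal{C},\iota D,\pm\delta_\alpha)\to(\mathcal{C}'',D'',\mp\delta''),\qquad \widehat\Theta\colon(\mathcal{C}'',D'',\mp\delta'')\to(\mathcal{C},\iota D,\pm\delta_\alpha)\] (mutually inverse). Moreover the following equalities of morphisms of categories with duality hold: \[\check G'\,\widehat\Psi=\widehat F\colon(\mathcal{C},D,\pm\delta)\to(\mathcal{C}',D',\pm\delta'),\qquad \widehat G'\,\check\Psi=\check F\colon(\mathcal{C},\iota D,\pm\delta_\alpha)\to(\mathcal{C}',\iota'D',\pm\delta'_{\alpha'}),\] and the following pairs of morphisms of categories with duality are similar: \[\widehat\Theta\,\widehat F'\ \text{ and }\ \widehat G\colon(\mathcal{C}',D',\pm\delta')\to(\mathcal{C},\iota D,\mp\delta_\alpha),\qquad \check\Theta\,\check F'\ \text{ and }\ \check G\colon(\mathcal{C}',\iota'D',\pm\delta'_{\alpha'})\to(\mathcal{C},D,\pm\delta).\]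
   Context: Throughout, $k$ is a commutative ring in which $2$ is invertible, $\mathcal{C}$ is an additive $k$-linear category that is pseudo-abelian (every idempotent endomorphism splits), and all functors are $k$-linear. Composition is written by juxtaposition; $1_C$ is the identity of $C$. Conjugations. A conjugation on $\mathcal{C}$ is a pair $(\iota,\lambda)$ where $\iota\colon\mathcal{C}\to\mathcal{C}$ is a covariant functor and $\lambda\colon\iota\iota\Rightarrow\mathrm{Id}_{\mathcal{C}}$ is a natural isomorphism with $\lambda_{\iota(C)}=\iota(\lambda_C)$ for all $C$. The double category $\mathcal{C}'$ has as objects the pairs $(C,f)$ with $f\colon\iota(C)\to C$ an isomorphism with $f\,\iota(f)=\lambda_C$; morphisms $(C,f)\to(E,g)$ are the morphisms $\varphi\colon C\to E$ in $\mathcal{C}$ with $\varphi f=g\,\iota(\varphi)$. It carries the conjugation $\iota'(C,f)=(\iota(C),-\iota(f))$, $\iota'(\varphi)=\iota(\varphi)$, $\lambda'_{(C,f)}=-\lambda_C$. Functors: $F\colon\mathcal{C}\to\mathcal{C}'$, $F(C)=(C\oplus\iota(C),\Lambda_C)$ with $\Lambda_C=\begin{pmatrix}0&\lambda_C\\1_{\iota(C)}&0\end{pmatrix}$, $F(\varphi)=\begin{pmatrix}\varphi&0\\0&\iota(\varphi)\end{pmatrix}$; and $G\colon\mathcal{C}'\to\mathcal{C}$ the forgetful functor $G(C,f)=C$. The double of $(\mathcal{C}',\iota',\lambda')$ is $(\mathcal{C}'',\iota'',\lambda'')$; objects of $\mathcal{C}''$ are written $(C,f,g)$ for $((C,f),g)$.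 Functor $\Theta\colon\mathcal{C}''\to\mathcal{C}$: for $C''=(C,f,g)$ the endomorphism $\frac12(1_C-gf^{-1})$ in $\mathcal{C}$ is idempotent; choose $\Theta(C'')$ and $t_{C''}\colon\Theta(C'')\to C$, $s_{C''}\colon C\to\Theta(C'')$ with $s_{C''}t_{C''}=1$, $t_{C''}s_{C''}=\frac12(1_C-gf^{-1})$; for $\varphi\colon C_1''\to C_2''$ put $\Theta(\varphi)=s_{C_2''}\varphi\, t_{C_1''}$. Functor $\Psi\colon\mathcal{C}\to\mathcal{C}''$: $\Psi(C)=(C\oplus\iota(C),\Lambda_C,\Delta_C)$ with $\Delta_C=\begin{pmatrix}0&-\lambda_C\\1_{\iota(C)}&0\end{pmatrix}$, $\Psi(\varphi)=\begin{pmatrix}\varphi&0\\0&\iota(\varphi)\end{pmatrix}$. Dualities. A duality on $\mathcal{C}$ is a pair $(D,\delta)$ of a contravariant functor $D\colon\mathcal{C}\to\mathcal{C}$ and a natural isomorphism $\delta\colon\mathrm{Id}\Rightarrow DD$ with $\delta_{D(C)}=D(\delta_C)^{-1}$ for all $C$; then $(D,-\delta)$ is also a duality. A morphism of categories with duality $(\mathcal{C}_1,D_1,\delta_1)\to(\mathcal{C}_2,D_2,\delta_2)$ is a pair $(R,\theta)$ of a covariant functor $R\colon\mathcal{C}_1\to\mathcal{C}_2$ and a natural isomorphism $\theta\colon RD_1\Rightarrow D_2R$ with $\theta_{D_1(C)}R((\delta_1)_C)=D_2(\theta_C)(\delta_2)_{R(C)}$. The composite $(S,\tau)(R,\theta)$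 is $SR$ with the natural isomorphism $C\mapsto\tau_{R(C)}S(\theta_C)$. Morphisms $(R,\theta),(S,\tau)\colon(\mathcal{C}_1,D_1,\delta_1)\to(\mathcal{C}_2,D_2,\delta_2)$ are similar if there are a natural isomorphism $\rho\colon R\Rightarrow S$ and $\mu\in k^\times$ with $D_2(\rho_C)\,\tau_C\,\rho_{D_1(C)}=\mu\,\theta_C$ for all $C$; they are isomorphic if this holds for some $\rho$ with $\mu=1$. Two morphisms in opposite directions are mutually inverse equivalences of categories with duality if both composites are isomorphic to the identity morphisms (the identity functor with the identity natural isomorphism). A commutation between $(\iota,\lambda)$ and $(D,\delta)$ is a natural isomorphism $\alpha\colon\iota D\Rightarrow D\iota$ such that $\alpha_{D(C)}\,\iota(\delta_C)=D(\alpha_C)\,\delta_{\iota(C)}$ and $\alpha_{\iota(C)}^{-1}D(\lambda_C)=\iota(\alpha_C)\,\lambda_{D(C)}^{-1}$ for all $C$. It yields a duality $(\iota D,\delta_\alpha)$ on $\mathcal{C}$ with $(\delta_\alpha)_C=\iota(\alpha_{D(C)})\,\lambda^{-1}_{DD(C)}\,\delta_C$, and a duality $(D',\delta')$ on $\mathcal{C}'$ with $D'(C,f)=(D(C),-D(f)^{-1}\alpha_C)$, $D'(\varphi)=D(\varphi)$, $\delta'_{(C,f)}=\delta_C$, together with a commutation $\alpha'_{(C,f)}=-\alpha_C$ between $(\iota',\lambda')$ and $(D',\delta')$. Hence also a duality $(\iota'D',\delta'_{\alpha'})$ on $\mathcal{C}'$; iterating, one gets $(D'',\delta'')$, $\alpha''$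 and $(\iota''D'',\delta''_{\alpha''})$ on $\mathcal{C}''$. Morphisms of categories with duality: $\widehat F=(F,\widehat\phi)\colon(\mathcal{C},D,\pm\delta)\to(\mathcal{C}',D',\pm\delta')$ with $\widehat\phi_C=\begin{pmatrix}1_{D(C)}&0\\0&-\alpha_C\end{pmatrix}$; $\check F=(F,\check\phi)\colon(\mathcal{C},\iota D,\pm\delta_\alpha)\to(\mathcal{C}',\iota'D',\pm\delta'_{\alpha'})$ with $\check\phi_C=\begin{pmatrix}1_{\iota D(C)}&0\\0&\iota(\alpha_C)\end{pmatrix}$; $\widehat G=(G,\widehat\gamma)\colon(\mathcal{C}',D',\pm\delta')\to(\mathcal{C},\iota D,\mp\delta_\alpha)$ with $\widehat\gamma_{(C,f)}=\alpha_C^{-1}D(f)$; $\check G=(G,\check\gamma)\colon(\mathcal{C}',\iota'D',\pm\delta'_{\alpha'})\to(\mathcal{C},D,\pm\delta)$ with $\check\gamma_{(C,f)}=D(f^{-1})\alpha_C$; $\widehat F',\check F',\widehat G',\check G'$ are defined in the same way starting from $\mathcal{C}'$ with $(\iota',\lambda')$, $(D',\delta')$, $\alpha'$; $\widehat\Psi=(\Psi,\widehat\psi)\colon(\mathcal{C},D,\pm\delta)\to(\mathcal{C}'',\iota''D'',\pm\delta''_{\alpha''})$ with $\widehat\psi_C=\begin{pmatrix}0&1_{\iota D(C)}\\\iota(\alpha_C)\lambda_{D(C)}^{-1}&0\end{pmatrix}$; $\check\Psi=(\Psi,\check\psi)\colon(\mathcal{C},\iota D,\pm\delta_\alpha)\to(\mathcal{C}'',D'',\mp\delta'')$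 with $\check\psi_C=\begin{pmatrix}0&\lambda_{D(C)}\\-\alpha_C&0\end{pmatrix}$; and, for $C''=(C,f,g)$, $\widehat\Theta=(\Theta,\widehat\theta)\colon(\mathcal{C}'',D'',\pm\delta'')\to(\mathcal{C},\iota D,\mp\delta_\alpha)$ with $\widehat\theta_{C''}=-\iota D(t_{C''})\,\alpha_C^{-1}\,D(f)\,t_{D''(C'')}$; $\check\Theta=(\Theta,\check\theta)\colon(\mathcal{C}'',\iota''D'',\pm\delta''_{\alpha''})\to(\mathcal{C},D,\pm\delta)$ with $\check\theta_{C''}=D(t_{C''})\,D(f^{-1})\,\alpha_C\,t_{\iota''D''(C'')}$. *)

theory Defs
  imports Main
begin

section \<open>\<open>k\<close>-linear categories\<close>

text \<open>
  The ring \<open>k\<close> is a type of sort \<open>{comm_ring, comm_monoid_mult}\<close>, i.e. a commutative ring with unit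
  (unlike \<open>comm_ring_1\<close>, this does not exclude the zero ring).

  A category is given by its objects and a family of Hom-sets. Composition, addition and scalar
  multiplication of morphisms do not mention the objects; for categories with pairwise disjoint
  Hom-sets (the usual convention) this is no restriction. Disjointness itself is not required,
  so that the morphisms of the double category below can literally be morphisms of the given one.
  The functions are only relevant on \<open>Obj\<close> and \<open>Hom\<close>. \<open>g \<cdot> f\<close> is ``\<open>g\<close> after \<open>f\<close>''.
\<close>

record ('o, 'm, 'k) lcat =
  Obj :: "'o set"
  Hom :: "'o \<Rightarrow> 'o \<Rightarrow> 'm set"
  Idn :: "'o \<Rightarrow> 'm"
  Cmp :: "'m \<Rightarrow> 'm \<Rightarrow> 'm"  (infixr "\<cdot>\<index>" 70)
  Zer :: "'o \<Rightarrow> 'o \<Rightarrow> 'm"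
  Add :: "'m \<Rightarrow> 'm \<Rightarrow> 'm"  (infixl "\<oplus>\<index>" 65)
  Scl :: "'k \<Rightarrow> 'm \<Rightarrow> 'm"  (infixr "\<odot>\<index>" 75)

locale linear_category =
  fixes C :: "('o, 'm, 'k::{comm_ring, comm_monoid_mult}) lcat" (structure)
  assumes Idn_in: "X \<in> Obj C \<Longrightarrow> Idn C X \<in> Hom C X X"
    and Cmp_in: "\<lbrakk>X \<in> Obj C; Y \<in> Obj C; Z \<in> Obj C; f \<in> Hom C X Y; g \<in> Hom C Y Z\<rbrakk> \<Longrightarrow> g \<cdot> f \<in> Hom C X Z"
    and Cmp_assoc: "\<lbrakk>W \<in> Obj C; X \<in> Obj C; Y \<in> Obj C; Z \<in> Obj C;
          f \<in> Hom C W X; g \<in> Hom C X Y; h \<in> Hom C Y Z\<rbrakk> \<Longrightarrow> (h \<cdot> g) \<cdot> f = h \<cdot> (g \<cdot> f)"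
    and Idn_left: "\<lbrakk>X \<in> Obj C; Y \<in> Obj C; f \<in> Hom C X Y\<rbrakk> \<Longrightarrow> Idn C Y \<cdot> f = f"
    and Idn_right: "\<lbrakk>X \<in> Obj C; Y \<in> Obj C; f \<in> Hom C X Y\<rbrakk> \<Longrightarrow> f \<cdot> Idn C X = f"
    and Zer_in: "\<lbrakk>X \<in> Obj C; Y \<in> Obj C\<rbrakk> \<Longrightarrow> Zer C X Y \<in> Hom C X Y"
    and Add_in: "\<lbrakk>X \<in> Obj C; Y \<in> Obj C; f \<in> Hom C X Y; g \<in> Hom C X Y\<rbrakk> \<Longrightarrow> f \<oplus> g \<in> Hom C X Y"
    and Scl_in: "\<lbrakk>X \<in> Obj C; Y \<in> Obj C; f \<in> Hom C X Y\<rbrakk> \<Longrightarrow> a \<odot> f \<in> Hom C X Y"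
    and Add_assoc: "\<lbrakk>X \<in> Obj C; Y \<in> Obj C; f \<in> Hom C X Y; g \<in> Hom C X Y; h \<in> Hom C X Y\<rbrakk>
          \<Longrightarrow> (f \<oplus> g) \<oplus> h = f \<oplus> (g \<oplus> h)"
    and Add_commute: "\<lbrakk>X \<in> Obj C; Y \<in> Obj C; f \<in> Hom C X Y; g \<in> Hom C X Y\<rbrakk> \<Longrightarrow> f \<oplus> g = g \<oplus> f"
    and Add_Zer: "\<lbrakk>X \<in> Obj C; Y \<in> Obj C; f \<in> Hom C X Y\<rbrakk> \<Longrightarrow> f \<oplus> Zer C X Y = f"
    and Add_inverse: "\<lbrakk>X \<in> Obj C; Y \<in> Obj C; f \<in> Hom C X Y\<rbrakk> \<Longrightarrow> \<exists>g\<in>Hom C X Y. f \<oplus> g = Zer C X Y"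
    and Scl_Add: "\<lbrakk>X \<in> Obj C; Y \<in> Obj C; f \<in> Hom C X Y; g \<in> Hom C X Y\<rbrakk>
          \<Longrightarrow> a \<odot> (f \<oplus> g) = a \<odot> f \<oplus> a \<odot> g"
    and add_Scl: "\<lbrakk>X \<in> Obj C; Y \<in> Obj C; f \<in> Hom C X Y\<rbrakk> \<Longrightarrow> (a + b) \<odot> f = a \<odot> f \<oplus> b \<odot> f"
    and mult_Scl: "\<lbrakk>X \<in> Obj C; Y \<in> Obj C; f \<in> Hom C X Y\<rbrakk> \<Longrightarrow> (a * b) \<odot> f = a \<odot> (b \<odot> f)"
    and one_Scl: "\<lbrakk>X \<in> Obj C; Y \<in> Obj C; f \<in> Hom C X Y\<rbrakk> \<Longrightarrow> 1 \<odot> f = f"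
    and Cmp_Add_right: "\<lbrakk>X \<in> Obj C; Y \<in> Obj C; Z \<in> Obj C; f \<in> Hom C X Y; f' \<in> Hom C X Y; g \<in> Hom C Y Z\<rbrakk>
          \<Longrightarrow> g \<cdot> (f \<oplus> f') = g \<cdot> f \<oplus> g \<cdot> f'"
    and Cmp_Add_left: "\<lbrakk>X \<in> Obj C; Y \<in> Obj C; Z \<in> Obj C; f \<in> Hom C X Y; g \<in> Hom C Y Z; g' \<in> Hom C Y Z\<rbrakk>
          \<Longrightarrow> (g \<oplus> g') \<cdot> f = g \<cdot> f \<oplus> g' \<cdot> f"
    and Cmp_Scl_right: "\<lbrakk>X \<in> Obj C; Y \<in> Obj C; Z \<in> Obj C; f \<in> Hom C X Y; g \<in> Hom C Y Z\<rbrakk>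
          \<Longrightarrow> g \<cdot> (a \<odot> f) = a \<odot> (g \<cdot> f)"
    and Cmp_Scl_left: "\<lbrakk>X \<in> Obj C; Y \<in> Obj C; Z \<in> Obj C; f \<in> Hom C X Y; g \<in> Hom C Y Z\<rbrakk>
          \<Longrightarrow> (a \<odot> g) \<cdot> f = a \<odot> (g \<cdot> f)"

definition Neg :: "('o, 'm, 'k::{comm_ring, comm_monoid_mult}) lcat \<Rightarrow> 'm \<Rightarrow> 'm"  ("\<ominus>\<index> _" [76] 75) where
  "Neg C f = (- 1) \<odot>\<^bsub>C\<^esub> f"

definition isom :: "('o, 'm, 'k) lcat \<Rightarrow> 'o \<Rightarrow> 'o \<Rightarrow> 'm \<Rightarrow> bool" where
  "isom C X Y f \<longleftrightarrow> f \<in> Hom C X Y \<and>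
     (\<exists>g\<in>Hom C Y X. g \<cdot>\<^bsub>C\<^esub> f = Idn C X \<and> f \<cdot>\<^bsub>C\<^esub> g = Idn C Y)"

definition Inv :: "('o, 'm, 'k) lcat \<Rightarrow> 'o \<Rightarrow> 'o \<Rightarrow> 'm \<Rightarrow> 'm" where
  "Inv C X Y f = (THE g. g \<in> Hom C Y X \<and> g \<cdot>\<^bsub>C\<^esub> f = Idn C X \<and> f \<cdot>\<^bsub>C\<^esub> g = Idn C Y)"

record ('o, 'm) bip =
  bsum :: "'o"
  in1 :: "'m"
  in2 :: "'m"
  pr1 :: "'m"
  pr2 :: "'m"

definition biproduct :: "('o, 'm, 'k) lcat \<Rightarrow> 'o \<Rightarrow> 'o \<Rightarrow> ('o, 'm) bip \<Rightarrow> bool" where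
  "biproduct C X Y b \<longleftrightarrow>
     bsum b \<in> Obj C \<and>
     in1 b \<in> Hom C X (bsum b) \<and> in2 b \<in> Hom C Y (bsum b) \<and>
     pr1 b \<in> Hom C (bsum b) X \<and> pr2 b \<in> Hom C (bsum b) Y \<and>
     pr1 b \<cdot>\<^bsub>C\<^esub> in1 b = Idn C X \<and> pr2 b \<cdot>\<^bsub>C\<^esub> in2 b = Idn C Y \<and>
     pr1 b \<cdot>\<^bsub>C\<^esub> in2 b = Zer C Y X \<and> pr2 b \<cdot>\<^bsub>C\<^esub> in1 b = Zer C X Y \<and>
     in1 b \<cdot>\<^bsub>C\<^esub> pr1 b \<oplus>\<^bsub>C\<^esub> in2 b \<cdot>\<^bsub>C\<^esub> pr2 b = Idn C (bsum b)"

locale additive_category = linear_category C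
  for C :: "('o, 'm, 'k::{comm_ring, comm_monoid_mult}) lcat" (structure) +
  assumes zero_object: "\<exists>Z\<in>Obj C. Idn C Z = Zer C Z Z"
    and biproducts: "\<lbrakk>X \<in> Obj C; Y \<in> Obj C\<rbrakk> \<Longrightarrow> \<exists>b. biproduct C X Y b"

locale pseudo_abelian_category = additive_category C
  for C :: "('o, 'm, 'k::{comm_ring, comm_monoid_mult}) lcat" (structure) +
  assumes idempotents_split: "\<lbrakk>X \<in> Obj C; e \<in> Hom C X X; e \<cdot> e = e\<rbrakk>
    \<Longrightarrow> \<exists>Y\<in>Obj C. \<exists>t\<in>Hom C Y X. \<exists>s\<in>Hom C X Y. s \<cdot> t = Idn C Y \<and> t \<cdot> s = e"

definition direct_sums :: "('o, 'm, 'k) lcat \<Rightarrow> ('o \<Rightarrow> 'o \<Rightarrow> ('o, 'm) bip) \<Rightarrow> bool" where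
  "direct_sums C B \<longleftrightarrow> (\<forall>X\<in>Obj C. \<forall>Y\<in>Obj C. biproduct C X Y (B X Y))"

text \<open>
  The morphism with matrix \<open>((a11, a12), (a21, a22))\<close> from the biproduct \<open>b\<close> to the biproduct \<open>b'\<close>.
\<close>

definition mat ::
  "('o, 'm, 'k) lcat \<Rightarrow> ('o, 'm) bip \<Rightarrow> ('o, 'm) bip \<Rightarrow> 'm \<Rightarrow> 'm \<Rightarrow> 'm \<Rightarrow> 'm \<Rightarrow> 'm" where
  "mat C b b' a11 a12 a21 a22 =
     (in1 b' \<cdot>\<^bsub>C\<^esub> a11 \<cdot>\<^bsub>C\<^esub> pr1 b \<oplus>\<^bsub>C\<^esub> in1 b' \<cdot>\<^bsub>C\<^esub> a12 \<cdot>\<^bsub>C\<^esub> pr2 b)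
     \<oplus>\<^bsub>C\<^esub> (in2 b' \<cdot>\<^bsub>C\<^esub> a21 \<cdot>\<^bsub>C\<^esub> pr1 b \<oplus>\<^bsub>C\<^esub> in2 b' \<cdot>\<^bsub>C\<^esub> a22 \<cdot>\<^bsub>C\<^esub> pr2 b)"

section \<open>Functors and natural isomorphisms\<close>

text \<open>
  Since Hom-sets may overlap, the action on morphisms has the source and the target as arguments:
  \<open>fmor F X Y \<phi>\<close> is the image of \<open>\<phi> : X \<rightarrow> Y\<close>, both for covariant and for contravariant \<open>F\<close>.
\<close>

record ('o1, 'm1, 'o2, 'm2) fctr =
  fob :: "'o1 \<Rightarrow> 'o2"
  fmor :: "'o1 \<Rightarrow> 'o1 \<Rightarrow> 'm1 \<Rightarrow> 'm2"

definition covariant_functor ::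
  "('o1, 'm1, 'k) lcat \<Rightarrow> ('o2, 'm2, 'k) lcat \<Rightarrow> ('o1, 'm1, 'o2, 'm2) fctr \<Rightarrow> bool" where
  "covariant_functor C1 C2 F \<longleftrightarrow>
     (\<forall>X\<in>Obj C1. fob F X \<in> Obj C2) \<and>
     (\<forall>X\<in>Obj C1. \<forall>Y\<in>Obj C1. \<forall>\<phi>\<in>Hom C1 X Y. fmor F X Y \<phi> \<in> Hom C2 (fob F X) (fob F Y)) \<and>
     (\<forall>X\<in>Obj C1. fmor F X X (Idn C1 X) = Idn C2 (fob F X)) \<and>
     (\<forall>X\<in>Obj C1. \<forall>Y\<in>Obj C1. \<forall>Z\<in>Obj C1. \<forall>\<phi>\<in>Hom C1 X Y. \<forall>\<psi>\<in>Hom C1 Y Z.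
        fmor F X Z (\<psi> \<cdot>\<^bsub>C1\<^esub> \<phi>) = fmor F Y Z \<psi> \<cdot>\<^bsub>C2\<^esub> fmor F X Y \<phi>) \<and>
     (\<forall>X\<in>Obj C1. \<forall>Y\<in>Obj C1. \<forall>\<phi>\<in>Hom C1 X Y. \<forall>\<psi>\<in>Hom C1 X Y.
        fmor F X Y (\<phi> \<oplus>\<^bsub>C1\<^esub> \<psi>) = fmor F X Y \<phi> \<oplus>\<^bsub>C2\<^esub> fmor F X Y \<psi>) \<and>
     (\<forall>X\<in>Obj C1. \<forall>Y\<in>Obj C1. \<forall>\<phi>\<in>Hom C1 X Y. \<forall>a.
        fmor F X Y (a \<odot>\<^bsub>C1\<^esub> \<phi>) = a \<odot>\<^bsub>C2\<^esub> fmor F X Y \<phi>)"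

definition contravariant_functor ::
  "('o1, 'm1, 'k) lcat \<Rightarrow> ('o2, 'm2, 'k) lcat \<Rightarrow> ('o1, 'm1, 'o2, 'm2) fctr \<Rightarrow> bool" where
  "contravariant_functor C1 C2 F \<longleftrightarrow>
     (\<forall>X\<in>Obj C1. fob F X \<in> Obj C2) \<and>
     (\<forall>X\<in>Obj C1. \<forall>Y\<in>Obj C1. \<forall>\<phi>\<in>Hom C1 X Y. fmor F X Y \<phi> \<in> Hom C2 (fob F Y) (fob F X)) \<and>
     (\<forall>X\<in>Obj C1. fmor F X X (Idn C1 X) = Idn C2 (fob F X)) \<and>
     (\<forall>X\<in>Obj C1. \<forall>Y\<in>Obj C1. \<forall>Z\<in>Obj C1. \<forall>\<phi>\<in>Hom C1 X Y. \<forall>\<psi>\<in>Hom C1 Y Z.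
        fmor F X Z (\<psi> \<cdot>\<^bsub>C1\<^esub> \<phi>) = fmor F X Y \<phi> \<cdot>\<^bsub>C2\<^esub> fmor F Y Z \<psi>) \<and>
     (\<forall>X\<in>Obj C1. \<forall>Y\<in>Obj C1. \<forall>\<phi>\<in>Hom C1 X Y. \<forall>\<psi>\<in>Hom C1 X Y.
        fmor F X Y (\<phi> \<oplus>\<^bsub>C1\<^esub> \<psi>) = fmor F X Y \<phi> \<oplus>\<^bsub>C2\<^esub> fmor F X Y \<psi>) \<and>
     (\<forall>X\<in>Obj C1. \<forall>Y\<in>Obj C1. \<forall>\<phi>\<in>Hom C1 X Y. \<forall>a.
        fmor F X Y (a \<odot>\<^bsub>C1\<^esub> \<phi>) = a \<odot>\<^bsub>C2\<^esub> fmor F X Y \<phi>)"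

definition idf :: "('o, 'm, 'o, 'm) fctr" where
  "idf = \<lparr>fob = (\<lambda>X. X), fmor = (\<lambda>X Y \<phi>. \<phi>)\<rparr>"

text \<open>
  The composite \<open>S R\<close> of functors, for covariant \<open>R\<close> and for contravariant \<open>R\<close>; the outer
  functor \<open>S\<close> may have either variance.
\<close>

definition comp_cov :: "('o2, 'm2, 'o3, 'm3) fctr \<Rightarrow> ('o1, 'm1, 'o2, 'm2) fctr \<Rightarrow> ('o1, 'm1, 'o3, 'm3) fctr" where
  "comp_cov S R = \<lparr>fob = (\<lambda>X. fob S (fob R X)),
     fmor = (\<lambda>X Y \<phi>. fmor S (fob R X) (fob R Y) (fmor R X Y \<phi>))\<rparr>"

definition comp_con :: "('o2, 'm2, 'o3, 'm3) fctr \<Rightarrow> ('o1, 'm1, 'o2, 'm2) fctr \<Rightarrow> ('o1, 'm1, 'o3, 'm3) fctr" where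
  "comp_con S R = \<lparr>fob = (\<lambda>X. fob S (fob R X)),
     fmor = (\<lambda>X Y \<phi>. fmor S (fob R Y) (fob R X) (fmor R X Y \<phi>))\<rparr>"

definition nat_iso_cov ::
  "('o1, 'm1, 'k) lcat \<Rightarrow> ('o2, 'm2, 'k) lcat \<Rightarrow> ('o1, 'm1, 'o2, 'm2) fctr \<Rightarrow> ('o1, 'm1, 'o2, 'm2) fctr
    \<Rightarrow> ('o1 \<Rightarrow> 'm2) \<Rightarrow> bool" where
  "nat_iso_cov C1 C2 R S \<rho> \<longleftrightarrow>
     (\<forall>X\<in>Obj C1. isom C2 (fob R X) (fob S X) (\<rho> X)) \<and>
     (\<forall>X\<in>Obj C1. \<forall>Y\<in>Obj C1. \<forall>\<phi>\<in>Hom C1 X Y. \<rho> Y \<cdot>\<^bsub>C2\<^esub> fmor R X Y \<phi> = fmor S X Y \<phi> \<cdot>\<^bsub>C2\<^esub> \<rho> X)"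

definition nat_iso_con ::
  "('o1, 'm1, 'k) lcat \<Rightarrow> ('o2, 'm2, 'k) lcat \<Rightarrow> ('o1, 'm1, 'o2, 'm2) fctr \<Rightarrow> ('o1, 'm1, 'o2, 'm2) fctr
    \<Rightarrow> ('o1 \<Rightarrow> 'm2) \<Rightarrow> bool" where
  "nat_iso_con C1 C2 R S \<rho> \<longleftrightarrow>
     (\<forall>X\<in>Obj C1. isom C2 (fob R X) (fob S X) (\<rho> X)) \<and>
     (\<forall>X\<in>Obj C1. \<forall>Y\<in>Obj C1. \<forall>\<phi>\<in>Hom C1 X Y. \<rho> X \<cdot>\<^bsub>C2\<^esub> fmor R X Y \<phi> = fmor S X Y \<phi> \<cdot>\<^bsub>C2\<^esub> \<rho> Y)"

text \<open>The biproducts of \<open>F X\<close> and \<open>F Y\<close> obtained from a biproduct \<open>b\<close> of \<open>X\<close> and \<open>Y\<close>.\<close>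

definition bip_cov :: "('o1, 'm1, 'o2, 'm2) fctr \<Rightarrow> 'o1 \<Rightarrow> 'o1 \<Rightarrow> ('o1, 'm1) bip \<Rightarrow> ('o2, 'm2) bip" where
  "bip_cov F X Y b =
     \<lparr>bsum = fob F (bsum b), in1 = fmor F X (bsum b) (in1 b), in2 = fmor F Y (bsum b) (in2 b),
      pr1 = fmor F (bsum b) X (pr1 b), pr2 = fmor F (bsum b) Y (pr2 b)\<rparr>"

definition bip_con :: "('o1, 'm1, 'o2, 'm2) fctr \<Rightarrow> 'o1 \<Rightarrow> 'o1 \<Rightarrow> ('o1, 'm1) bip \<Rightarrow> ('o2, 'm2) bip" where
  "bip_con F X Y b =
     \<lparr>bsum = fob F (bsum b), in1 = fmor F (bsum b) X (pr1 b), in2 = fmor F (bsum b) Y (pr2 b),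
      pr1 = fmor F X (bsum b) (in1 b), pr2 = fmor F Y (bsum b) (in2 b)\<rparr>"

section \<open>Conjugations, dualities, commutations\<close>

definition conjugation :: "('o, 'm, 'k) lcat \<Rightarrow> ('o, 'm, 'o, 'm) fctr \<Rightarrow> ('o \<Rightarrow> 'm) \<Rightarrow> bool" where
  "conjugation C \<iota> l \<longleftrightarrow>
     covariant_functor C C \<iota> \<and>
     nat_iso_cov C C (comp_cov \<iota> \<iota>) idf l \<and>
     (\<forall>X\<in>Obj C. l (fob \<iota> X) = fmor \<iota> (fob \<iota> (fob \<iota> X)) X (l X))"

definition duality :: "('o, 'm, 'k) lcat \<Rightarrow> ('o, 'm, 'o, 'm) fctr \<Rightarrow> ('o \<Rightarrow> 'm) \<Rightarrow> bool" where
  "duality C D \<delta> \<longleftrightarrow>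
     contravariant_functor C C D \<and>
     nat_iso_cov C C idf (comp_con D D) \<delta> \<and>
     (\<forall>X\<in>Obj C. \<delta> (fob D X)
        = Inv C (fob D (fob D (fob D X))) (fob D X) (fmor D X (fob D (fob D X)) (\<delta> X)))"

definition commutation ::
  "('o, 'm, 'k) lcat \<Rightarrow> ('o, 'm, 'o, 'm) fctr \<Rightarrow> ('o \<Rightarrow> 'm) \<Rightarrow> ('o, 'm, 'o, 'm) fctr \<Rightarrow> ('o \<Rightarrow> 'm)
    \<Rightarrow> ('o \<Rightarrow> 'm) \<Rightarrow> bool" where
  "commutation C \<iota> l D \<delta> \<alpha> \<longleftrightarrow>
     nat_iso_con C C (comp_con \<iota> D) (comp_cov D \<iota>) \<alpha> \<and>
     (\<forall>X\<in>Obj C.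
        \<alpha> (fob D X) \<cdot>\<^bsub>C\<^esub> fmor \<iota> X (fob D (fob D X)) (\<delta> X)
        = fmor D (fob \<iota> (fob D X)) (fob D (fob \<iota> X)) (\<alpha> X) \<cdot>\<^bsub>C\<^esub> \<delta> (fob \<iota> X)) \<and>
     (\<forall>X\<in>Obj C.
        Inv C (fob \<iota> (fob D (fob \<iota> X))) (fob D (fob \<iota> (fob \<iota> X))) (\<alpha> (fob \<iota> X))
          \<cdot>\<^bsub>C\<^esub> fmor D (fob \<iota> (fob \<iota> X)) X (l X)
        = fmor \<iota> (fob \<iota> (fob D X)) (fob D (fob \<iota> X)) (\<alpha> X)
          \<cdot>\<^bsub>C\<^esub> Inv C (fob \<iota> (fob \<iota> (fob D X))) (fob D X) (l (fob D X)))"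

section \<open>Categories with duality and their morphisms\<close>

type_synonym ('o, 'm, 'k) dcat = "('o, 'm, 'k) lcat \<times> ('o, 'm, 'o, 'm) fctr \<times> ('o \<Rightarrow> 'm)"

type_synonym ('o1, 'm1, 'o2, 'm2) dmor = "('o1, 'm1, 'o2, 'm2) fctr \<times> ('o1 \<Rightarrow> 'm2)"

fun category_with_duality :: "('o, 'm, 'k::{comm_ring, comm_monoid_mult}) dcat \<Rightarrow> bool" where
  "category_with_duality (C, D, \<delta>) \<longleftrightarrow> pseudo_abelian_category C \<and> duality C D \<delta>"

text \<open>\<open>signed \<epsilon> (C, D, \<delta>)\<close> is \<open>(C, D, \<epsilon>\<delta>)\<close>; it is used for \<open>\<epsilon> = 1\<close> and \<open>\<epsilon> = -1\<close>.\<close>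

fun signed :: "'k \<Rightarrow> ('o, 'm, 'k) dcat \<Rightarrow> ('o, 'm, 'k) dcat" where
  "signed \<epsilon> (C, D, \<delta>) = (C, D, \<lambda>X. \<epsilon> \<odot>\<^bsub>C\<^esub> \<delta> X)"

fun dmorphism ::
  "('o1, 'm1, 'k::{comm_ring, comm_monoid_mult}) dcat \<Rightarrow> ('o2, 'm2, 'k) dcat \<Rightarrow> ('o1, 'm1, 'o2, 'm2) dmor \<Rightarrow> bool" where
  "dmorphism (C1, D1, \<delta>1) (C2, D2, \<delta>2) (R, \<theta>) \<longleftrightarrow>
     category_with_duality (C1, D1, \<delta>1) \<and> category_with_duality (C2, D2, \<delta>2) \<and>
     covariant_functor C1 C2 R \<and>
     nat_iso_con C1 C2 (comp_con R D1) (comp_cov D2 R) \<theta> \<and>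
     (\<forall>X\<in>Obj C1. \<theta> (fob D1 X) \<cdot>\<^bsub>C2\<^esub> fmor R X (fob D1 (fob D1 X)) (\<delta>1 X)
        = fmor D2 (fob R (fob D1 X)) (fob D2 (fob R X)) (\<theta> X) \<cdot>\<^bsub>C2\<^esub> \<delta>2 (fob R X))"

definition id_dmor :: "('o, 'm, 'k) dcat \<Rightarrow> ('o, 'm, 'o, 'm) dmor" where
  "id_dmor \<C> = (case \<C> of (C, D, \<delta>) \<Rightarrow> (idf, \<lambda>X. Idn C (fob D X)))"

text \<open>The composite \<open>(S, \<tau>) (R, \<theta>)\<close> of \<open>(R, \<theta>) : (C1, D1, \<delta>1) \<rightarrow> (C2, D2, \<delta>2)\<close> and
  \<open>(S, \<tau>) : (C2, D2, \<delta>2) \<rightarrow> (C3, D3, \<delta>3)\<close>.\<close>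

fun dcomp ::
  "('o1, 'm1, 'k) dcat \<Rightarrow> ('o2, 'm2, 'k) dcat \<Rightarrow> ('o3, 'm3, 'k) dcat
    \<Rightarrow> ('o2, 'm2, 'o3, 'm3) dmor \<Rightarrow> ('o1, 'm1, 'o2, 'm2) dmor \<Rightarrow> ('o1, 'm1, 'o3, 'm3) dmor" where
  "dcomp (C1, D1, \<delta>1) (C2, D2, \<delta>2) (C3, D3, \<delta>3) (S, \<tau>) (R, \<theta>) =
     (comp_cov S R,
      \<lambda>X. \<tau> (fob R X) \<cdot>\<^bsub>C3\<^esub> fmor S (fob R (fob D1 X)) (fob D2 (fob R X)) (\<theta> X))"

text \<open>Equality of morphisms: equal on all objects and morphisms of the source category.\<close>

fun dmor_eq ::
  "('o1, 'm1, 'k::{comm_ring, comm_monoid_mult}) dcat \<Rightarrow> ('o2, 'm2, 'k) dcat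
    \<Rightarrow> ('o1, 'm1, 'o2, 'm2) dmor \<Rightarrow> ('o1, 'm1, 'o2, 'm2) dmor \<Rightarrow> bool" where
  "dmor_eq (C1, D1, \<delta>1) \<C>2 (R, \<theta>) (S, \<tau>) \<longleftrightarrow>
     dmorphism (C1, D1, \<delta>1) \<C>2 (R, \<theta>) \<and> dmorphism (C1, D1, \<delta>1) \<C>2 (S, \<tau>) \<and>
     (\<forall>X\<in>Obj C1. fob R X = fob S X) \<and>
     (\<forall>X\<in>Obj C1. \<forall>Y\<in>Obj C1. \<forall>\<phi>\<in>Hom C1 X Y. fmor R X Y \<phi> = fmor S X Y \<phi>) \<and>
     (\<forall>X\<in>Obj C1. \<theta> X = \<tau> X)"

fun similar_via ::
  "'k \<Rightarrow> ('o1, 'm1, 'k::{comm_ring, comm_monoid_mult}) dcat \<Rightarrow> ('o2, 'm2, 'k) dcat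
    \<Rightarrow> ('o1, 'm1, 'o2, 'm2) dmor \<Rightarrow> ('o1, 'm1, 'o2, 'm2) dmor \<Rightarrow> bool" where
  "similar_via \<mu> (C1, D1, \<delta>1) (C2, D2, \<delta>2) (R, \<theta>) (S, \<tau>) \<longleftrightarrow>
     dmorphism (C1, D1, \<delta>1) (C2, D2, \<delta>2) (R, \<theta>) \<and> dmorphism (C1, D1, \<delta>1) (C2, D2, \<delta>2) (S, \<tau>) \<and>
     (\<exists>\<rho>. nat_iso_cov C1 C2 R S \<rho> \<and>
       (\<forall>X\<in>Obj C1. fmor D2 (fob R X) (fob S X) (\<rho> X) \<cdot>\<^bsub>C2\<^esub> \<tau> X \<cdot>\<^bsub>C2\<^esub> \<rho> (fob D1 X) = \<mu> \<odot>\<^bsub>C2\<^esub> \<theta> X))"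

definition dsimilar ::
  "('o1, 'm1, 'k::{comm_ring, comm_monoid_mult}) dcat \<Rightarrow> ('o2, 'm2, 'k) dcat
    \<Rightarrow> ('o1, 'm1, 'o2, 'm2) dmor \<Rightarrow> ('o1, 'm1, 'o2, 'm2) dmor \<Rightarrow> bool" where
  "dsimilar \<C>1 \<C>2 P Q \<longleftrightarrow> (\<exists>\<mu>. \<mu> dvd 1 \<and> similar_via \<mu> \<C>1 \<C>2 P Q)"

definition disomorphic ::
  "('o1, 'm1, 'k::{comm_ring, comm_monoid_mult}) dcat \<Rightarrow> ('o2, 'm2, 'k) dcat
    \<Rightarrow> ('o1, 'm1, 'o2, 'm2) dmor \<Rightarrow> ('o1, 'm1, 'o2, 'm2) dmor \<Rightarrow> bool" where
  "disomorphic \<C>1 \<C>2 P Q \<longleftrightarrow> similar_via 1 \<C>1 \<C>2 P Q"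

definition mutually_inverse_equivalences ::
  "('o1, 'm1, 'k::{comm_ring, comm_monoid_mult}) dcat \<Rightarrow> ('o2, 'm2, 'k) dcat
    \<Rightarrow> ('o1, 'm1, 'o2, 'm2) dmor \<Rightarrow> ('o2, 'm2, 'o1, 'm1) dmor \<Rightarrow> bool" where
  "mutually_inverse_equivalences \<C>1 \<C>2 P Q \<longleftrightarrow>
     dmorphism \<C>1 \<C>2 P \<and> dmorphism \<C>2 \<C>1 Q \<and>
     disomorphic \<C>1 \<C>1 (dcomp \<C>1 \<C>2 \<C>1 Q P) (id_dmor \<C>1) \<and>
     disomorphic \<C>2 \<C>2 (dcomp \<C>2 \<C>1 \<C>2 P Q) (id_dmor \<C>2)"

section \<open>The double\<close>

text \<open>The data \<open>(C, \<iota>, \<lambda>, D, \<delta>, \<alpha>)\<close>, bundled so that doubling can be iterated.\<close>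

record ('o, 'm, 'k) cdcat =
  ucat :: "('o, 'm, 'k) lcat"
  cnj :: "('o, 'm, 'o, 'm) fctr"
  lam :: "'o \<Rightarrow> 'm"
  dua :: "('o, 'm, 'o, 'm) fctr"
  del :: "'o \<Rightarrow> 'm"
  alp :: "'o \<Rightarrow> 'm"

definition conjugation_duality_category ::
  "('o, 'm, 'k::{comm_ring, comm_monoid_mult}) cdcat \<Rightarrow> bool" where
  "conjugation_duality_category K \<longleftrightarrow>
     pseudo_abelian_category (ucat K) \<and>
     conjugation (ucat K) (cnj K) (lam K) \<and>
     duality (ucat K) (dua K) (del K) \<and>
     commutation (ucat K) (cnj K) (lam K) (dua K) (del K) (alp K)"

definition double_cat ::
  "('o, 'm, 'k) lcat \<Rightarrow> ('o, 'm, 'o, 'm) fctr \<Rightarrow> ('o \<Rightarrow> 'm) \<Rightarrow> ('o \<times> 'm, 'm, 'k) lcat" where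
  "double_cat C \<iota> l =
     \<lparr>Obj = {(X, f). X \<in> Obj C \<and> isom C (fob \<iota> X) X f \<and> f \<cdot>\<^bsub>C\<^esub> fmor \<iota> (fob \<iota> X) X f = l X},
      Hom = (\<lambda>(X, f) (Y, g). {\<phi> \<in> Hom C X Y. \<phi> \<cdot>\<^bsub>C\<^esub> f = g \<cdot>\<^bsub>C\<^esub> fmor \<iota> X Y \<phi>}),
      Idn = (\<lambda>(X, f). Idn C X),
      Cmp = Cmp C,
      Zer = (\<lambda>(X, f) (Y, g). Zer C X Y),
      Add = Add C,
      Scl = Scl C\<rparr>"

definition double ::
  "('o, 'm, 'k::{comm_ring, comm_monoid_mult}) cdcat \<Rightarrow> ('o \<times> 'm, 'm, 'k) cdcat" where
  "double K = (let C = ucat K; \<iota> = cnj K; D = dua K in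
     \<lparr>ucat = double_cat C \<iota> (lam K),
      cnj = \<lparr>fob = (\<lambda>(X, f). (fob \<iota> X, \<ominus>\<^bsub>C\<^esub> fmor \<iota> (fob \<iota> X) X f)),
             fmor = (\<lambda>(X, f) (Y, g) \<phi>. fmor \<iota> X Y \<phi>)\<rparr>,
      lam = (\<lambda>(X, f). \<ominus>\<^bsub>C\<^esub> lam K X),
      dua = \<lparr>fob = (\<lambda>(X, f). (fob D X,
                \<ominus>\<^bsub>C\<^esub> (Inv C (fob D X) (fob D (fob \<iota> X)) (fmor D (fob \<iota> X) X f) \<cdot>\<^bsub>C\<^esub> alp K X))),
             fmor = (\<lambda>(X, f) (Y, g) \<phi>. fmor D X Y \<phi>)\<rparr>,
      del = (\<lambda>(X, f). del K X),
      alp = (\<lambda>(X, f). \<ominus>\<^bsub>C\<^esub> alp K X)\<rparr>)"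

text \<open>The categories with duality \<open>(C, D, \<delta>)\<close> and \<open>(C, \<iota>D, \<delta>\<^sub>\<alpha>)\<close>.\<close>

definition dualD :: "('o, 'm, 'k) cdcat \<Rightarrow> ('o, 'm, 'k) dcat" where
  "dualD K = (ucat K, dua K, del K)"

definition dualID :: "('o, 'm, 'k) cdcat \<Rightarrow> ('o, 'm, 'k) dcat" where
  "dualID K = (let C = ucat K; \<iota> = cnj K; D = dua K in
     (C, comp_con \<iota> D,
      \<lambda>X. fmor \<iota> (fob \<iota> (fob D (fob D X))) (fob D (fob \<iota> (fob D X))) (alp K (fob D X))
          \<cdot>\<^bsub>C\<^esub> Inv C (fob \<iota> (fob \<iota> (fob D (fob D X)))) (fob D (fob D X)) (lam K (fob D (fob D X)))
          \<cdot>\<^bsub>C\<^esub> del K X))"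

section \<open>The functors \<open>F\<close>, \<open>G\<close>, \<open>\<Psi>\<close>, \<open>\<Theta>\<close>\<close>

text \<open>
  \<open>B\<close> is the choice of direct sums. The source \<open>\<iota>(X \<oplus> \<iota> X)\<close> of \<open>\<Lambda>\<close> and \<open>\<Delta>\<close> is decomposed as
  \<open>\<iota> X \<oplus> \<iota> \<iota> X\<close>.
\<close>

definition dsum :: "('o, 'm, 'k) cdcat \<Rightarrow> ('o \<Rightarrow> 'o \<Rightarrow> ('o, 'm) bip) \<Rightarrow> 'o \<Rightarrow> ('o, 'm) bip" where
  "dsum K B X = B X (fob (cnj K) X)"

definition Lambda_mat :: "('o, 'm, 'k) cdcat \<Rightarrow> ('o \<Rightarrow> 'o \<Rightarrow> ('o, 'm) bip) \<Rightarrow> 'o \<Rightarrow> 'm" where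
  "Lambda_mat K B X = (let C = ucat K; \<iota> = cnj K; b = dsum K B X in
     mat C (bip_cov \<iota> X (fob \<iota> X) b) b
       (Zer C (fob \<iota> X) X) (lam K X)
       (Idn C (fob \<iota> X)) (Zer C (fob \<iota> (fob \<iota> X)) (fob \<iota> X)))"

definition Delta_mat ::
  "('o, 'm, 'k::{comm_ring, comm_monoid_mult}) cdcat \<Rightarrow> ('o \<Rightarrow> 'o \<Rightarrow> ('o, 'm) bip) \<Rightarrow> 'o \<Rightarrow> 'm" where
  "Delta_mat K B X = (let C = ucat K; \<iota> = cnj K; b = dsum K B X in
     mat C (bip_cov \<iota> X (fob \<iota> X) b) b
       (Zer C (fob \<iota> X) X) (\<ominus>\<^bsub>C\<^esub> lam K X)
       (Idn C (fob \<iota> X)) (Zer C (fob \<iota> (fob \<iota> X)) (fob \<iota> X)))"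

definition diag_mor :: "('o, 'm, 'k) cdcat \<Rightarrow> ('o \<Rightarrow> 'o \<Rightarrow> ('o, 'm) bip) \<Rightarrow> 'o \<Rightarrow> 'o \<Rightarrow> 'm \<Rightarrow> 'm" where
  "diag_mor K B X Y \<phi> = (let C = ucat K; \<iota> = cnj K in
     mat C (dsum K B X) (dsum K B Y)
       \<phi> (Zer C (fob \<iota> X) Y)
       (Zer C X (fob \<iota> Y)) (fmor \<iota> X Y \<phi>))"

definition F_fun :: "('o, 'm, 'k) cdcat \<Rightarrow> ('o \<Rightarrow> 'o \<Rightarrow> ('o, 'm) bip) \<Rightarrow> ('o, 'm, 'o \<times> 'm, 'm) fctr" where
  "F_fun K B = \<lparr>fob = (\<lambda>X. (bsum (dsum K B X), Lambda_mat K B X)), fmor = diag_mor K B\<rparr>"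

definition G_fun :: "('o \<times> 'm, 'm, 'o, 'm) fctr" where
  "G_fun = \<lparr>fob = fst, fmor = (\<lambda>_ _ \<phi>. \<phi>)\<rparr>"

definition Psi_fun ::
  "('o, 'm, 'k::{comm_ring, comm_monoid_mult}) cdcat \<Rightarrow> ('o \<Rightarrow> 'o \<Rightarrow> ('o, 'm) bip)
    \<Rightarrow> ('o, 'm, ('o \<times> 'm) \<times> 'm, 'm) fctr" where
  "Psi_fun K B =
     \<lparr>fob = (\<lambda>X. ((bsum (dsum K B X), Lambda_mat K B X), Delta_mat K B X)), fmor = diag_mor K B\<rparr>"

text \<open>
  A choice \<open>T\<close>, \<open>t\<close>, \<open>s\<close> of splittings of the idempotents \<open>(1 - g f\<^sup>-\<^sup>1) / 2\<close>;
  \<open>half\<close> is the inverse of 2 in \<open>k\<close>.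
\<close>

definition Theta_choice ::
  "('o, 'm, 'k::{comm_ring, comm_monoid_mult}) cdcat \<Rightarrow> 'k \<Rightarrow> (('o \<times> 'm) \<times> 'm \<Rightarrow> 'o)
    \<Rightarrow> (('o \<times> 'm) \<times> 'm \<Rightarrow> 'm) \<Rightarrow> (('o \<times> 'm) \<times> 'm \<Rightarrow> 'm) \<Rightarrow> bool" where
  "Theta_choice K half T t s \<longleftrightarrow> (let C = ucat K; \<iota> = cnj K in
     \<forall>X f g. ((X, f), g) \<in> Obj (ucat (double (double K))) \<longrightarrow>
       T ((X, f), g) \<in> Obj C \<and>
       t ((X, f), g) \<in> Hom C (T ((X, f), g)) X \<and>
       s ((X, f), g) \<in> Hom C X (T ((X, f), g)) \<and>
       s ((X, f), g) \<cdot>\<^bsub>C\<^esub> t ((X, f), g) = Idn C (T ((X, f), g)) \<and>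
       t ((X, f), g) \<cdot>\<^bsub>C\<^esub> s ((X, f), g)
         = half \<odot>\<^bsub>C\<^esub> (Idn C X \<oplus>\<^bsub>C\<^esub> \<ominus>\<^bsub>C\<^esub> (g \<cdot>\<^bsub>C\<^esub> Inv C (fob \<iota> X) X f)))"

definition Theta_fun ::
  "('o, 'm, 'k) cdcat \<Rightarrow> (('o \<times> 'm) \<times> 'm \<Rightarrow> 'o) \<Rightarrow> (('o \<times> 'm) \<times> 'm \<Rightarrow> 'm) \<Rightarrow> (('o \<times> 'm) \<times> 'm \<Rightarrow> 'm)
    \<Rightarrow> (('o \<times> 'm) \<times> 'm, 'm, 'o, 'm) fctr" where
  "Theta_fun K T t s = \<lparr>fob = T, fmor = (\<lambda>X1 X2 \<phi>. s X2 \<cdot>\<^bsub>ucat K\<^esub> \<phi> \<cdot>\<^bsub>ucat K\<^esub> t X1)\<rparr>"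

section \<open>The morphisms of categories with duality\<close>

text \<open>
  In the matrices below \<open>D(X \<oplus> \<iota> X)\<close> is decomposed as \<open>D X \<oplus> D \<iota> X\<close>, and \<open>\<iota> D(X \<oplus> \<iota> X)\<close> as
  \<open>\<iota> D X \<oplus> \<iota> D \<iota> X\<close>.
\<close>

definition D_sum :: "('o, 'm, 'k) cdcat \<Rightarrow> ('o \<Rightarrow> 'o \<Rightarrow> ('o, 'm) bip) \<Rightarrow> 'o \<Rightarrow> ('o, 'm) bip" where
  "D_sum K B X = bip_con (dua K) X (fob (cnj K) X) (dsum K B X)"

definition ID_sum :: "('o, 'm, 'k) cdcat \<Rightarrow> ('o \<Rightarrow> 'o \<Rightarrow> ('o, 'm) bip) \<Rightarrow> 'o \<Rightarrow> ('o, 'm) bip" where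
  "ID_sum K B X = bip_con (comp_con (cnj K) (dua K)) X (fob (cnj K) X) (dsum K B X)"

definition F_hat ::
  "('o, 'm, 'k::{comm_ring, comm_monoid_mult}) cdcat \<Rightarrow> ('o \<Rightarrow> 'o \<Rightarrow> ('o, 'm) bip)
    \<Rightarrow> ('o, 'm, 'o \<times> 'm, 'm) dmor" where
  "F_hat K B = (let C = ucat K; \<iota> = cnj K; D = dua K in
     (F_fun K B,
      \<lambda>X. mat C (dsum K B (fob D X)) (D_sum K B X)
            (Idn C (fob D X)) (Zer C (fob \<iota> (fob D X)) (fob D X))
            (Zer C (fob D X) (fob D (fob \<iota> X))) (\<ominus>\<^bsub>C\<^esub> alp K X)))"

definition F_check ::
  "('o, 'm, 'k) cdcat \<Rightarrow> ('o \<Rightarrow> 'o \<Rightarrow> ('o, 'm) bip) \<Rightarrow> ('o, 'm, 'o \<times> 'm, 'm) dmor" where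
  "F_check K B = (let C = ucat K; \<iota> = cnj K; D = dua K in
     (F_fun K B,
      \<lambda>X. mat C (dsum K B (fob \<iota> (fob D X))) (ID_sum K B X)
            (Idn C (fob \<iota> (fob D X))) (Zer C (fob \<iota> (fob \<iota> (fob D X))) (fob \<iota> (fob D X)))
            (Zer C (fob \<iota> (fob D X)) (fob \<iota> (fob D (fob \<iota> X))))
            (fmor \<iota> (fob \<iota> (fob D X)) (fob D (fob \<iota> X)) (alp K X))))"

definition G_hat :: "('o, 'm, 'k) cdcat \<Rightarrow> ('o \<times> 'm, 'm, 'o, 'm) dmor" where
  "G_hat K = (let C = ucat K; \<iota> = cnj K; D = dua K in
     (G_fun,
      \<lambda>(X, f). Inv C (fob \<iota> (fob D X)) (fob D (fob \<iota> X)) (alp K X) \<cdot>\<^bsub>C\<^esub> fmor D (fob \<iota> X) X f))"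

definition G_check :: "('o, 'm, 'k) cdcat \<Rightarrow> ('o \<times> 'm, 'm, 'o, 'm) dmor" where
  "G_check K = (let C = ucat K; \<iota> = cnj K; D = dua K in
     (G_fun,
      \<lambda>(X, f). fmor D X (fob \<iota> X) (Inv C (fob \<iota> X) X f) \<cdot>\<^bsub>C\<^esub> alp K X))"

definition Psi_hat ::
  "('o, 'm, 'k::{comm_ring, comm_monoid_mult}) cdcat \<Rightarrow> ('o \<Rightarrow> 'o \<Rightarrow> ('o, 'm) bip)
    \<Rightarrow> ('o, 'm, ('o \<times> 'm) \<times> 'm, 'm) dmor" where
  "Psi_hat K B = (let C = ucat K; \<iota> = cnj K; D = dua K in
     (Psi_fun K B,
      \<lambda>X. mat C (dsum K B (fob D X)) (ID_sum K B X)
            (Zer C (fob D X) (fob \<iota> (fob D X))) (Idn C (fob \<iota> (fob D X)))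
            (fmor \<iota> (fob \<iota> (fob D X)) (fob D (fob \<iota> X)) (alp K X)
              \<cdot>\<^bsub>C\<^esub> Inv C (fob \<iota> (fob \<iota> (fob D X))) (fob D X) (lam K (fob D X)))
            (Zer C (fob \<iota> (fob D X)) (fob \<iota> (fob D (fob \<iota> X))))))"

definition Psi_check ::
  "('o, 'm, 'k::{comm_ring, comm_monoid_mult}) cdcat \<Rightarrow> ('o \<Rightarrow> 'o \<Rightarrow> ('o, 'm) bip)
    \<Rightarrow> ('o, 'm, ('o \<times> 'm) \<times> 'm, 'm) dmor" where
  "Psi_check K B = (let C = ucat K; \<iota> = cnj K; D = dua K in
     (Psi_fun K B,
      \<lambda>X. mat C (dsum K B (fob \<iota> (fob D X))) (D_sum K B X)
            (Zer C (fob \<iota> (fob D X)) (fob D X)) (lam K (fob D X))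
            (\<ominus>\<^bsub>C\<^esub> alp K X) (Zer C (fob \<iota> (fob \<iota> (fob D X))) (fob D (fob \<iota> X)))))"

definition Theta_hat ::
  "('o, 'm, 'k::{comm_ring, comm_monoid_mult}) cdcat \<Rightarrow> (('o \<times> 'm) \<times> 'm \<Rightarrow> 'o)
    \<Rightarrow> (('o \<times> 'm) \<times> 'm \<Rightarrow> 'm) \<Rightarrow> (('o \<times> 'm) \<times> 'm \<Rightarrow> 'm) \<Rightarrow> (('o \<times> 'm) \<times> 'm, 'm, 'o, 'm) dmor" where
  "Theta_hat K T t s = (let C = ucat K; \<iota> = cnj K; D = dua K; D2 = dua (double (double K)) in
     (Theta_fun K T t s,
      \<lambda>((X, f), g). \<ominus>\<^bsub>C\<^esub> (fmor (comp_con \<iota> D) (T ((X, f), g)) X (t ((X, f), g))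
        \<cdot>\<^bsub>C\<^esub> Inv C (fob \<iota> (fob D X)) (fob D (fob \<iota> X)) (alp K X)
        \<cdot>\<^bsub>C\<^esub> fmor D (fob \<iota> X) X f
        \<cdot>\<^bsub>C\<^esub> t (fob D2 ((X, f), g)))))"

definition Theta_check ::
  "('o, 'm, 'k::{comm_ring, comm_monoid_mult}) cdcat \<Rightarrow> (('o \<times> 'm) \<times> 'm \<Rightarrow> 'o)
    \<Rightarrow> (('o \<times> 'm) \<times> 'm \<Rightarrow> 'm) \<Rightarrow> (('o \<times> 'm) \<times> 'm \<Rightarrow> 'm) \<Rightarrow> (('o \<times> 'm) \<times> 'm, 'm, 'o, 'm) dmor" where
  "Theta_check K T t s = (let C = ucat K; \<iota> = cnj K; D = dua K; K2 = double (double K) in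
     (Theta_fun K T t s,
      \<lambda>((X, f), g). fmor D (T ((X, f), g)) X (t ((X, f), g))
        \<cdot>\<^bsub>C\<^esub> fmor D X (fob \<iota> X) (Inv C (fob \<iota> X) X f)
        \<cdot>\<^bsub>C\<^esub> alp K X
        \<cdot>\<^bsub>C\<^esub> t (fob (cnj K2) (fob (dua K2) ((X, f), g)))))"

end

theory Submission
  imports Defs
begin

text \<open>
  For an object \<open>(C, f, g)\<close> of \<open>\<C>''\<close> put \<open>u = g f\<^sup>-\<^sup>1\<close>. The conditions on \<open>f\<close> and \<open>g\<close> say that \<open>u\<close> is an involution with
  \<open>u f = -f \<iota>(u)\<close>. As \<open>2\<close> is invertible, \<open>C\<close> splits into the eigenspaces of \<open>u\<close> for \<open>-1\<close> and \<open>1\<close>; the first is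
  \<open>\<Theta>(C, f, g)\<close> with inclusion \<open>t\<close>, and \<open>f\<close> identifies its conjugate with the second. Hence
  \<open>(t, f \<iota>(t)) : \<Theta>(C, f, g) \<oplus> \<iota>(\<Theta>(C, f, g)) \<rightarrow> C\<close> is an isomorphism. It carries \<open>\<Lambda>\<close> to \<open>f\<close> and \<open>\<Delta>\<close> to \<open>g\<close>, so it is an
  isomorphism \<open>\<Psi>\<Theta> \<cong> 1\<close> (lemmas \<open>aiso_rh\<close>, \<open>rh_La\<close>, \<open>rh_nat\<close>). Conversely, for \<open>\<Psi>(C)\<close> the involution is diagonal
  with entries \<open>-1\<close> and \<open>1\<close>, and the first projection gives \<open>\<Theta>\<Psi> \<cong> 1\<close> (lemma \<open>ee_La\<close>).

  Compatibility with the dualities is derived with as little matrix calculation as possible. The morphisms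
  \<open>F_hat\<close>, \<open>F_check\<close>, \<open>G_hat\<close> and \<open>G_check\<close> are verified directly from the axioms of a commutation. The components
  of \<open>G_check (double K)\<close> after \<open>Psi_hat\<close> are those of \<open>F_hat\<close>, and similarly for \<open>G_hat (double K)\<close> after
  \<open>Psi_check\<close> and \<open>F_check\<close>; a faithful functor reflects the defining equations of a morphism of categories
  with duality (\<open>dmorphism_reflectI\<close>), and so \<open>Psi_hat\<close> and \<open>Psi_check\<close> are such morphisms (\<open>G_Psi\<close>). The same
  equations can be transported along a natural isomorphism (\<open>dmorphism_transportI\<close>). Applied to \<open>\<Psi>\<Theta> \<cong> 1\<close>,
  this makes \<open>\<Psi>\<Theta>\<close> a morphism isomorphic to the identity, whose components turn out to be the composites of
  those of \<open>\<Psi>\<close> and \<open>\<Theta>\<close> (\<open>ps_thc\<close>, \<open>pk_thh\<close>); since \<open>\<Psi>\<close> is faithful, \<open>Theta_check\<close> and \<open>Theta_hat\<close> are morphisms as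
  well (\<open>Psi_Theta\<close>). That \<open>\<Theta>\<Psi> \<cong> 1\<close> respects the dualities is the computation in \<open>thc_La\<close> and \<open>thh_La\<close>.

  For an object \<open>F'(X, f)\<close> of \<open>\<C>''\<close> the involution exchanges the two summands up to \<open>f\<close>, hence the second component of
  \<open>t\<close> is \<open>-f\<^sup>-\<^sup>1\<close> times the first (\<open>p2_ut\<close>), and the first is an isomorphism from \<open>\<Theta>F'(X, f)\<close> to \<open>X = G(X, f)\<close>. Both
  summands contribute the same amount to the duality morphism of \<open>\<Theta>F'\<close>; this doubling, and a sign,
  account for the similarity factors \<open>1 / 2\<close> and \<open>-1 / 2\<close> (\<open>thc_double\<close>, \<open>thh_double\<close>).

  All these equations hold between arrows of \<open>\<C>\<close>, since morphisms of \<open>\<C>'\<close> and \<open>\<C>''\<close> are morphisms of \<open>\<C>\<close>. The sign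
  \<open>\<epsilon>\<close> is put in afterwards, by \<open>dmorphism_signed\<close>, for the morphisms \<open>F\<close> and \<open>G\<close>; the others inherit it.
\<close>

section \<open>Typed arrows\<close>

text \<open>
  The sets \<open>Hom C X Y\<close> may overlap, so a morphism does not determine its source and target, and every
  law of a linear category carries membership premises. A typed arrow records its source, its target
  and possibly a morphism; an ill-typed composite or sum is an arrow without morphism. Associativity and
  bilinearity then hold for all arrows and can be applied as unconditional rewrite rules, because
  either both sides are well typed or both carry no morphism.
\<close>

datatype ('o, 'm) arr = Arr (src: 'o) (tgt: 'o) (rep: "'m option")

definition mor :: "('o, 'm) arr \<Rightarrow> 'm" where
  "mor a = the (rep a)"

definition ok :: "('o, 'm, 'k) lcat \<Rightarrow> ('o, 'm) arr \<Rightarrow> bool" where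
  "ok C a \<longleftrightarrow> src a \<in> Obj C \<and> tgt a \<in> Obj C \<and> rep a \<in> Some ` Hom C (src a) (tgt a)"

definition acmp :: "('o, 'm, 'k) lcat \<Rightarrow> ('o, 'm) arr \<Rightarrow> ('o, 'm) arr \<Rightarrow> ('o, 'm) arr"
  (infixr "\<star>\<index>" 70) where
  "b \<star>\<^bsub>C\<^esub> a = Arr (src a) (tgt b)
     (if ok C b \<and> ok C a \<and> src b = tgt a then Some (mor b \<cdot>\<^bsub>C\<^esub> mor a) else None)"

definition aadd :: "('o, 'm, 'k) lcat \<Rightarrow> ('o, 'm) arr \<Rightarrow> ('o, 'm) arr \<Rightarrow> ('o, 'm) arr"
  (infixl "\<boxplus>\<index>" 65) where
  "a \<boxplus>\<^bsub>C\<^esub> b = Arr (src a) (tgt a)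
     (if ok C a \<and> ok C b \<and> src b = src a \<and> tgt b = tgt a then Some (mor a \<oplus>\<^bsub>C\<^esub> mor b) else None)"

definition ascl :: "('o, 'm, 'k) lcat \<Rightarrow> 'k \<Rightarrow> ('o, 'm) arr \<Rightarrow> ('o, 'm) arr"
  (infixr "\<bullet>\<index>" 75) where
  "r \<bullet>\<^bsub>C\<^esub> a = Arr (src a) (tgt a) (if ok C a then Some (r \<odot>\<^bsub>C\<^esub> mor a) else None)"

definition aid :: "('o, 'm, 'k) lcat \<Rightarrow> 'o \<Rightarrow> ('o, 'm) arr" where
  "aid C X = Arr X X (Some (Idn C X))"

definition azer :: "('o, 'm, 'k) lcat \<Rightarrow> 'o \<Rightarrow> 'o \<Rightarrow> ('o, 'm) arr" where
  "azer C X Y = Arr X Y (Some (Zer C X Y))"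

definition aiso :: "('o, 'm, 'k) lcat \<Rightarrow> ('o, 'm) arr \<Rightarrow> bool" where
  "aiso C a \<longleftrightarrow> ok C a \<and> isom C (src a) (tgt a) (mor a)"

definition ainv :: "('o, 'm, 'k) lcat \<Rightarrow> ('o, 'm) arr \<Rightarrow> ('o, 'm) arr" where
  "ainv C a = Arr (tgt a) (src a) (Some (Inv C (src a) (tgt a) (mor a)))"

lemma src_tgt [simp]:
  "src (b \<star>\<^bsub>C\<^esub> a) = src a" "tgt (b \<star>\<^bsub>C\<^esub> a) = tgt b"
  "src (a \<boxplus>\<^bsub>C\<^esub> b) = src a" "tgt (a \<boxplus>\<^bsub>C\<^esub> b) = tgt a"
  "src (r \<bullet>\<^bsub>C\<^esub> a) = src a" "tgt (r \<bullet>\<^bsub>C\<^esub> a) = tgt a"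
  "src (aid C X) = X" "tgt (aid C X) = X"
  "src (azer C X Y) = X" "tgt (azer C X Y) = Y"
  "src (ainv C a) = tgt a" "tgt (ainv C a) = src a"
  by (simp_all add: acmp_def aadd_def ascl_def aid_def azer_def ainv_def)

lemma ok_src: "ok C a \<Longrightarrow> src a \<in> Obj C"
  and ok_tgt: "ok C a \<Longrightarrow> tgt a \<in> Obj C"
  by (simp_all add: ok_def)

lemma ok_Arr [simp]: "ok C (Arr X Y (Some f)) \<longleftrightarrow> X \<in> Obj C \<and> Y \<in> Obj C \<and> f \<in> Hom C X Y"
  "\<not> ok C (Arr X Y None)"
  by (auto simp: ok_def)

lemma arr_cases:
  assumes "\<phi> \<in> Hom C X Y" "X \<in> Obj C" "Y \<in> Obj C"
  obtains a where "\<phi> = mor a" "ok C a" "src a = X" "tgt a = Y"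
  using assms that[of "Arr X Y (Some \<phi>)"] by (simp add: mor_def)

lemma iso_cases:
  assumes "isom C X Y \<phi>" "X \<in> Obj C" "Y \<in> Obj C"
  obtains a where "\<phi> = mor a" "ok C a" "aiso C a" "src a = X" "tgt a = Y"
  using assms that[of "Arr X Y (Some \<phi>)"] by (simp add: aiso_def isom_def mor_def)

lemma mor_in_Hom: "\<lbrakk>ok C a; src a = X; tgt a = Y\<rbrakk> \<Longrightarrow> mor a \<in> Hom C X Y"
  by (auto simp: ok_def mor_def)

lemma ok_iff: "ok C a \<longleftrightarrow>
    src a \<in> Obj C \<and> tgt a \<in> Obj C \<and> rep a = Some (mor a) \<and> mor a \<in> Hom C (src a) (tgt a)"
  by (auto simp: ok_def mor_def)

declare ok_src [simp] ok_tgt [simp] mor_in_Hom [simp]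

lemma mor_eq_iff:
  "\<lbrakk>ok C a; ok C b; src a = src b; tgt a = tgt b\<rbrakk> \<Longrightarrow> mor a = mor b \<longleftrightarrow> a = b"
  by (metis arr.exhaust_sel ok_iff)

lemma mor_aid: "Idn C X = mor (aid C X)"
  by (simp add: aid_def mor_def)

lemma mor_azer: "Zer C X Y = mor (azer C X Y)"
  by (simp add: azer_def mor_def)

lemma mor_acmp: "\<lbrakk>ok C b; ok C a; src b = tgt a\<rbrakk> \<Longrightarrow> mor b \<cdot>\<^bsub>C\<^esub> mor a = mor (b \<star>\<^bsub>C\<^esub> a)"
  by (simp add: acmp_def mor_def)

lemma mor_aadd:
  "\<lbrakk>ok C a; ok C b; src b = src a; tgt b = tgt a\<rbrakk> \<Longrightarrow> mor a \<oplus>\<^bsub>C\<^esub> mor b = mor (a \<boxplus>\<^bsub>C\<^esub> b)"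
  by (simp add: aadd_def mor_def)

lemma mor_ascl: "ok C a \<Longrightarrow> r \<odot>\<^bsub>C\<^esub> mor a = mor (r \<bullet>\<^bsub>C\<^esub> a)"
  by (simp add: ascl_def mor_def)

lemma mor_aneg: "ok C a \<Longrightarrow> \<ominus>\<^bsub>C\<^esub> mor a = mor ((- 1) \<bullet>\<^bsub>C\<^esub> a)"
  by (simp add: ascl_def Neg_def mor_def)

lemma mor_ainv: "\<lbrakk>src a = X; tgt a = Y\<rbrakk> \<Longrightarrow> Inv C X Y (mor a) = mor (ainv C a)"
  by (auto simp add: ainv_def mor_def)

lemma isom_mor: "\<lbrakk>ok C a; src a = X; tgt a = Y\<rbrakk> \<Longrightarrow> isom C X Y (mor a) \<longleftrightarrow> aiso C a"
  by (auto simp: aiso_def)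

text \<open>
  These rules collect an expression of raw morphisms into the form \<open>mor a\<close>; by \<open>mor_eq_iff\<close> an equation
  between two such expressions becomes an equation between typed arrows.
\<close>

lemmas to_arr = mor_aid mor_azer mor_acmp mor_aadd mor_ascl mor_aneg mor_ainv isom_mor

context linear_category
begin

declare mor_eq_iff [of C, simp]

lemma ok_aid [simp]: "X \<in> Obj C \<Longrightarrow> ok C (aid C X)"
  by (simp add: aid_def Idn_in)

lemma ok_azer [simp]: "\<lbrakk>X \<in> Obj C; Y \<in> Obj C\<rbrakk> \<Longrightarrow> ok C (azer C X Y)"
  by (simp add: azer_def Zer_in)

lemma ok_acmp [simp]: "\<lbrakk>ok C b; ok C a; src b = tgt a\<rbrakk> \<Longrightarrow> ok C (b \<star> a)"
  using Cmp_in[of "src a" "tgt a" "tgt b" "mor a" "mor b"] by (simp add: acmp_def)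

lemma ok_acmp_iff: "ok C (b \<star> a) \<longleftrightarrow> ok C b \<and> ok C a \<and> src b = tgt a"
  using ok_acmp[of b a] by (auto simp: acmp_def)

lemma ok_aadd [simp]: "\<lbrakk>ok C a; ok C b; src b = src a; tgt b = tgt a\<rbrakk> \<Longrightarrow> ok C (a \<boxplus> b)"
  using Add_in[of "src a" "tgt a" "mor a" "mor b"] by (simp add: aadd_def)

lemma ok_aadd_iff: "ok C (a \<boxplus> b) \<longleftrightarrow> ok C a \<and> ok C b \<and> src b = src a \<and> tgt b = tgt a"
  using ok_aadd[of a b] by (auto simp: aadd_def)

lemma ok_ascl_iff [simp]: "ok C (r \<bullet> a) \<longleftrightarrow> ok C a"
  using Scl_in[of "src a" "tgt a" "mor a"] by (auto simp: ascl_def)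

lemmas ok_iffs = ok_acmp_iff ok_aadd_iff

lemma rep_not_ok:
  "\<not> ok C (b \<star> a) \<Longrightarrow> rep (b \<star> a) = None"
  "\<not> ok C (a \<boxplus> b) \<Longrightarrow> rep (a \<boxplus> b) = None"
  "\<not> ok C (r \<bullet> a) \<Longrightarrow> rep (r \<bullet> a) = None"
  unfolding ok_iffs ok_ascl_iff by (auto simp: acmp_def aadd_def ascl_def)

lemma arr_eqI: "\<lbrakk>ok C a; ok C b; src a = src b; tgt a = tgt b; mor a = mor b\<rbrakk> \<Longrightarrow> a = b"
  by simp

lemma arr_eqI': "\<lbrakk>src a = src b; tgt a = tgt b; rep a = None; rep b = None\<rbrakk> \<Longrightarrow> a = b"
  by (simp add: arr.expand)

lemma acmp_assoc [simp]: "(c \<star> b) \<star> a = c \<star> (b \<star> a)"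
proof (cases "ok C ((c \<star> b) \<star> a)")
  case True
  then show ?thesis
    by (intro arr_eqI) (auto simp: ok_iffs mor_acmp[symmetric] Cmp_assoc[of "src a" "tgt a" "tgt b" "tgt c"])
next
  case False
  then show ?thesis
    by (intro arr_eqI') (auto simp: rep_not_ok ok_iffs)
qed

text \<open>
  Composites are normalised to the right, so every equation \<open>a \<star> b = c\<close> that is to be used for rewriting is
  also needed inside \<open>a \<star> (b \<star> d)\<close>.
\<close>

lemma acmp_reassoc: "a \<star> b = c \<Longrightarrow> a \<star> (b \<star> d) = c \<star> d"
  by (metis acmp_assoc)

lemma aid_left [simp]: "\<lbrakk>ok C a; tgt a = X\<rbrakk> \<Longrightarrow> aid C X \<star> a = a"
  by (intro arr_eqI) (auto simp: mor_acmp[symmetric] mor_aid[symmetric] Idn_left[of "src a"])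

lemma aid_right [simp]: "\<lbrakk>ok C a; src a = X\<rbrakk> \<Longrightarrow> a \<star> aid C X = a"
  by (intro arr_eqI) (auto simp: mor_acmp[symmetric] mor_aid[symmetric] Idn_right[of _ "tgt a"])

lemma aadd_commute: "\<lbrakk>src b = src a; tgt b = tgt a\<rbrakk> \<Longrightarrow> a \<boxplus> b = b \<boxplus> a"
  by (auto simp: aadd_def intro!: Add_commute[of "src a" "tgt a"])

lemma aadd_assoc [simp]: "(a \<boxplus> b) \<boxplus> c = a \<boxplus> (b \<boxplus> c)"
proof (cases "ok C ((a \<boxplus> b) \<boxplus> c)")
  case True
  then show ?thesis
    by (intro arr_eqI) (auto simp: ok_iffs mor_aadd[symmetric] Add_assoc[of "src a" "tgt a"])
next
  case False
  then show ?thesis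
    by (intro arr_eqI'; simp only: rep_not_ok src_tgt) (auto intro!: rep_not_ok simp: ok_iffs)
qed

lemma aadd_left_commute: "\<lbrakk>src b = src a; tgt b = tgt a\<rbrakk> \<Longrightarrow> a \<boxplus> (b \<boxplus> c) = b \<boxplus> (a \<boxplus> c)"
  by (metis aadd_assoc aadd_commute)

lemmas aadd_ac = aadd_commute aadd_left_commute

lemma acmp_aadd [simp]: "c \<star> (a \<boxplus> b) = c \<star> a \<boxplus> c \<star> b"
proof (cases "ok C (c \<star> (a \<boxplus> b))")
  case True
  then show ?thesis
    by (intro arr_eqI) (auto simp: ok_iffs mor_acmp[symmetric] mor_aadd[symmetric] Cmp_Add_right[of "src a" "tgt a" "tgt c"])
next
  case False
  then show ?thesis
    by (intro arr_eqI') (auto simp: rep_not_ok ok_iffs)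
qed

lemma aadd_acmp [simp]: "(a \<boxplus> b) \<star> c = a \<star> c \<boxplus> b \<star> c"
proof (cases "ok C ((a \<boxplus> b) \<star> c)")
  case True
  then show ?thesis
    by (intro arr_eqI) (auto simp: ok_iffs mor_acmp[symmetric] mor_aadd[symmetric] Cmp_Add_left[of "src c" "tgt c" "tgt a"])
next
  case False
  then show ?thesis
    by (intro arr_eqI'; simp only: rep_not_ok src_tgt) (auto intro!: rep_not_ok simp: ok_iffs)
qed

lemma acmp_ascl [simp]: "b \<star> (r \<bullet> a) = r \<bullet> (b \<star> a)"
proof (cases "ok C (b \<star> (r \<bullet> a))")
  case True
  then show ?thesis
    by (intro arr_eqI) (auto simp: ok_iffs mor_acmp[symmetric] mor_ascl[symmetric] Cmp_Scl_right[of "src a" "tgt a" "tgt b"])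
next
  case False
  then show ?thesis
    by (intro arr_eqI') (auto simp: rep_not_ok ok_iffs)
qed

lemma ascl_acmp [simp]: "(r \<bullet> b) \<star> a = r \<bullet> (b \<star> a)"
proof (cases "ok C ((r \<bullet> b) \<star> a)")
  case True
  then show ?thesis
    by (intro arr_eqI) (auto simp: ok_iffs mor_acmp[symmetric] mor_ascl[symmetric] Cmp_Scl_left[of "src a" "tgt a" "tgt b"])
next
  case False
  then show ?thesis
    by (intro arr_eqI') (auto simp: rep_not_ok ok_iffs)
qed

lemma ascl_aadd [simp]: "r \<bullet> (a \<boxplus> b) = r \<bullet> a \<boxplus> r \<bullet> b"
proof (cases "ok C (r \<bullet> (a \<boxplus> b))")
  case True
  then show ?thesis
    by (intro arr_eqI) (auto simp: ok_iffs mor_aadd[symmetric] mor_ascl[symmetric] Scl_Add[of "src a" "tgt a"])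
next
  case False
  then show ?thesis
    by (intro arr_eqI') (auto simp: rep_not_ok ok_iffs)
qed

lemma ascl_ascl [simp]: "r \<bullet> (q \<bullet> a) = (r * q) \<bullet> a"
proof (cases "ok C (r \<bullet> (q \<bullet> a))")
  case True
  then show ?thesis
    by (intro arr_eqI) (auto simp: ok_iffs mor_ascl[symmetric] mult_Scl[of "src a" "tgt a"])
next
  case False
  then show ?thesis
    by (intro arr_eqI') (auto simp: rep_not_ok ok_iffs)
qed

lemma ascl_one [simp]: "ok C a \<Longrightarrow> 1 \<bullet> a = a"
  by (intro arr_eqI) (simp_all add: mor_ascl[symmetric] one_Scl[of "src a" "tgt a"])

lemma ascl_add: "r \<bullet> a \<boxplus> q \<bullet> a = (r + q) \<bullet> a"
proof (cases "ok C (r \<bullet> a \<boxplus> q \<bullet> a)")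
  case True
  then show ?thesis
    by (intro arr_eqI) (auto simp: ok_iffs mor_aadd[symmetric] mor_ascl[symmetric] add_Scl[of "src a" "tgt a"])
next
  case False
  then show ?thesis
    by (intro arr_eqI') (auto simp: rep_not_ok ok_iffs)
qed

lemma aadd_azer [simp]: "\<lbrakk>ok C a; src a = X; tgt a = Y\<rbrakk> \<Longrightarrow> a \<boxplus> azer C X Y = a"
  by (intro arr_eqI) (auto simp: mor_aadd[symmetric] mor_azer[symmetric] Add_Zer)

lemma azer_aadd [simp]: "\<lbrakk>ok C a; src a = X; tgt a = Y\<rbrakk> \<Longrightarrow> azer C X Y \<boxplus> a = a"
  by (metis aadd_azer aadd_commute src_tgt(9,10))

lemma aadd_inverse_ex:
  assumes "ok C a"
  obtains b where "ok C b" "src b = src a" "tgt b = tgt a" "a \<boxplus> b = azer C (src a) (tgt a)"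
proof -
  obtain g where "g \<in> Hom C (src a) (tgt a)" "mor a \<oplus> g = Zer C (src a) (tgt a)"
    using Add_inverse[of "src a" "tgt a" "mor a"] assms by auto
  then show ?thesis
    using assms by (auto elim!: arr_cases intro: that simp: to_arr)
qed

text \<open>
  The axioms do not mention scalar multiplication by \<open>0\<close>; as \<open>0 \<bullet> a\<close> is additively idempotent, it is zero.
\<close>

lemma aadd_idem:
  assumes "ok C a" "a \<boxplus> a = a"
  shows "a = azer C (src a) (tgt a)"
proof -
  obtain b where b: "ok C b" "src b = src a" "tgt b = tgt a" "a \<boxplus> b = azer C (src a) (tgt a)"
    using aadd_inverse_ex assms(1) by blast
  have "a = a \<boxplus> (a \<boxplus> b)" using b assms by simp
  also have "\<dots> = a \<boxplus> b" using assms(2) by (metis aadd_assoc)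
  finally show ?thesis using b by simp
qed

lemma ascl_zero [simp]: "ok C a \<Longrightarrow> 0 \<bullet> a = azer C (src a) (tgt a)"
  using aadd_idem[of "0 \<bullet> a"] by (simp add: ascl_add)

lemma ascl_azer [simp]: "\<lbrakk>X \<in> Obj C; Y \<in> Obj C\<rbrakk> \<Longrightarrow> r \<bullet> azer C X Y = azer C X Y"
  using ascl_ascl[of r 0 "azer C X Y"] by simp

lemma acmp_azer [simp]: "\<lbrakk>ok C b; src b = Y; X \<in> Obj C\<rbrakk> \<Longrightarrow> b \<star> azer C X Y = azer C X (tgt b)"
  using acmp_ascl[of b 0 "azer C X Y"] ok_tgt by fastforce

lemma azer_acmp [simp]: "\<lbrakk>ok C a; tgt a = X; Y \<in> Obj C\<rbrakk> \<Longrightarrow> azer C X Y \<star> a = azer C (src a) Y"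
  using ascl_acmp[of 0 "azer C X Y" a] ok_src by fastforce

lemma aadd_neg [simp]: "ok C a \<Longrightarrow> a \<boxplus> (- 1) \<bullet> a = azer C (src a) (tgt a)"
  "ok C a \<Longrightarrow> (- 1) \<bullet> a \<boxplus> a = azer C (src a) (tgt a)"
  using ascl_add[of 1 a "- 1"] ascl_add[of "- 1" a 1] by simp_all

lemma neg_aadd_left [simp]:
  "\<lbrakk>ok C a; ok C b; src b = src a; tgt b = tgt a\<rbrakk> \<Longrightarrow> (- 1) \<bullet> a \<boxplus> (a \<boxplus> b) = b"
  by (simp add: aadd_assoc[symmetric])

subsection \<open>Isomorphisms\<close>

lemma Inv_mor:
  assumes "ok C a" "ok C b" "src b = tgt a" "tgt b = src a"
    "b \<star> a = aid C (src a)" "a \<star> b = aid C (tgt a)"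
  shows "Inv C (src a) (tgt a) (mor a) = mor b"
  unfolding Inv_def
proof (rule the_equality)
  show "mor b \<in> Hom C (tgt a) (src a) \<and> mor b \<cdot> mor a = Idn C (src a) \<and> mor a \<cdot> mor b = Idn C (tgt a)"
    using assms by (simp add: to_arr)
next
  fix g
  assume g: "g \<in> Hom C (tgt a) (src a) \<and> g \<cdot> mor a = Idn C (src a) \<and> mor a \<cdot> g = Idn C (tgt a)"
  then obtain c where c: "g = mor c" "ok C c" "src c = tgt a" "tgt c = src a"
    using assms(1) by (metis arr_cases ok_src ok_tgt)
  have ca: "c \<star> a = aid C (src a)"
    using g c assms by (simp add: to_arr)
  have "c = c \<star> (a \<star> b)" using c assms by simp
  also have "\<dots> = b" using ca assms by (metis acmp_assoc aid_left)
  finally show "g = mor b" by (simp add: c)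
qed

lemma
  assumes "ok C a" "ok C b" "src b = tgt a" "tgt b = src a"
    "b \<star> a = aid C (src a)" "a \<star> b = aid C (tgt a)"
  shows aisoI: "aiso C a" and ainv_eqI: "ainv C a = b"
proof -
  show "aiso C a" unfolding aiso_def isom_def
    using assms by (auto intro!: bexI[of _ "mor b"] simp: to_arr)
  show "ainv C a = b"
    using Inv_mor[OF assms] assms(3,4) iffD1[OF ok_iff assms(2)]
    by (intro arr.expand) (simp add: ainv_def)
qed

lemma aiso_inverse:
  assumes "aiso C a"
  obtains b where "ok C b" "src b = tgt a" "tgt b = src a"
    "b \<star> a = aid C (src a)" "a \<star> b = aid C (tgt a)"
proof -
  have a: "ok C a" using assms by (simp add: aiso_def)
  obtain g where g: "g \<in> Hom C (tgt a) (src a)" "g \<cdot> mor a = Idn C (src a)" "mor a \<cdot> g = Idn C (tgt a)"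
    using assms by (auto simp: aiso_def isom_def)
  obtain c where c: "g = mor c" "ok C c" "src c = tgt a" "tgt c = src a"
    using a arr_cases[OF g(1)] by auto
  show thesis
    by (rule that[of c]) (use a c g in \<open>simp_all add: to_arr\<close>)
qed

lemma ok_aiso: "aiso C a \<Longrightarrow> ok C a"
  by (simp add: aiso_def)

lemma ainv_simps [simp]:
  assumes "aiso C a"
  shows "ok C (ainv C a)" "ainv C a \<star> a = aid C (src a)" "a \<star> ainv C a = aid C (tgt a)"
    "aiso C (ainv C a)" "ainv C (ainv C a) = a"
proof -
  obtain b where "ok C b" "src b = tgt a" "tgt b = src a"
    "b \<star> a = aid C (src a)" "a \<star> b = aid C (tgt a)"
    using aiso_inverse assms by blast
  then show "ok C (ainv C a)" "ainv C a \<star> a = aid C (src a)" "a \<star> ainv C a = aid C (tgt a)"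
    "aiso C (ainv C a)" "ainv C (ainv C a) = a"
    using ainv_eqI[of a b] aisoI[of b a] ainv_eqI[of b a] ok_aiso[OF assms] by simp_all
qed

lemma ainv_cancel [simp]:
  "\<lbrakk>aiso C a; ok C c; tgt c = src a\<rbrakk> \<Longrightarrow> ainv C a \<star> (a \<star> c) = c"
  "\<lbrakk>aiso C a; ok C c; tgt c = tgt a\<rbrakk> \<Longrightarrow> a \<star> (ainv C a \<star> c) = c"
  by (simp_all flip: acmp_assoc)

lemma aiso_cancel_left:
  assumes "aiso C c" "ok C a" "ok C b" "tgt a = src c" "tgt b = src c" "c \<star> a = c \<star> b"
  shows "a = b"
  using assms by (metis ainv_cancel(1))

lemma aiso_aid [simp]: "X \<in> Obj C \<Longrightarrow> aiso C (aid C X)"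
  by (auto intro: aisoI[of _ "aid C X"])

lemma aiso_acmp [simp]:
  assumes "aiso C a" "aiso C b" "src b = tgt a"
  shows "aiso C (b \<star> a)" "ainv C (b \<star> a) = ainv C a \<star> ainv C b"
  using assms aisoI[of "b \<star> a" "ainv C a \<star> ainv C b"] ainv_eqI[of "b \<star> a" "ainv C a \<star> ainv C b"]
  by (simp_all add: ok_aiso)

lemma aiso_ascl:
  assumes "aiso C a" "r * q = 1"
  shows "aiso C (r \<bullet> a)" "ainv C (r \<bullet> a) = q \<bullet> ainv C a"
  using assms aisoI[of "r \<bullet> a" "q \<bullet> ainv C a"] ainv_eqI[of "r \<bullet> a" "q \<bullet> ainv C a"]
  by (simp_all add: ok_aiso mult.commute)

lemma aiso_neg [simp]:
  assumes "aiso C a"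
  shows "aiso C ((- 1) \<bullet> a)" "ainv C ((- 1) \<bullet> a) = (- 1) \<bullet> ainv C a"
  using assms aiso_ascl[of a "- 1" "- 1"] by simp_all

end

section \<open>Functors on arrows\<close>

definition acov :: "('o1, 'm1, 'k) lcat \<Rightarrow> ('o1, 'm1, 'o2, 'm2) fctr \<Rightarrow> ('o1, 'm1) arr \<Rightarrow> ('o2, 'm2) arr" where
  "acov C F a = Arr (fob F (src a)) (fob F (tgt a))
     (if ok C a then Some (fmor F (src a) (tgt a) (mor a)) else None)"

definition acon :: "('o1, 'm1, 'k) lcat \<Rightarrow> ('o1, 'm1, 'o2, 'm2) fctr \<Rightarrow> ('o1, 'm1) arr \<Rightarrow> ('o2, 'm2) arr" where
  "acon C F a = Arr (fob F (tgt a)) (fob F (src a))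
     (if ok C a then Some (fmor F (src a) (tgt a) (mor a)) else None)"

lemma mor_acov: "\<lbrakk>ok C a; src a = X; tgt a = Y\<rbrakk> \<Longrightarrow> fmor F X Y (mor a) = mor (acov C F a)"
  by (auto simp: acov_def mor_def)

lemma mor_acon: "\<lbrakk>ok C a; src a = X; tgt a = Y\<rbrakk> \<Longrightarrow> fmor F X Y (mor a) = mor (acon C F a)"
  by (auto simp: acon_def mor_def)

lemma mor_acov': "ok C a \<Longrightarrow> mor (acov C F a) = fmor F (src a) (tgt a) (mor a)"
  and mor_acon': "ok C a \<Longrightarrow> mor (acon C F a) = fmor F (src a) (tgt a) (mor a)"
  by (simp_all add: acov_def acon_def mor_def)

locale cov_functor = C1: linear_category C1 + C2: linear_category C2
  for C1 :: "('o1, 'm1, 'k::{comm_ring, comm_monoid_mult}) lcat"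
    and C2 :: "('o2, 'm2, 'k) lcat" +
  fixes F :: "('o1, 'm1, 'o2, 'm2) fctr"
  assumes is_functor: "covariant_functor C1 C2 F"
begin

abbreviation "fo \<equiv> fob F"
abbreviation "fa \<equiv> acov C1 F"

lemma fob_in [simp]: "X \<in> Obj C1 \<Longrightarrow> fo X \<in> Obj C2"
  using is_functor by (simp add: covariant_functor_def)

lemma acov_src_tgt [simp]: "src (fa a) = fo (src a)" "tgt (fa a) = fo (tgt a)"
  by (simp_all add: acov_def)

lemma fmor_mor: "\<lbrakk>ok C1 a; src a = X; tgt a = Y\<rbrakk> \<Longrightarrow> fmor F X Y (mor a) = mor (fa a)"
  by (rule mor_acov)

lemma acov_not_ok: "\<not> ok C1 a \<Longrightarrow> rep (fa a) = None" "\<not> ok C1 a \<Longrightarrow> \<not> ok C2 (fa a)"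
  by (auto simp: acov_def)

lemma ok_acov [simp]: "ok C1 a \<Longrightarrow> ok C2 (fa a)"
  using is_functor by (simp add: acov_def covariant_functor_def)

lemma fmor_Cmp:
  "\<lbrakk>X \<in> Obj C1; Y \<in> Obj C1; Z \<in> Obj C1; \<phi> \<in> Hom C1 X Y; \<psi> \<in> Hom C1 Y Z\<rbrakk>
    \<Longrightarrow> fmor F X Z (\<psi> \<cdot>\<^bsub>C1\<^esub> \<phi>) = fmor F Y Z \<psi> \<cdot>\<^bsub>C2\<^esub> fmor F X Y \<phi>"
  using is_functor by (simp add: covariant_functor_def)

lemma fmor_Add:
  "\<lbrakk>X \<in> Obj C1; Y \<in> Obj C1; \<phi> \<in> Hom C1 X Y; \<psi> \<in> Hom C1 X Y\<rbrakk>
    \<Longrightarrow> fmor F X Y (\<phi> \<oplus>\<^bsub>C1\<^esub> \<psi>) = fmor F X Y \<phi> \<oplus>\<^bsub>C2\<^esub> fmor F X Y \<psi>"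
  using is_functor by (simp add: covariant_functor_def)

lemma fmor_Scl:
  "\<lbrakk>X \<in> Obj C1; Y \<in> Obj C1; \<phi> \<in> Hom C1 X Y\<rbrakk>
    \<Longrightarrow> fmor F X Y (r \<odot>\<^bsub>C1\<^esub> \<phi>) = r \<odot>\<^bsub>C2\<^esub> fmor F X Y \<phi>"
  using is_functor by (simp add: covariant_functor_def)

lemma acov_aid [simp]: "X \<in> Obj C1 \<Longrightarrow> fa (aid C1 X) = aid C2 (fo X)"
  using is_functor by (intro C2.arr_eqI) (simp_all add: mor_acov' mor_aid[symmetric] covariant_functor_def)

lemma acov_acmp [simp]: "src b = tgt a \<Longrightarrow> fa (b \<star>\<^bsub>C1\<^esub> a) = fa b \<star>\<^bsub>C2\<^esub> fa a"
proof (cases "ok C1 a \<and> ok C1 b")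
  case True
  moreover assume "src b = tgt a"
  ultimately show ?thesis
    by (intro C2.arr_eqI)
      (simp_all add: mor_acov' mor_acmp[symmetric] fmor_Cmp[of "src a" "tgt a" "tgt b"])
next
  case False
  then show ?thesis
    by (intro C2.arr_eqI') (auto simp: acov_not_ok C1.ok_iffs C2.ok_iffs C1.rep_not_ok C2.rep_not_ok)
qed

lemma acov_aadd [simp]:
  "\<lbrakk>src b = src a; tgt b = tgt a\<rbrakk> \<Longrightarrow> fa (b \<boxplus>\<^bsub>C1\<^esub> a) = fa b \<boxplus>\<^bsub>C2\<^esub> fa a"
proof (cases "ok C1 a \<and> ok C1 b")
  case True
  moreover assume "src b = src a" "tgt b = tgt a"
  ultimately show ?thesis
    by (intro C2.arr_eqI)
      (simp_all add: mor_acov' mor_aadd[symmetric] fmor_Add)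
next
  case False
  then show ?thesis
    by (intro C2.arr_eqI') (auto simp: acov_not_ok C1.ok_iffs C2.ok_iffs C1.rep_not_ok C2.rep_not_ok)
qed

lemma acov_ascl [simp]: "fa (r \<bullet>\<^bsub>C1\<^esub> a) = r \<bullet>\<^bsub>C2\<^esub> fa a"
proof (cases "ok C1 a")
  case True
  then show ?thesis
    by (intro C2.arr_eqI)
      (simp_all add: mor_acov' mor_ascl[symmetric] fmor_Scl)
next
  case False
  then show ?thesis
    by (intro C2.arr_eqI') (auto simp: acov_not_ok C1.ok_iffs C2.ok_iffs C1.rep_not_ok C2.rep_not_ok)
qed

lemma acov_azer [simp]: "\<lbrakk>X \<in> Obj C1; Y \<in> Obj C1\<rbrakk> \<Longrightarrow> fa (azer C1 X Y) = azer C2 (fo X) (fo Y)"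
  using acov_ascl[of 0 "azer C1 X Y"] by simp

lemma acov_aiso [simp]:
  assumes "aiso C1 a"
  shows "aiso C2 (fa a)" "ainv C2 (fa a) = fa (ainv C1 a)"
proof -
  have *: "fa (ainv C1 a) \<star>\<^bsub>C2\<^esub> fa a = fa (ainv C1 a \<star>\<^bsub>C1\<^esub> a)"
    "fa a \<star>\<^bsub>C2\<^esub> fa (ainv C1 a) = fa (a \<star>\<^bsub>C1\<^esub> ainv C1 a)"
    by (simp_all only: acov_acmp src_tgt)
  show "aiso C2 (fa a)" "ainv C2 (fa a) = fa (ainv C1 a)"
    using assms * C2.aisoI[of "fa a" "fa (ainv C1 a)"] C2.ainv_eqI[of "fa a" "fa (ainv C1 a)"]
    by (simp_all add: C1.ok_aiso)
qed

text \<open>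
  The rule \<open>acov_acmp\<close> pushes the functor into a composite, so an equation \<open>b \<star> a = 1\<close> or \<open>b \<star> a = 0\<close> is met
  under the functor with the two factors already separated.
\<close>

lemma acov_cancel:
  assumes "b \<star>\<^bsub>C1\<^esub> a = aid C1 (src a)" "ok C1 a" "ok C1 b" "src b = tgt a"
  shows "fa b \<star>\<^bsub>C2\<^esub> fa a = aid C2 (fo (src a))"
    "ok C2 c \<Longrightarrow> tgt c = fo (src a) \<Longrightarrow> fa b \<star>\<^bsub>C2\<^esub> (fa a \<star>\<^bsub>C2\<^esub> c) = c"
proof -
  show *: "fa b \<star>\<^bsub>C2\<^esub> fa a = aid C2 (fo (src a))"
    using assms acov_acmp[of b a] by simp
  show "fa b \<star>\<^bsub>C2\<^esub> (fa a \<star>\<^bsub>C2\<^esub> c) = c" if "ok C2 c" "tgt c = fo (src a)"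
    using that * by (simp flip: C2.acmp_assoc)
qed

lemma acov_vanish:
  assumes "b \<star>\<^bsub>C1\<^esub> a = azer C1 (src a) (tgt b)" "ok C1 a" "ok C1 b" "src b = tgt a"
  shows "fa b \<star>\<^bsub>C2\<^esub> fa a = azer C2 (fo (src a)) (fo (tgt b))"
    "ok C2 c \<Longrightarrow> tgt c = fo (src a) \<Longrightarrow> fa b \<star>\<^bsub>C2\<^esub> (fa a \<star>\<^bsub>C2\<^esub> c) = azer C2 (src c) (fo (tgt b))"
proof -
  show *: "fa b \<star>\<^bsub>C2\<^esub> fa a = azer C2 (fo (src a)) (fo (tgt b))"
    using assms acov_acmp[of b a] by simp
  show "fa b \<star>\<^bsub>C2\<^esub> (fa a \<star>\<^bsub>C2\<^esub> c) = azer C2 (src c) (fo (tgt b))" if "ok C2 c" "tgt c = fo (src a)"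
    using that * assms by (simp flip: C2.acmp_assoc)
qed

end

locale con_functor = C1: linear_category C1 + C2: linear_category C2
  for C1 :: "('o1, 'm1, 'k::{comm_ring, comm_monoid_mult}) lcat"
    and C2 :: "('o2, 'm2, 'k) lcat" +
  fixes F :: "('o1, 'm1, 'o2, 'm2) fctr"
  assumes is_functor: "contravariant_functor C1 C2 F"
begin

abbreviation "fo \<equiv> fob F"
abbreviation "fa \<equiv> acon C1 F"

lemma fob_in [simp]: "X \<in> Obj C1 \<Longrightarrow> fo X \<in> Obj C2"
  using is_functor by (simp add: contravariant_functor_def)

lemma acon_src_tgt [simp]: "src (fa a) = fo (tgt a)" "tgt (fa a) = fo (src a)"
  by (simp_all add: acon_def)

lemma fmor_mor: "\<lbrakk>ok C1 a; src a = X; tgt a = Y\<rbrakk> \<Longrightarrow> fmor F X Y (mor a) = mor (fa a)"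
  by (rule mor_acon)

lemma acon_not_ok: "\<not> ok C1 a \<Longrightarrow> rep (fa a) = None" "\<not> ok C1 a \<Longrightarrow> \<not> ok C2 (fa a)"
  by (auto simp: acon_def)

lemma ok_acon [simp]: "ok C1 a \<Longrightarrow> ok C2 (fa a)"
  using is_functor by (simp add: acon_def contravariant_functor_def)

lemma fmor_Cmp:
  "\<lbrakk>X \<in> Obj C1; Y \<in> Obj C1; Z \<in> Obj C1; \<phi> \<in> Hom C1 X Y; \<psi> \<in> Hom C1 Y Z\<rbrakk>
    \<Longrightarrow> fmor F X Z (\<psi> \<cdot>\<^bsub>C1\<^esub> \<phi>) = fmor F X Y \<phi> \<cdot>\<^bsub>C2\<^esub> fmor F Y Z \<psi>"
  using is_functor by (simp add: contravariant_functor_def)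

lemma fmor_Add:
  "\<lbrakk>X \<in> Obj C1; Y \<in> Obj C1; \<phi> \<in> Hom C1 X Y; \<psi> \<in> Hom C1 X Y\<rbrakk>
    \<Longrightarrow> fmor F X Y (\<phi> \<oplus>\<^bsub>C1\<^esub> \<psi>) = fmor F X Y \<phi> \<oplus>\<^bsub>C2\<^esub> fmor F X Y \<psi>"
  using is_functor by (simp add: contravariant_functor_def)

lemma fmor_Scl:
  "\<lbrakk>X \<in> Obj C1; Y \<in> Obj C1; \<phi> \<in> Hom C1 X Y\<rbrakk>
    \<Longrightarrow> fmor F X Y (r \<odot>\<^bsub>C1\<^esub> \<phi>) = r \<odot>\<^bsub>C2\<^esub> fmor F X Y \<phi>"
  using is_functor by (simp add: contravariant_functor_def)

lemma acon_aid [simp]: "X \<in> Obj C1 \<Longrightarrow> fa (aid C1 X) = aid C2 (fo X)"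
  using is_functor by (intro C2.arr_eqI) (simp_all add: mor_acon' mor_aid[symmetric] contravariant_functor_def)

lemma acon_acmp [simp]: "src b = tgt a \<Longrightarrow> fa (b \<star>\<^bsub>C1\<^esub> a) = fa a \<star>\<^bsub>C2\<^esub> fa b"
proof (cases "ok C1 a \<and> ok C1 b")
  case True
  moreover assume "src b = tgt a"
  ultimately show ?thesis
    by (intro C2.arr_eqI)
      (simp_all add: mor_acon' mor_acmp[symmetric] fmor_Cmp[of "src a" "tgt a" "tgt b"])
next
  case False
  then show ?thesis
    by (intro C2.arr_eqI') (auto simp: acon_not_ok C1.ok_iffs C2.ok_iffs C1.rep_not_ok C2.rep_not_ok)
qed

lemma acon_aadd [simp]:
  "\<lbrakk>src b = src a; tgt b = tgt a\<rbrakk> \<Longrightarrow> fa (b \<boxplus>\<^bsub>C1\<^esub> a) = fa b \<boxplus>\<^bsub>C2\<^esub> fa a"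
proof (cases "ok C1 a \<and> ok C1 b")
  case True
  moreover assume "src b = src a" "tgt b = tgt a"
  ultimately show ?thesis
    by (intro C2.arr_eqI)
      (simp_all add: mor_acon' mor_aadd[symmetric] fmor_Add)
next
  case False
  then show ?thesis
    by (intro C2.arr_eqI') (auto simp: acon_not_ok C1.ok_iffs C2.ok_iffs C1.rep_not_ok C2.rep_not_ok)
qed

lemma acon_ascl [simp]: "fa (r \<bullet>\<^bsub>C1\<^esub> a) = r \<bullet>\<^bsub>C2\<^esub> fa a"
proof (cases "ok C1 a")
  case True
  then show ?thesis
    by (intro C2.arr_eqI)
      (simp_all add: mor_acon' mor_ascl[symmetric] fmor_Scl)
next
  case False
  then show ?thesis
    by (intro C2.arr_eqI') (auto simp: acon_not_ok C1.ok_iffs C2.ok_iffs C1.rep_not_ok C2.rep_not_ok)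
qed

lemma acon_azer [simp]: "\<lbrakk>X \<in> Obj C1; Y \<in> Obj C1\<rbrakk> \<Longrightarrow> fa (azer C1 X Y) = azer C2 (fo Y) (fo X)"
  using acon_ascl[of 0 "azer C1 X Y"] by simp

lemma acon_aiso [simp]:
  assumes "aiso C1 a"
  shows "aiso C2 (fa a)" "ainv C2 (fa a) = fa (ainv C1 a)"
proof -
  have *: "fa a \<star>\<^bsub>C2\<^esub> fa (ainv C1 a) = fa (ainv C1 a \<star>\<^bsub>C1\<^esub> a)"
    "fa (ainv C1 a) \<star>\<^bsub>C2\<^esub> fa a = fa (a \<star>\<^bsub>C1\<^esub> ainv C1 a)"
    by (simp_all only: acon_acmp src_tgt)
  show "aiso C2 (fa a)" "ainv C2 (fa a) = fa (ainv C1 a)"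
    using assms * C2.aisoI[of "fa a" "fa (ainv C1 a)"] C2.ainv_eqI[of "fa a" "fa (ainv C1 a)"]
    by (simp_all add: C1.ok_aiso)
qed

lemma acon_cancel:
  assumes "b \<star>\<^bsub>C1\<^esub> a = aid C1 (src a)" "ok C1 a" "ok C1 b" "src b = tgt a"
  shows "fa a \<star>\<^bsub>C2\<^esub> fa b = aid C2 (fo (src a))"
    "ok C2 c \<Longrightarrow> tgt c = fo (tgt b) \<Longrightarrow> fa a \<star>\<^bsub>C2\<^esub> (fa b \<star>\<^bsub>C2\<^esub> c) = c"
proof -
  show *: "fa a \<star>\<^bsub>C2\<^esub> fa b = aid C2 (fo (src a))"
    using assms acon_acmp[of b a] by simp
  show "fa a \<star>\<^bsub>C2\<^esub> (fa b \<star>\<^bsub>C2\<^esub> c) = c" if "ok C2 c" "tgt c = fo (tgt b)"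
  proof -
    have "tgt b = src a"
      using arg_cong[OF assms(1), of tgt] assms(2-) by simp
    then show ?thesis
      using that * assms by (simp flip: C2.acmp_assoc)
  qed
qed

lemma acon_vanish:
  assumes "b \<star>\<^bsub>C1\<^esub> a = azer C1 (src a) (tgt b)" "ok C1 a" "ok C1 b" "src b = tgt a"
  shows "fa a \<star>\<^bsub>C2\<^esub> fa b = azer C2 (fo (tgt b)) (fo (src a))"
    "ok C2 c \<Longrightarrow> tgt c = fo (tgt b) \<Longrightarrow> fa a \<star>\<^bsub>C2\<^esub> (fa b \<star>\<^bsub>C2\<^esub> c) = azer C2 (src c) (fo (src a))"
proof -
  show *: "fa a \<star>\<^bsub>C2\<^esub> fa b = azer C2 (fo (tgt b)) (fo (src a))"
    using assms acon_acmp[of b a] by simp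
  show "fa a \<star>\<^bsub>C2\<^esub> (fa b \<star>\<^bsub>C2\<^esub> c) = azer C2 (src c) (fo (src a))" if "ok C2 c" "tgt c = fo (tgt b)"
    using that * assms by (simp flip: C2.acmp_assoc)
qed

end

section \<open>Categories with duality and their morphisms\<close>

text \<open>
  A natural isomorphism is given by raw morphisms \<open>\<theta> X\<close>. It is studied through the typed arrows
  \<open>arw (fob R X) (fob S X) (\<theta> X)\<close>, for which naturality is a commuting square of arrows.
\<close>

definition arw :: "'o \<Rightarrow> 'o \<Rightarrow> 'm \<Rightarrow> ('o, 'm) arr" where
  "arw X Y f = Arr X Y (Some f)"

lemma arw_simps [simp]: "src (arw X Y f) = X" "tgt (arw X Y f) = Y" "mor (arw X Y f) = f"
  by (simp_all add: arw_def mor_def)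

lemma ok_arw [simp]: "ok C (arw X Y f) \<longleftrightarrow> X \<in> Obj C \<and> Y \<in> Obj C \<and> f \<in> Hom C X Y"
  by (simp add: arw_def)

lemma aiso_arw [simp]: "aiso C (arw X Y f) \<longleftrightarrow> X \<in> Obj C \<and> Y \<in> Obj C \<and> isom C X Y f"
  by (auto simp: aiso_def isom_def)

lemma acov_src_tgt: "src (acov C F a) = fob F (src a)" "tgt (acov C F a) = fob F (tgt a)"
  and acon_src_tgt: "src (acon C F a) = fob F (tgt a)" "tgt (acon C F a) = fob F (src a)"
  by (simp_all add: acov_def acon_def)

lemma (in linear_category) nat_iso_covI:
  assumes "\<And>X. X \<in> Obj C1 \<Longrightarrow>
      \<theta> X = mor (\<rho> X) \<and> aiso C (\<rho> X) \<and> src (\<rho> X) = fob R X \<and> tgt (\<rho> X) = fob S X"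
    and "\<And>a. ok C1 a \<Longrightarrow> ok C (acov C1 R a) \<and> ok C (acov C1 S a) \<and>
      \<rho> (tgt a) \<star> acov C1 R a = acov C1 S a \<star> \<rho> (src a)"
  shows "nat_iso_cov C1 C R S \<theta>"
  unfolding nat_iso_cov_def
proof (intro conjI ballI)
  show "isom C (fob R X) (fob S X) (\<theta> X)" if "X \<in> Obj C1" for X
    using assms(1)[OF that] by (metis aiso_def)
  show "\<theta> Y \<cdot> fmor R X Y \<phi> = fmor S X Y \<phi> \<cdot> \<theta> X"
    if X: "X \<in> Obj C1" and Y: "Y \<in> Obj C1" and \<phi>: "\<phi> \<in> Hom C1 X Y" for X Y \<phi>
  proof -
    obtain a where a: "\<phi> = mor a" "ok C1 a" "src a = X" "tgt a = Y"
      using arr_cases[OF \<phi> X Y] .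
    have "mor (\<rho> Y \<star> acov C1 R a) = mor (acov C1 S a \<star> \<rho> X)"
      using assms(2)[OF a(2)] a by simp
    then show ?thesis
      using assms(1)[OF X] assms(1)[OF Y] assms(2)[OF a(2)] a
      by (simp add: mor_acmp[symmetric] mor_acov' ok_aiso acov_src_tgt)
  qed
qed

lemma (in linear_category) nat_iso_conI:
  assumes "\<And>X. X \<in> Obj C1 \<Longrightarrow>
      \<theta> X = mor (\<rho> X) \<and> aiso C (\<rho> X) \<and> src (\<rho> X) = fob R X \<and> tgt (\<rho> X) = fob S X"
    and "\<And>a. ok C1 a \<Longrightarrow> ok C (acon C1 R a) \<and> ok C (acon C1 S a) \<and>
      \<rho> (src a) \<star> acon C1 R a = acon C1 S a \<star> \<rho> (tgt a)"
  shows "nat_iso_con C1 C R S \<theta>"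
  unfolding nat_iso_con_def
proof (intro conjI ballI)
  show "isom C (fob R X) (fob S X) (\<theta> X)" if "X \<in> Obj C1" for X
    using assms(1)[OF that] by (metis aiso_def)
  show "\<theta> X \<cdot> fmor R X Y \<phi> = fmor S X Y \<phi> \<cdot> \<theta> Y"
    if X: "X \<in> Obj C1" and Y: "Y \<in> Obj C1" and \<phi>: "\<phi> \<in> Hom C1 X Y" for X Y \<phi>
  proof -
    obtain a where a: "\<phi> = mor a" "ok C1 a" "src a = X" "tgt a = Y"
      using arr_cases[OF \<phi> X Y] .
    have "mor (\<rho> X \<star> acon C1 R a) = mor (acon C1 S a \<star> \<rho> Y)"
      using assms(2)[OF a(2)] a by simp
    then show ?thesis
      using assms(1)[OF X] assms(1)[OF Y] assms(2)[OF a(2)] a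
      by (simp add: mor_acmp[symmetric] mor_acon' ok_aiso acon_src_tgt)
  qed
qed

lemma (in linear_category) nat_iso_cov_square:
  assumes "nat_iso_cov C1 C R S \<rho>" "ok C1 a" "ok C (acov C1 R a)" "ok C (acov C1 S a)"
  shows "arw (fob R (tgt a)) (fob S (tgt a)) (\<rho> (tgt a)) \<star> acov C1 R a
    = acov C1 S a \<star> arw (fob R (src a)) (fob S (src a)) (\<rho> (src a))"
proof -
  have "\<rho> (tgt a) \<cdot> fmor R (src a) (tgt a) (mor a) = fmor S (src a) (tgt a) (mor a) \<cdot> \<rho> (src a)"
    and h: "\<rho> (src a) \<in> Hom C (fob R (src a)) (fob S (src a))" "\<rho> (tgt a) \<in> Hom C (fob R (tgt a)) (fob S (tgt a))"
    using assms(1,2) unfolding nat_iso_cov_def isom_def by auto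
  moreover have "fob R (src a) \<in> Obj C" "fob R (tgt a) \<in> Obj C" "fob S (src a) \<in> Obj C" "fob S (tgt a) \<in> Obj C"
    using assms(3,4) ok_src[of C] ok_tgt[of C] by (metis acov_def arr.sel(1,2))+
  ultimately show ?thesis
    using assms(3,4)
    by (intro arr_eqI) (simp_all add: acov_def, simp_all add: acov_def assms(2) acmp_def mor_def arw_def)
qed

lemma (in linear_category) nat_iso_con_square:
  assumes "nat_iso_con C1 C R S \<rho>" "ok C1 a" "ok C (acon C1 R a)" "ok C (acon C1 S a)"
  shows "arw (fob R (src a)) (fob S (src a)) (\<rho> (src a)) \<star> acon C1 R a
    = acon C1 S a \<star> arw (fob R (tgt a)) (fob S (tgt a)) (\<rho> (tgt a))"
proof -
  have "\<rho> (src a) \<cdot> fmor R (src a) (tgt a) (mor a) = fmor S (src a) (tgt a) (mor a) \<cdot> \<rho> (tgt a)"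
    and h: "\<rho> (src a) \<in> Hom C (fob R (src a)) (fob S (src a))" "\<rho> (tgt a) \<in> Hom C (fob R (tgt a)) (fob S (tgt a))"
    using assms(1,2) unfolding nat_iso_con_def isom_def by auto
  moreover have "fob R (src a) \<in> Obj C" "fob R (tgt a) \<in> Obj C" "fob S (src a) \<in> Obj C" "fob S (tgt a) \<in> Obj C"
    using assms(3,4) ok_src[of C] ok_tgt[of C] by (metis acon_def arr.sel(1,2))+
  ultimately show ?thesis
    using assms(3,4)
    by (intro arr_eqI) (simp_all add: acon_def, simp_all add: acon_def assms(2) acmp_def mor_def arw_def)
qed

lemma fob_simps [simp]: "fob (comp_cov S R) X = fob S (fob R X)" "fob (comp_con S R) X = fob S (fob R X)"
  "fob idf X = X"
  by (simp_all add: comp_cov_def comp_con_def idf_def)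

lemma fmor_simps:
  "fmor (comp_cov S R) X Y \<phi> = fmor S (fob R X) (fob R Y) (fmor R X Y \<phi>)"
  "fmor (comp_con S R) X Y \<phi> = fmor S (fob R Y) (fob R X) (fmor R X Y \<phi>)"
  "fmor idf X Y \<phi> = \<phi>"
  by (simp_all add: comp_cov_def comp_con_def idf_def)

lemma acov_idf [simp]: "ok C a \<Longrightarrow> acov C idf a = a"
  by (rule arr.expand) (simp add: acov_def idf_def ok_iff[THEN iffD1])

context cov_functor
begin

lemma acov_comp_cov [simp]: "acov C1 (comp_cov S F) a = acov C2 S (fa a)"
  using acov_not_ok(2)[of a] by (cases "ok C1 a") (simp_all add: acov_def[of _ "comp_cov S F"] acov_def[of _ S] fmor_simps mor_acov')

lemma acon_comp_cov [simp]: "acon C1 (comp_cov S F) a = acon C2 S (fa a)"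
  using acov_not_ok(2)[of a] by (cases "ok C1 a") (simp_all add: acon_def[of _ "comp_cov S F"] acon_def[of _ S] fmor_simps mor_acov')

end

context con_functor
begin

lemma acov_comp_con [simp]: "acov C1 (comp_con S F) a = acon C2 S (fa a)"
  using acon_not_ok(2)[of a] by (cases "ok C1 a") (simp_all add: acov_def[of _ "comp_con S F"] acon_def[of _ S] fmor_simps mor_acon')

lemma acon_comp_con [simp]: "acon C1 (comp_con S F) a = acov C2 S (fa a)"
  using acon_not_ok(2)[of a] by (cases "ok C1 a") (simp_all add: acon_def[of _ "comp_con S F"] acov_def[of _ S] fmor_simps mor_acon')

end

lemma comp_cov_functor:
  assumes "cov_functor C1 C2 R" "cov_functor C2 C3 S"
  shows "cov_functor C1 C3 (comp_cov S R)"
proof -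
  interpret R: cov_functor C1 C2 R by fact
  interpret S: cov_functor C2 C3 S by fact
  show ?thesis
    by unfold_locales (use R.is_functor S.is_functor in \<open>simp add: covariant_functor_def comp_cov_def\<close>)
qed

lemma comp_con_functor:
  assumes "con_functor C1 C2 R" "cov_functor C2 C3 S"
  shows "con_functor C1 C3 (comp_con S R)"
proof -
  interpret R: con_functor C1 C2 R by fact
  interpret S: cov_functor C2 C3 S by fact
  show ?thesis
    by unfold_locales
      (use R.is_functor S.is_functor in \<open>simp add: covariant_functor_def contravariant_functor_def comp_con_def\<close>)
qed

locale dual_category = pseudo_abelian_category C + D: con_functor C C D
  for C :: "('o, 'm, 'k::{comm_ring, comm_monoid_mult}) lcat" (structure)
    and D :: "('o, 'm, 'o, 'm) fctr" +
  fixes \<delta> :: "'o \<Rightarrow> 'm"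
  assumes dual: "duality C D \<delta>"
begin

definition "dl X = arw X (fob D (fob D X)) (\<delta> X)"

lemma dl_src_tgt [simp]: "src (dl X) = X" "tgt (dl X) = fob D (fob D X)"
  by (simp_all add: dl_def)

lemma mor_dl: "\<delta> X = mor (dl X)"
  by (simp add: dl_def)

lemma aiso_dl [simp]: "X \<in> Obj C \<Longrightarrow> aiso C (dl X)"
  and ok_dl [simp]: "X \<in> Obj C \<Longrightarrow> ok C (dl X)"
  using dual by (auto simp: dl_def duality_def nat_iso_cov_def isom_def)

lemma dl_nat:
  assumes "ok C a" "tgt a = Y"
  shows "dl Y \<star> a = D.fa (D.fa a) \<star> dl (src a)"
  using nat_iso_cov_square[of C idf "comp_con D D" \<delta> a] dual assms
  by (auto simp: duality_def dl_def)

lemma dl_D [simp]: "X \<in> Obj C \<Longrightarrow> dl (fob D X) = D.fa (ainv C (dl X))"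
proof -
  assume X: "X \<in> Obj C"
  then have "\<delta> (fob D X) = Inv C (fob D (fob D (fob D X))) (fob D X) (fmor D X (fob D (fob D X)) (\<delta> X))"
    using dual by (simp add: duality_def)
  also have "\<dots> = mor (D.fa (ainv C (dl X)))"
    using X by (simp add: mor_dl D.fmor_mor to_arr)
  finally show ?thesis
    using X by (intro arr_eqI) (simp_all flip: mor_dl)
qed

end

lemma dual_categoryI:
  assumes "category_with_duality (C, D, \<delta>)"
  shows "dual_category C D \<delta>"
proof -
  interpret pseudo_abelian_category C using assms by simp
  show ?thesis
    using assms by unfold_locales (auto simp: duality_def)
qed

locale dual_functor = A: dual_category C1 D1 \<delta>1 + B: dual_category C2 D2 \<delta>2 + R: cov_functor C1 C2 R
  for C1 :: "('o1, 'm1, 'k::{comm_ring, comm_monoid_mult}) lcat" and D1 \<delta>1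
    and C2 :: "('o2, 'm2, 'k) lcat" and D2 \<delta>2 and R +
  fixes \<theta> :: "'o1 \<Rightarrow> 'm2"
  assumes nat_iso: "nat_iso_con C1 C2 (comp_con R D1) (comp_cov D2 R) \<theta>"
    and coherent: "X \<in> Obj C1 \<Longrightarrow> \<theta> (fob D1 X) \<cdot>\<^bsub>C2\<^esub> fmor R X (fob D1 (fob D1 X)) (\<delta>1 X)
        = fmor D2 (fob R (fob D1 X)) (fob D2 (fob R X)) (\<theta> X) \<cdot>\<^bsub>C2\<^esub> \<delta>2 (fob R X)"
begin

definition "th X = arw (fob R (fob D1 X)) (fob D2 (fob R X)) (\<theta> X)"

lemma th_src_tgt [simp]: "src (th X) = fob R (fob D1 X)" "tgt (th X) = fob D2 (fob R X)"
  by (simp_all add: th_def)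

lemma mor_th: "\<theta> X = mor (th X)"
  by (simp add: th_def)

lemma aiso_th [simp]: "X \<in> Obj C1 \<Longrightarrow> aiso C2 (th X)"
  and ok_th [simp]: "X \<in> Obj C1 \<Longrightarrow> ok C2 (th X)"
  using nat_iso by (auto simp: th_def nat_iso_con_def isom_def)

lemma th_nat:
  assumes "ok C1 a" "src a = X"
  shows "th X \<star>\<^bsub>C2\<^esub> R.fa (A.D.fa a) = B.D.fa (R.fa a) \<star>\<^bsub>C2\<^esub> th (tgt a)"
    and "th X \<star>\<^bsub>C2\<^esub> (R.fa (A.D.fa a) \<star>\<^bsub>C2\<^esub> c) = B.D.fa (R.fa a) \<star>\<^bsub>C2\<^esub> (th (tgt a) \<star>\<^bsub>C2\<^esub> c)"
proof -
  show *: "th X \<star>\<^bsub>C2\<^esub> R.fa (A.D.fa a) = B.D.fa (R.fa a) \<star>\<^bsub>C2\<^esub> th (tgt a)"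
    using B.nat_iso_con_square[OF nat_iso, of a] assms by (simp add: th_def)
  show "th X \<star>\<^bsub>C2\<^esub> (R.fa (A.D.fa a) \<star>\<^bsub>C2\<^esub> c) = B.D.fa (R.fa a) \<star>\<^bsub>C2\<^esub> (th (tgt a) \<star>\<^bsub>C2\<^esub> c)"
    using B.acmp_reassoc[OF *] by simp
qed

lemma th_dl:
  "X \<in> Obj C1 \<Longrightarrow> th (fob D1 X) \<star>\<^bsub>C2\<^esub> R.fa (A.dl X) = B.D.fa (th X) \<star>\<^bsub>C2\<^esub> B.dl (fob R X)"
  using coherent[of X]
  by (intro B.arr_eqI) (simp_all add: mor_acmp[symmetric] mor_acon' mor_acov',
    simp add: th_def A.dl_def B.dl_def)

end

lemma dmorphism_iff_dual_functor:
  "dmorphism (C1, D1, \<delta>1) (C2, D2, \<delta>2) (R, \<theta>) \<longleftrightarrow> dual_functor C1 D1 \<delta>1 C2 D2 \<delta>2 R \<theta>"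
proof
  assume *: "dmorphism (C1, D1, \<delta>1) (C2, D2, \<delta>2) (R, \<theta>)"
  then interpret A: dual_category C1 D1 \<delta>1 by (intro dual_categoryI) simp
  from * interpret B: dual_category C2 D2 \<delta>2 by (intro dual_categoryI) simp
  show "dual_functor C1 D1 \<delta>1 C2 D2 \<delta>2 R \<theta>"
    using * by unfold_locales simp_all
next
  assume "dual_functor C1 D1 \<delta>1 C2 D2 \<delta>2 R \<theta>"
  then interpret dual_functor C1 D1 \<delta>1 C2 D2 \<delta>2 R \<theta> .
  show "dmorphism (C1, D1, \<delta>1) (C2, D2, \<delta>2) (R, \<theta>)"
    using A.dual B.dual nat_iso coherent R.is_functor
      A.pseudo_abelian_category_axioms B.pseudo_abelian_category_axioms by simp
qed

lemma dual_functorI: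
  assumes "dual_category C1 D1 \<delta>1" "dual_category C2 D2 \<delta>2" "cov_functor C1 C2 R"
    and th: "\<And>X. X \<in> Obj C1 \<Longrightarrow> \<theta> X = mor (t X) \<and> aiso C2 (t X) \<and>
      src (t X) = fob R (fob D1 X) \<and> tgt (t X) = fob D2 (fob R X)"
    and nat: "\<And>a. ok C1 a \<Longrightarrow> t (src a) \<star>\<^bsub>C2\<^esub> acov C1 R (acon C1 D1 a) = acon C2 D2 (acov C1 R a) \<star>\<^bsub>C2\<^esub> t (tgt a)"
    and coh: "\<And>X. X \<in> Obj C1 \<Longrightarrow> t (fob D1 X) \<star>\<^bsub>C2\<^esub> acov C1 R (dual_category.dl D1 \<delta>1 X)
      = acon C2 D2 (t X) \<star>\<^bsub>C2\<^esub> dual_category.dl D2 \<delta>2 (fob R X)"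
  shows "dual_functor C1 D1 \<delta>1 C2 D2 \<delta>2 R \<theta>"
proof -
  interpret A: dual_category C1 D1 \<delta>1 by fact
  interpret B: dual_category C2 D2 \<delta>2 by fact
  interpret R: cov_functor C1 C2 R by fact
  show ?thesis
  proof unfold_locales
    show "nat_iso_con C1 C2 (comp_con R D1) (comp_cov D2 R) \<theta>"
      using th nat by (intro B.nat_iso_conI[of _ _ t]) simp_all
    fix X assume X: "X \<in> Obj C1"
    note t = th[OF X] th[OF A.D.fob_in[OF X]]
    show "\<theta> (fob D1 X) \<cdot>\<^bsub>C2\<^esub> fmor R X (fob D1 (fob D1 X)) (\<delta>1 X)
        = fmor D2 (fob R (fob D1 X)) (fob D2 (fob R X)) (\<theta> X) \<cdot>\<^bsub>C2\<^esub> \<delta>2 (fob R X)"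
      using t coh[OF X] X
      by (simp add: A.mor_dl B.mor_dl R.fmor_mor B.D.fmor_mor mor_acmp B.ok_aiso)
  qed
qed

lemma dual_functor_comp:
  assumes "dual_functor C1 D1 \<delta>1 C2 D2 \<delta>2 R \<theta>" "dual_functor C2 D2 \<delta>2 C3 D3 \<delta>3 S \<tau>"
  shows "dual_functor C1 D1 \<delta>1 C3 D3 \<delta>3 (comp_cov S R)
    (\<lambda>X. \<tau> (fob R X) \<cdot>\<^bsub>C3\<^esub> fmor S (fob R (fob D1 X)) (fob D2 (fob R X)) (\<theta> X))"
proof -
  interpret R: dual_functor C1 D1 \<delta>1 C2 D2 \<delta>2 R \<theta> by fact
  interpret S: dual_functor C2 D2 \<delta>2 C3 D3 \<delta>3 S \<tau> by fact
  let ?t = "\<lambda>X. S.th (fob R X) \<star>\<^bsub>C3\<^esub> S.R.fa (R.th X)"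
  show ?thesis
  proof (rule dual_functorI[where t = ?t])
    show "dual_category C1 D1 \<delta>1" "dual_category C3 D3 \<delta>3" ..
    show "cov_functor C1 C3 (comp_cov S R)"
      by (rule comp_cov_functor) unfold_locales
  next
    fix X assume X: "X \<in> Obj C1"
    show "\<tau> (fob R X) \<cdot>\<^bsub>C3\<^esub> fmor S (fob R (fob D1 X)) (fob D2 (fob R X)) (\<theta> X) = mor (?t X) \<and>
      aiso C3 (?t X) \<and> src (?t X) = fob (comp_cov S R) (fob D1 X) \<and> tgt (?t X) = fob D3 (fob (comp_cov S R) X)"
      using X by (simp add: R.mor_th S.mor_th S.R.fmor_mor mor_acmp)
    have "S.th (fob R (fob D1 X)) \<star>\<^bsub>C3\<^esub> (S.R.fa (R.th (fob D1 X)) \<star>\<^bsub>C3\<^esub> S.R.fa (R.R.fa (R.A.dl X)))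
        = S.th (fob R (fob D1 X)) \<star>\<^bsub>C3\<^esub> S.R.fa (R.th (fob D1 X) \<star>\<^bsub>C2\<^esub> R.R.fa (R.A.dl X))"
      using X by simp
    also have "\<dots> = S.th (fob R (fob D1 X)) \<star>\<^bsub>C3\<^esub> S.R.fa (R.B.D.fa (R.th X)) \<star>\<^bsub>C3\<^esub> S.R.fa (R.B.dl (fob R X))"
      unfolding R.th_dl[OF X] using X by simp
    also have "\<dots> = S.B.D.fa (S.R.fa (R.th X)) \<star>\<^bsub>C3\<^esub> S.th (fob D2 (fob R X)) \<star>\<^bsub>C3\<^esub> S.R.fa (R.B.dl (fob R X))"
      using X by (simp add: S.th_nat)
    also have "\<dots> = S.B.D.fa (S.R.fa (R.th X)) \<star>\<^bsub>C3\<^esub> S.B.D.fa (S.th (fob R X)) \<star>\<^bsub>C3\<^esub> S.B.dl (fob S (fob R X))"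
      using S.th_dl[of "fob R X"] X by simp
    finally show "?t (fob D1 X) \<star>\<^bsub>C3\<^esub> acov C1 (comp_cov S R) (R.A.dl X)
        = S.B.D.fa (?t X) \<star>\<^bsub>C3\<^esub> S.B.dl (fob (comp_cov S R) X)"
      using X by simp
  next
    fix a assume a: "ok C1 a"
    have "S.th (fob R (src a)) \<star>\<^bsub>C3\<^esub> (S.R.fa (R.th (src a)) \<star>\<^bsub>C3\<^esub> S.R.fa (R.R.fa (R.A.D.fa a)))
        = S.th (fob R (src a)) \<star>\<^bsub>C3\<^esub> S.R.fa (R.th (src a) \<star>\<^bsub>C2\<^esub> R.R.fa (R.A.D.fa a))"
      using a by simp
    also have "\<dots> = S.th (fob R (src a)) \<star>\<^bsub>C3\<^esub> S.R.fa (R.B.D.fa (R.R.fa a)) \<star>\<^bsub>C3\<^esub> S.R.fa (R.th (tgt a))"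
      unfolding R.th_nat(1)[OF a refl] using a by simp
    also have "\<dots> = S.B.D.fa (S.R.fa (R.R.fa a)) \<star>\<^bsub>C3\<^esub> S.th (fob R (tgt a)) \<star>\<^bsub>C3\<^esub> S.R.fa (R.th (tgt a))"
      using a by (simp add: S.th_nat)
    finally show "?t (src a) \<star>\<^bsub>C3\<^esub> acov C1 (comp_cov S R) (R.A.D.fa a)
        = S.B.D.fa (acov C1 (comp_cov S R) a) \<star>\<^bsub>C3\<^esub> ?t (tgt a)"
      using a by simp
  qed
qed

lemma dmorphism_dcomp:
  assumes "dmorphism \<A> \<B> P" "dmorphism \<B> \<C> Q"
  shows "dmorphism \<A> \<C> (dcomp \<A> \<B> \<C> Q P)"
  using assms
  by (cases \<A>; cases \<B>; cases \<C>; cases P; cases Q)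
    (simp only: dmorphism_iff_dual_functor dcomp.simps, rule dual_functor_comp)

lemma dmorphism_cong:
  assumes P: "dmorphism (C1, D1, \<delta>1) \<B> (R, \<theta>)"
    and eq: "\<And>X. X \<in> Obj C1 \<Longrightarrow> fob R' X = fob R X \<and> \<theta>' X = \<theta> X"
      "\<And>X Y \<phi>. \<lbrakk>X \<in> Obj C1; Y \<in> Obj C1; \<phi> \<in> Hom C1 X Y\<rbrakk> \<Longrightarrow> fmor R' X Y \<phi> = fmor R X Y \<phi>"
  shows "dmorphism (C1, D1, \<delta>1) \<B> (R', \<theta>')"
proof (cases \<B>)
  case (fields C2 D2 \<delta>2)
  interpret dual_functor C1 D1 \<delta>1 C2 D2 \<delta>2 R \<theta>
    using P by (simp only: fields dmorphism_iff_dual_functor)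
  have C1: "\<And>X Y Z f g. \<lbrakk>X \<in> Obj C1; Y \<in> Obj C1; Z \<in> Obj C1; f \<in> Hom C1 X Y; g \<in> Hom C1 Y Z\<rbrakk> \<Longrightarrow> g \<cdot>\<^bsub>C1\<^esub> f \<in> Hom C1 X Z"
    by (rule A.Cmp_in)
  have D: "\<And>X Y f. \<lbrakk>X \<in> Obj C1; Y \<in> Obj C1; f \<in> Hom C1 X Y\<rbrakk> \<Longrightarrow> fmor D1 X Y f \<in> Hom C1 (fob D1 Y) (fob D1 X)"
    using A.D.is_functor by (simp add: contravariant_functor_def)
  have dl: "\<And>X. X \<in> Obj C1 \<Longrightarrow> \<delta>1 X \<in> Hom C1 X (fob D1 (fob D1 X))"
    by (simp add: A.mor_dl)
  show ?thesis
    using P eq C1 D dl unfolding fields dmorphism.simps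
    by (simp add: covariant_functor_def nat_iso_con_def fmor_simps A.Idn_in A.Add_in A.Scl_in)
qed

lemma dual_category_signed:
  assumes "category_with_duality (C, D, \<delta>)" "\<epsilon> * \<epsilon> = 1"
  shows "category_with_duality (signed \<epsilon> (C, D, \<delta>))"
proof -
  interpret dual_category C D \<delta> using assms(1) by (rule dual_categoryI)
  have "nat_iso_cov C C idf (comp_con D D) (\<lambda>X. \<epsilon> \<odot>\<^bsub>C\<^esub> \<delta> X)"
    by (rule nat_iso_covI[where \<rho> = "\<lambda>X. \<epsilon> \<bullet>\<^bsub>C\<^esub> dl X"])
      (simp_all add: mor_dl mor_ascl aiso_ascl(1)[OF _ assms(2)], simp add: dl_nat)
  moreover have "\<epsilon> \<odot>\<^bsub>C\<^esub> \<delta> (fob D X)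
        = Inv C (fob D (fob D (fob D X))) (fob D X) (fmor D X (fob D (fob D X)) (\<epsilon> \<odot>\<^bsub>C\<^esub> \<delta> X))"
    if "X \<in> Obj C" for X
    using that by (simp add: mor_dl mor_ascl D.fmor_mor mor_ainv aiso_ascl[OF _ assms(2)])
  ultimately show ?thesis
    using assms by (simp add: duality_def)
qed

text \<open>
  Both sides of the coherence condition are linear in the double-dual isomorphisms, so multiplying these
  by a sign on both sides preserves it. This reduces the statements for \<open>\<plusminus>\<delta>\<close> to one sign.
\<close>

lemma dmorphism_signed:
  assumes P: "dmorphism \<A> (signed \<eta> \<B>) P" and \<B>: "category_with_duality \<B>"
    and \<eta>: "\<eta> * \<eta> = 1" and \<epsilon>: "\<epsilon> * \<epsilon> = 1"
  shows "dmorphism (signed \<epsilon> \<A>) (signed (\<epsilon> * \<eta>) \<B>) P"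
proof (cases \<A>; cases \<B>; cases P)
  fix C1 D1 \<delta>1 C2 D2 \<delta>2 R \<theta>
  assume eq: "\<A> = (C1, D1, \<delta>1)" "\<B> = (C2, D2, \<delta>2)" "P = (R, \<theta>)"
  interpret dual_functor C1 D1 \<delta>1 C2 D2 "\<lambda>X. \<eta> \<odot>\<^bsub>C2\<^esub> \<delta>2 X" R \<theta>
    using P by (simp only: eq dmorphism_iff_dual_functor signed.simps)
  interpret B': dual_category C2 D2 \<delta>2
    using \<B> unfolding eq by (rule dual_categoryI)
  have "category_with_duality (signed \<epsilon> (C1, D1, \<delta>1))"
    using A.dual A.pseudo_abelian_category_axioms by (intro dual_category_signed \<epsilon>) simp
  moreover have "category_with_duality (signed (\<epsilon> * \<eta>) (C2, D2, \<delta>2))"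
  proof (rule dual_category_signed)
    show "category_with_duality (C2, D2, \<delta>2)" using \<B> unfolding eq .
    show "\<epsilon> * \<eta> * (\<epsilon> * \<eta>) = 1" by (metis \<eta> \<epsilon> mult.commute mult.left_commute mult_1)
  qed
  moreover have "\<theta> (fob D1 X) \<cdot>\<^bsub>C2\<^esub> fmor R X (fob D1 (fob D1 X)) (\<epsilon> \<odot>\<^bsub>C1\<^esub> \<delta>1 X)
      = fmor D2 (fob R (fob D1 X)) (fob D2 (fob R X)) (\<theta> X) \<cdot>\<^bsub>C2\<^esub> ((\<epsilon> * \<eta>) \<odot>\<^bsub>C2\<^esub> \<delta>2 (fob R X))"
    if X: "X \<in> Obj C1" for X
    using coherent[OF X] X
    by (simp add: A.mor_dl B'.mor_dl mor_th R.fmor_mor B.D.fmor_mor mor_acmp mor_ascl)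
  ultimately show "dmorphism (signed \<epsilon> \<A>) (signed (\<epsilon> * \<eta>) \<B>) P"
    unfolding eq using nat_iso R.is_functor by simp
qed

lemma dmorphism_signed_one:
  assumes "dmorphism \<A> \<B> P"
  shows "dmorphism \<A> (signed 1 \<B>) P"
proof (cases \<A>; cases \<B>; cases P)
  fix C1 D1 \<delta>1 C2 D2 \<delta>2 R \<theta>
  assume eq: "\<A> = (C1, D1, \<delta>1)" "\<B> = (C2, D2, \<delta>2)" "P = (R, \<theta>)"
  interpret dual_functor C1 D1 \<delta>1 C2 D2 \<delta>2 R \<theta>
    using assms by (simp only: eq dmorphism_iff_dual_functor signed.simps)
  have "category_with_duality (signed 1 (C2, D2, \<delta>2))"
    using assms unfolding eq by (intro dual_category_signed) auto
  moreover have "1 \<odot>\<^bsub>C2\<^esub> \<delta>2 (fob R X) = \<delta>2 (fob R X)" if "X \<in> Obj C1" for X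
    using that by (simp add: B.mor_dl mor_ascl)
  ultimately show "dmorphism \<A> (signed 1 \<B>) P"
    using assms unfolding eq by simp
qed

lemma dcomp_signed [simp]: "dcomp (signed \<epsilon> \<A>) (signed \<eta> \<B>) (signed \<zeta> \<C>) Q P = dcomp \<A> \<B> \<C> Q P"
  by (cases \<A>; cases \<B>; cases \<C>; cases P; cases Q) simp

lemma dmorphism_id:
  assumes "category_with_duality \<A>"
  shows "dmorphism \<A> \<A> (id_dmor \<A>)"
proof (cases \<A>)
  case (fields C D \<delta>)
  interpret dual_category C D \<delta>
    using assms unfolding fields by (rule dual_categoryI)
  have "dual_functor C D \<delta> C D \<delta> idf (\<lambda>X. Idn C (fob D X))"
  proof (rule dual_functorI[where t = "\<lambda>X. aid C (fob D X)"])
    show "cov_functor C C idf"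
      by unfold_locales (simp add: covariant_functor_def fmor_simps)
  qed (unfold_locales, simp_all add: mor_aid)
  then show ?thesis
    by (simp add: fields id_dmor_def dmorphism_iff_dual_functor del: dmorphism.simps)
qed

text \<open>
  For \<open>(S, \<tau>)\<close> and \<open>(S, \<tau>) (R, \<theta>)\<close> known, naturality and coherence of \<open>\<theta>\<close> are equations that hold after
  application of \<open>S\<close> and composition with the isomorphism \<open>\<tau>\<close>; a faithful \<open>S\<close> reflects them. This gives
  the morphisms from \<open>\<C>\<close> to \<open>\<C>''\<close>: the forgetful functors are faithful.
\<close>

lemma dmorphism_reflect:
  assumes S: "dmorphism (C2, D2, \<delta>2) (C3, D3, \<delta>3) (S, \<tau>)"
    and SR: "dmorphism (C1, D1, \<delta>1) (C3, D3, \<delta>3) (dcomp (C1, D1, \<delta>1) (C2, D2, \<delta>2) (C3, D3, \<delta>3) (S, \<tau>) (R, \<theta>))"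
    and R: "covariant_functor C1 C2 R"
    and iso: "\<And>X. X \<in> Obj C1 \<Longrightarrow> isom C2 (fob R (fob D1 X)) (fob D2 (fob R X)) (\<theta> X)"
    and faithful: "\<And>a b. \<lbrakk>ok C2 a; ok C2 b; src a = src b; tgt a = tgt b; acov C2 S a = acov C2 S b\<rbrakk> \<Longrightarrow> a = b"
  shows "dmorphism (C1, D1, \<delta>1) (C2, D2, \<delta>2) (R, \<theta>)"
proof -
  interpret S: dual_functor C2 D2 \<delta>2 C3 D3 \<delta>3 S \<tau>
    using S by (simp only: dmorphism_iff_dual_functor)
  interpret SR: dual_functor C1 D1 \<delta>1 C3 D3 \<delta>3 "comp_cov S R"
    "\<lambda>X. \<tau> (fob R X) \<cdot>\<^bsub>C3\<^esub> fmor S (fob R (fob D1 X)) (fob D2 (fob R X)) (\<theta> X)"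
    using SR by (simp only: dmorphism_iff_dual_functor dcomp.simps)
  interpret R: cov_functor C1 C2 R
    using R by unfold_locales
  define t where "t X = arw (fob R (fob D1 X)) (fob D2 (fob R X)) (\<theta> X)" for X
  have t [simp]: "src (t X) = fob R (fob D1 X)" "tgt (t X) = fob D2 (fob R X)" for X
    by (simp_all add: t_def)
  have t_iso [simp]: "aiso C2 (t X)" if "X \<in> Obj C1" for X
    using that iso by (simp add: t_def)
  note [simp] = S.A.ok_aiso[OF t_iso]
  have th: "SR.th X = S.th (fob R X) \<star>\<^bsub>C3\<^esub> S.R.fa (t X)" if "X \<in> Obj C1" for X
  proof -
    have "\<theta> X = mor (t X)" by (simp add: t_def)
    then show ?thesis
      using that by (intro S.B.arr_eqI) (simp_all flip: SR.mor_th, simp add: S.mor_th S.R.fmor_mor mor_acmp)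
  qed
  have "dual_functor C1 D1 \<delta>1 C2 D2 \<delta>2 R \<theta>"
  proof (rule dual_functorI[where t = t])
    show "dual_category C1 D1 \<delta>1" "dual_category C2 D2 \<delta>2" "cov_functor C1 C2 R" ..
    show "\<theta> X = mor (t X) \<and> aiso C2 (t X) \<and> src (t X) = fob R (fob D1 X) \<and> tgt (t X) = fob D2 (fob R X)"
      if "X \<in> Obj C1" for X
      using that by simp (simp add: t_def)
  next
    fix a assume a: "ok C1 a"
    have "S.th (fob R (src a)) \<star>\<^bsub>C3\<^esub> S.R.fa (t (src a) \<star>\<^bsub>C2\<^esub> R.fa (SR.A.D.fa a))
        = SR.th (src a) \<star>\<^bsub>C3\<^esub> SR.R.fa (SR.A.D.fa a)"
      using a by (simp add: th)
    also have "\<dots> = S.B.D.fa (S.R.fa (R.fa a)) \<star>\<^bsub>C3\<^esub> S.th (fob R (tgt a)) \<star>\<^bsub>C3\<^esub> S.R.fa (t (tgt a))"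
      unfolding SR.th_nat(1)[OF a refl] using a by (simp add: th)
    also have "\<dots> = S.th (fob R (src a)) \<star>\<^bsub>C3\<^esub> S.R.fa (S.A.D.fa (R.fa a) \<star>\<^bsub>C2\<^esub> t (tgt a))"
      using a by (simp add: S.th_nat)
    finally have "S.R.fa (t (src a) \<star>\<^bsub>C2\<^esub> R.fa (SR.A.D.fa a)) = S.R.fa (S.A.D.fa (R.fa a) \<star>\<^bsub>C2\<^esub> t (tgt a))"
      using a by - (rule S.B.aiso_cancel_left[of "S.th (fob R (src a))"], simp_all)
    then show "t (src a) \<star>\<^bsub>C2\<^esub> R.fa (SR.A.D.fa a) = S.A.D.fa (R.fa a) \<star>\<^bsub>C2\<^esub> t (tgt a)"
      using a by - (rule faithful, simp_all)
  next
    fix X assume X: "X \<in> Obj C1"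
    have "S.th (fob R (fob D1 X)) \<star>\<^bsub>C3\<^esub> S.R.fa (t (fob D1 X) \<star>\<^bsub>C2\<^esub> R.fa (SR.A.dl X))
        = SR.th (fob D1 X) \<star>\<^bsub>C3\<^esub> SR.R.fa (SR.A.dl X)"
      using X by (simp add: th)
    also have "\<dots> = S.B.D.fa (S.R.fa (t X)) \<star>\<^bsub>C3\<^esub> S.B.D.fa (S.th (fob R X)) \<star>\<^bsub>C3\<^esub> S.B.dl (fob S (fob R X))"
      unfolding SR.th_dl[OF X] using X by (simp add: th)
    also have "\<dots> = S.B.D.fa (S.R.fa (t X)) \<star>\<^bsub>C3\<^esub> S.th (fob D2 (fob R X)) \<star>\<^bsub>C3\<^esub> S.R.fa (S.A.dl (fob R X))"
      using S.th_dl[of "fob R X"] X by simp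
    also have "\<dots> = S.th (fob R (fob D1 X)) \<star>\<^bsub>C3\<^esub> S.R.fa (S.A.D.fa (t X) \<star>\<^bsub>C2\<^esub> S.A.dl (fob R X))"
      using X by (simp add: S.th_nat)
    finally have "S.R.fa (t (fob D1 X) \<star>\<^bsub>C2\<^esub> R.fa (SR.A.dl X)) = S.R.fa (S.A.D.fa (t X) \<star>\<^bsub>C2\<^esub> S.A.dl (fob R X))"
      using X by - (rule S.B.aiso_cancel_left[of "S.th (fob R (fob D1 X))"], simp_all)
    then show "t (fob D1 X) \<star>\<^bsub>C2\<^esub> R.fa (SR.A.dl X) = S.A.D.fa (t X) \<star>\<^bsub>C2\<^esub> S.A.dl (fob R X)"
      using X by - (rule faithful, simp_all)
  qed
  then show ?thesis
    by (simp only: dmorphism_iff_dual_functor)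
qed

text \<open>
  A morphism \<open>(S, \<tau>)\<close> can be transported along a natural isomorphism \<open>\<rho> : R \<Rightarrow> S\<close>. The resulting \<open>\<theta>\<close> is such
  that \<open>\<rho>\<close> is an isomorphism \<open>(R, \<theta>) \<cong> (S, \<tau>)\<close> of morphisms of categories with duality.
\<close>

lemma dmorphism_transport:
  assumes S: "dmorphism (C1, D1, \<delta>1) (C2, D2, \<delta>2) (S, \<tau>)"
    and R: "covariant_functor C1 C2 R"
    and \<rho>: "nat_iso_cov C1 C2 R S \<rho>"
    and \<theta>: "\<And>X. X \<in> Obj C1 \<Longrightarrow>
      \<theta> X = fmor D2 (fob R X) (fob S X) (\<rho> X) \<cdot>\<^bsub>C2\<^esub> \<tau> X \<cdot>\<^bsub>C2\<^esub> \<rho> (fob D1 X)"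
  shows "dmorphism (C1, D1, \<delta>1) (C2, D2, \<delta>2) (R, \<theta>)"
proof -
  interpret S: dual_functor C1 D1 \<delta>1 C2 D2 \<delta>2 S \<tau>
    using S by (simp only: dmorphism_iff_dual_functor)
  interpret R: cov_functor C1 C2 R
    using R by unfold_locales
  define r where "r X = arw (fob R X) (fob S X) (\<rho> X)" for X
  have r [simp]: "src (r X) = fob R X" "tgt (r X) = fob S X" for X
    by (simp_all add: r_def)
  have r_iso [simp]: "aiso C2 (r X)" if "X \<in> Obj C1" for X
    using that \<rho> by (simp add: r_def nat_iso_cov_def)
  note [simp] = S.B.ok_aiso[OF r_iso]
  have r_nat: "r (tgt a) \<star>\<^bsub>C2\<^esub> R.fa a = S.R.fa a \<star>\<^bsub>C2\<^esub> r (src a)" if "ok C1 a" for a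
    using S.B.nat_iso_cov_square[OF \<rho>, of a] that by (simp add: r_def)
  let ?t = "\<lambda>X. S.B.D.fa (r X) \<star>\<^bsub>C2\<^esub> S.th X \<star>\<^bsub>C2\<^esub> r (fob D1 X)"
  have "dual_functor C1 D1 \<delta>1 C2 D2 \<delta>2 R \<theta>"
  proof (rule dual_functorI[where t = ?t])
    show "dual_category C1 D1 \<delta>1" "dual_category C2 D2 \<delta>2" "cov_functor C1 C2 R" ..
    show "\<theta> X = mor (?t X) \<and> aiso C2 (?t X) \<and> src (?t X) = fob R (fob D1 X) \<and> tgt (?t X) = fob D2 (fob R X)"
      if X: "X \<in> Obj C1" for X
    proof -
      have "\<rho> X = mor (r X)" "\<rho> (fob D1 X) = mor (r (fob D1 X))" by (simp_all add: r_def)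
      then show ?thesis
        using X by (simp add: \<theta> S.mor_th S.B.D.fmor_mor mor_acmp)
    qed
  next
    fix a assume a: "ok C1 a"
    have "?t (src a) \<star>\<^bsub>C2\<^esub> R.fa (S.A.D.fa a)
        = S.B.D.fa (r (src a)) \<star>\<^bsub>C2\<^esub> (S.th (src a) \<star>\<^bsub>C2\<^esub> S.R.fa (S.A.D.fa a)) \<star>\<^bsub>C2\<^esub> r (fob D1 (tgt a))"
      using r_nat[of "S.A.D.fa a"] a by simp
    also have "\<dots> = S.B.D.fa (S.R.fa a \<star>\<^bsub>C2\<^esub> r (src a)) \<star>\<^bsub>C2\<^esub> S.th (tgt a) \<star>\<^bsub>C2\<^esub> r (fob D1 (tgt a))"
      unfolding S.th_nat(1)[OF a refl] using a by simp
    also have "\<dots> = S.B.D.fa (R.fa a) \<star>\<^bsub>C2\<^esub> ?t (tgt a)"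
      unfolding r_nat[OF a, symmetric] using a by simp
    finally show "?t (src a) \<star>\<^bsub>C2\<^esub> R.fa (S.A.D.fa a) = S.B.D.fa (R.fa a) \<star>\<^bsub>C2\<^esub> ?t (tgt a)" .
  next
    fix X assume X: "X \<in> Obj C1"
    have "?t (fob D1 X) \<star>\<^bsub>C2\<^esub> R.fa (S.A.dl X)
        = S.B.D.fa (r (fob D1 X)) \<star>\<^bsub>C2\<^esub> (S.th (fob D1 X) \<star>\<^bsub>C2\<^esub> S.R.fa (S.A.dl X)) \<star>\<^bsub>C2\<^esub> r X"
      using r_nat[of "S.A.dl X"] X by simp
    also have "\<dots> = S.B.D.fa (r (fob D1 X)) \<star>\<^bsub>C2\<^esub> S.B.D.fa (S.th X) \<star>\<^bsub>C2\<^esub> S.B.dl (fob S X) \<star>\<^bsub>C2\<^esub> r X"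
      unfolding S.th_dl[OF X] using X by simp
    also have "\<dots> = S.B.D.fa (?t X) \<star>\<^bsub>C2\<^esub> S.B.dl (fob R X)"
      using S.B.dl_nat[of "r X"] X by simp
    finally show "?t (fob D1 X) \<star>\<^bsub>C2\<^esub> R.fa (S.A.dl X) = S.B.D.fa (?t X) \<star>\<^bsub>C2\<^esub> S.B.dl (fob R X)" .
  qed
  then show ?thesis
    by (simp only: dmorphism_iff_dual_functor)
qed

lemma signed_simps [simp]: "fst (signed \<epsilon> \<A>) = fst \<A>" "fst (snd (signed \<epsilon> \<A>)) = fst (snd \<A>)"
  by (cases \<A>, simp)+

lemma dcomp_simps:
  "fst (dcomp \<A> \<B> \<C> Q P) = comp_cov (fst Q) (fst P)"
  "snd (dcomp \<A> \<B> \<C> Q P) X = snd Q (fob (fst P) X)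
    \<cdot>\<^bsub>fst \<C>\<^esub> fmor (fst Q) (fob (fst P) (fob (fst (snd \<A>)) X)) (fob (fst (snd \<B>)) (fob (fst P) X)) (snd P X)"
  by (cases \<A>; cases \<B>; cases \<C>; cases P; cases Q; simp)+

lemma dmor_eqI:
  assumes "dmorphism \<A> \<B> Q"
    and "\<And>X. X \<in> Obj (fst \<A>) \<Longrightarrow> fob (fst P) X = fob (fst Q) X \<and> snd P X = snd Q X"
    and "\<And>X Y m. \<lbrakk>X \<in> Obj (fst \<A>); Y \<in> Obj (fst \<A>); m \<in> Hom (fst \<A>) X Y\<rbrakk>
      \<Longrightarrow> fmor (fst P) X Y m = fmor (fst Q) X Y m"
  shows "dmorphism \<A> \<B> P" "dmor_eq \<A> \<B> P Q"
proof -
  obtain C1 D1 \<delta>1 R \<theta> S \<tau> where eq: "\<A> = (C1, D1, \<delta>1)" "P = (R, \<theta>)" "Q = (S, \<tau>)"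
    by (metis prod.exhaust)
  show "dmorphism \<A> \<B> P"
    using dmorphism_cong[of C1 D1 \<delta>1 \<B> S \<tau> R \<theta>] assms unfolding eq by simp
  with assms show "dmor_eq \<A> \<B> P Q"
    unfolding eq by simp
qed

lemma dmorphism_reflectI:
  assumes "dmorphism \<B> \<C> Q" "dmorphism \<A> \<C> (dcomp \<A> \<B> \<C> Q P)"
    and "covariant_functor (fst \<A>) (fst \<B>) (fst P)"
    and "\<And>X. X \<in> Obj (fst \<A>) \<Longrightarrow>
      isom (fst \<B>) (fob (fst P) (fob (fst (snd \<A>)) X)) (fob (fst (snd \<B>)) (fob (fst P) X)) (snd P X)"
    and "\<And>a b. \<lbrakk>ok (fst \<B>) a; ok (fst \<B>) b; src a = src b; tgt a = tgt b;
      acov (fst \<B>) (fst Q) a = acov (fst \<B>) (fst Q) b\<rbrakk> \<Longrightarrow> a = b"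
  shows "dmorphism \<A> \<B> P"
proof -
  obtain C1 D1 \<delta>1 C2 D2 \<delta>2 C3 D3 \<delta>3 R \<theta> S \<tau>
    where eq: "\<A> = (C1, D1, \<delta>1)" "\<B> = (C2, D2, \<delta>2)" "\<C> = (C3, D3, \<delta>3)" "P = (R, \<theta>)" "Q = (S, \<tau>)"
    by (metis prod.exhaust)
  show ?thesis
    using dmorphism_reflect[of C2 D2 \<delta>2 C3 D3 \<delta>3 S \<tau> C1 D1 \<delta>1 R \<theta>] assms unfolding eq by simp
qed

lemma dmorphism_transportI:
  assumes "dmorphism \<A> \<B> Q" "covariant_functor (fst \<A>) (fst \<B>) (fst P)"
    and "nat_iso_cov (fst \<A>) (fst \<B>) (fst P) (fst Q) \<rho>"
    and "\<And>X. X \<in> Obj (fst \<A>) \<Longrightarrow> fmor (fst (snd \<B>)) (fob (fst P) X) (fob (fst Q) X) (\<rho> X)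
      \<cdot>\<^bsub>fst \<B>\<^esub> snd Q X \<cdot>\<^bsub>fst \<B>\<^esub> \<rho> (fob (fst (snd \<A>)) X) = snd P X"
  shows "dmorphism \<A> \<B> P"
proof -
  obtain C1 D1 \<delta>1 C2 D2 \<delta>2 R \<theta> S \<tau>
    where eq: "\<A> = (C1, D1, \<delta>1)" "\<B> = (C2, D2, \<delta>2)" "P = (R, \<theta>)" "Q = (S, \<tau>)"
    by (metis prod.exhaust)
  show ?thesis
    using dmorphism_transport[of C1 D1 \<delta>1 C2 D2 \<delta>2 S \<tau> R \<rho> \<theta>] assms unfolding eq by simp
qed

lemma similar_viaI:
  assumes "dmorphism \<A> \<B> P" "dmorphism \<A> \<B> Q"
    and "nat_iso_cov (fst \<A>) (fst \<B>) (fst P) (fst Q) \<rho>"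
    and "\<And>X. X \<in> Obj (fst \<A>) \<Longrightarrow> fmor (fst (snd \<B>)) (fob (fst P) X) (fob (fst Q) X) (\<rho> X)
      \<cdot>\<^bsub>fst \<B>\<^esub> snd Q X \<cdot>\<^bsub>fst \<B>\<^esub> \<rho> (fob (fst (snd \<A>)) X) = \<mu> \<odot>\<^bsub>fst \<B>\<^esub> snd P X"
  shows "similar_via \<mu> \<A> \<B> P Q"
  using assms by (cases \<A>; cases \<B>; cases P; cases Q) auto

section \<open>Conjugation, duality and commutation on arrows\<close>

locale conj_dual =
  fixes K :: "('o, 'm, 'k::{comm_ring, comm_monoid_mult}) cdcat"
  assumes K: "conjugation_duality_category K"

sublocale conj_dual \<subseteq> dual_category "ucat K" "dua K" "del K"
  using K by (intro dual_categoryI) (simp add: conjugation_duality_category_def)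

sublocale conj_dual \<subseteq> I: cov_functor "ucat K" "ucat K" "cnj K"
  using K by unfold_locales (simp add: conjugation_duality_category_def conjugation_def)

context conj_dual
begin

abbreviation "C \<equiv> ucat K"
abbreviation "io \<equiv> fob (cnj K)"
abbreviation "dob \<equiv> fob (dua K)"
abbreviation cmp (infixr "\<cdot>" 70) where "b \<cdot> a \<equiv> acmp C b a"
abbreviation add (infixl "\<oplus>" 65) where "a \<oplus> b \<equiv> aadd C a b"
abbreviation scl (infixr "\<odot>" 75) where "r \<odot> a \<equiv> ascl C r a"
abbreviation "iv a \<equiv> ainv C a"
abbreviation "ide X \<equiv> aid C X"
abbreviation "zer X Y \<equiv> azer C X Y"
abbreviation "I a \<equiv> acov C (cnj K) a"
abbreviation "D a \<equiv> acon C (dua K) a"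

definition "lm X = arw (io (io X)) X (lam K X)"
definition "al X = arw (io (dob X)) (dob (io X)) (alp K X)"

lemma lm_al_src_tgt [simp]: "src (lm X) = io (io X)" "tgt (lm X) = X"
    "src (al X) = io (dob X)" "tgt (al X) = dob (io X)"
  by (simp_all add: lm_def al_def)

lemma mor_lm: "lam K X = mor (lm X)"
  and mor_al: "alp K X = mor (al X)"
  by (simp_all add: lm_def al_def)

lemma conj: "conjugation C (cnj K) (lam K)"
  and comm: "commutation C (cnj K) (lam K) (dua K) (del K) (alp K)"
  using K by (simp_all add: conjugation_duality_category_def)

lemma aiso_lm [simp]: "X \<in> Obj C \<Longrightarrow> aiso C (lm X)"
  and ok_lm [simp]: "X \<in> Obj C \<Longrightarrow> ok C (lm X)"
  using conj by (auto simp: lm_def conjugation_def nat_iso_cov_def isom_def)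

lemma aiso_al [simp]: "X \<in> Obj C \<Longrightarrow> aiso C (al X)"
  and ok_al [simp]: "X \<in> Obj C \<Longrightarrow> ok C (al X)"
  using comm by (auto simp: al_def commutation_def nat_iso_con_def isom_def)

lemma square_reassoc:
  assumes "a \<cdot> b = c \<cdot> d"
  shows "a \<cdot> (b \<cdot> x) = c \<cdot> (d \<cdot> x)"
  using acmp_reassoc[OF assms] by simp

lemma square_inv:
  assumes "a \<cdot> b = c \<cdot> d" "aiso C a" "aiso C d" "ok C b" "ok C c" "src a = tgt b" "src c = tgt d"
  shows "iv a \<cdot> c = b \<cdot> iv d"
proof -
  have "iv a \<cdot> c = iv a \<cdot> (c \<cdot> d) \<cdot> iv d" using assms(2-) by (simp add: ok_aiso)
  also have "\<dots> = iv a \<cdot> (a \<cdot> b) \<cdot> iv d" by (simp only: assms(1))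
  also have "\<dots> = b \<cdot> iv d"
  proof -
    have "src b = src d" by (metis assms(1) src_tgt(1))
    then show ?thesis using assms(2-) by (simp add: ok_aiso)
  qed
  finally show ?thesis .
qed

text \<open>
  Each naturality law comes in two forms, the second one for use inside a longer composite. Where the
  object is a parameter \<open>X\<close> with a premise \<open>src a = X\<close> or \<open>tgt a = Y\<close>, the law still applies after the
  source or target of \<open>a\<close> has been simplified.
\<close>

lemma lm_nat:
  assumes "ok C a" "tgt a = Y"
  shows "lm Y \<cdot> I (I a) = a \<cdot> lm (src a)"
    and "lm Y \<cdot> (I (I a) \<cdot> c) = a \<cdot> (lm (src a) \<cdot> c)"
proof -
  show *: "lm Y \<cdot> I (I a) = a \<cdot> lm (src a)"
    using nat_iso_cov_square[of C "comp_cov (cnj K) (cnj K)" idf "lam K" a] conj assms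
    by (auto simp: conjugation_def lm_def)
  show "lm Y \<cdot> (I (I a) \<cdot> c) = a \<cdot> (lm (src a) \<cdot> c)"
    by (rule square_reassoc[OF *])
qed

lemma inv_lm_nat:
  assumes "ok C a" "tgt a = Y"
  shows "iv (lm Y) \<cdot> a = I (I a) \<cdot> iv (lm (src a))"
    and "iv (lm Y) \<cdot> (a \<cdot> c) = I (I a) \<cdot> (iv (lm (src a)) \<cdot> c)"
proof -
  show *: "iv (lm Y) \<cdot> a = I (I a) \<cdot> iv (lm (src a))"
    using assms by (intro square_inv lm_nat(1)) auto
  show "iv (lm Y) \<cdot> (a \<cdot> c) = I (I a) \<cdot> (iv (lm (src a)) \<cdot> c)"
    by (rule square_reassoc[OF *])
qed

lemma al_nat:
  assumes "ok C a" "src a = X"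
  shows "al X \<cdot> I (D a) = D (I a) \<cdot> al (tgt a)"
    and "al X \<cdot> (I (D a) \<cdot> c) = D (I a) \<cdot> (al (tgt a) \<cdot> c)"
proof -
  show *: "al X \<cdot> I (D a) = D (I a) \<cdot> al (tgt a)"
    using nat_iso_con_square[of C "comp_con (cnj K) (dua K)" "comp_cov (dua K) (cnj K)" "alp K" a] comm assms
    by (auto simp: commutation_def al_def)
  show "al X \<cdot> (I (D a) \<cdot> c) = D (I a) \<cdot> (al (tgt a) \<cdot> c)"
    by (rule square_reassoc[OF *])
qed

lemma inv_al_nat:
  assumes "ok C a" "src a = X"
  shows "iv (al X) \<cdot> D (I a) = I (D a) \<cdot> iv (al (tgt a))"
    and "iv (al X) \<cdot> (D (I a) \<cdot> c) = I (D a) \<cdot> (iv (al (tgt a)) \<cdot> c)"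
proof -
  show *: "iv (al X) \<cdot> D (I a) = I (D a) \<cdot> iv (al (tgt a))"
    using assms by (intro square_inv al_nat(1)) auto
  show "iv (al X) \<cdot> (D (I a) \<cdot> c) = I (D a) \<cdot> (iv (al (tgt a)) \<cdot> c)"
    by (rule square_reassoc[OF *])
qed

lemma lm_io [simp]: "X \<in> Obj C \<Longrightarrow> lm (io X) = I (lm X)"
proof -
  assume X: "X \<in> Obj C"
  then have "lam K (io X) = fmor (cnj K) (io (io X)) X (lam K X)"
    using conj by (simp add: conjugation_def)
  then show ?thesis
    using X by (intro arr_eqI) (simp_all add: mor_lm I.fmor_mor)
qed

text \<open>
  The instance of \<open>lm_nat\<close> at \<open>io X\<close>, in the form in which \<open>lm_io\<close> leaves it.
\<close>

lemma lm_nat_io: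
  assumes "X \<in> Obj C" "ok C a" "tgt a = io X"
  shows "I (lm X) \<cdot> I (I a) = a \<cdot> lm (src a)"
    and "I (lm X) \<cdot> (I (I a) \<cdot> c) = a \<cdot> (lm (src a) \<cdot> c)"
  using lm_nat[OF assms(2,3)] assms(1) by simp_all

lemma al_dl: "X \<in> Obj C \<Longrightarrow> al (dob X) \<cdot> I (dl X) = D (al X) \<cdot> dl (io X)"
proof -
  assume X: "X \<in> Obj C"
  then have "alp K (dob X) \<cdot>\<^bsub>C\<^esub> fmor (cnj K) X (dob (dob X)) (del K X)
        = fmor (dua K) (io (dob X)) (dob (io X)) (alp K X) \<cdot>\<^bsub>C\<^esub> del K (io X)"
    using comm by (simp add: commutation_def)
  then show ?thesis
    using X by (simp add: mor_dl mor_al I.fmor_mor D.fmor_mor mor_acmp)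
qed

text \<open>
  The second axiom of a commutation, freed of inverses.
\<close>

lemma al_lm: "X \<in> Obj C \<Longrightarrow> al (io X) \<cdot> I (al X) = D (lm X) \<cdot> lm (dob X)"
proof -
  assume X: "X \<in> Obj C"
  then have "Inv C (io (dob (io X))) (dob (io (io X))) (alp K (io X)) \<cdot>\<^bsub>C\<^esub> fmor (dua K) (io (io X)) X (lam K X)
        = fmor (cnj K) (io (dob X)) (dob (io X)) (alp K X)
          \<cdot>\<^bsub>C\<^esub> Inv C (io (io (dob X))) (dob X) (lam K (dob X))"
    using comm by (simp add: commutation_def)
  then have *: "iv (al (io X)) \<cdot> D (lm X) = I (al X) \<cdot> iv (lm (dob X))"
    using X by (simp add: mor_lm mor_al I.fmor_mor D.fmor_mor mor_acmp mor_ainv)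
  have "al (io X) \<cdot> (I (al X) \<cdot> iv (lm (dob X))) \<cdot> lm (dob X) = D (lm X) \<cdot> lm (dob X)"
    unfolding *[symmetric] using X by simp
  then show ?thesis
    using X by simp
qed

lemmas to_arrow = mor_lm mor_al mor_dl to_arr[where C = C] I.fmor_mor D.fmor_mor

lemma I_square:
  assumes "a \<cdot> b = c \<cdot> d" "src a = tgt b" "src c = tgt d"
  shows "I a \<cdot> I b = I c \<cdot> I d" "I a \<cdot> (I b \<cdot> x) = I c \<cdot> (I d \<cdot> x)"
proof -
  show *: "I a \<cdot> I b = I c \<cdot> I d"
    using arg_cong[OF assms(1), of I] assms(2,3) by simp
  show "I a \<cdot> (I b \<cdot> x) = I c \<cdot> (I d \<cdot> x)"
    by (rule square_reassoc[OF *])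
qed

lemma D_square:
  assumes "a \<cdot> b = c \<cdot> d" "src a = tgt b" "src c = tgt d"
  shows "D b \<cdot> D a = D d \<cdot> D c" "D b \<cdot> (D a \<cdot> x) = D d \<cdot> (D c \<cdot> x)"
proof -
  show *: "D b \<cdot> D a = D d \<cdot> D c"
    using arg_cong[OF assms(1), of D] assms(2,3) by simp
  show "D b \<cdot> (D a \<cdot> x) = D d \<cdot> (D c \<cdot> x)"
    by (rule square_reassoc[OF *])
qed

lemma I_al_nat:
  assumes "ok C a" "src a = X"
  shows "I (al X) \<cdot> I (I (D a)) = I (D (I a)) \<cdot> I (al (tgt a))"
    "I (al X) \<cdot> (I (I (D a)) \<cdot> c) = I (D (I a)) \<cdot> (I (al (tgt a)) \<cdot> c)"
  using I_square[OF al_nat(1)[OF assms]] assms by simp_all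

lemma D_inv_lm_al:
  assumes "X \<in> Obj C"
  shows "D (iv (lm X)) \<cdot> al (io X) = lm (dob X) \<cdot> I (iv (al X))"
    and "D (iv (lm X)) \<cdot> (al (io X) \<cdot> c) = lm (dob X) \<cdot> (I (iv (al X)) \<cdot> c)"
    and "I (D (iv (lm X))) \<cdot> I (al (io X)) = I (lm (dob X)) \<cdot> I (I (iv (al X)))"
    and "I (D (iv (lm X))) \<cdot> (I (al (io X)) \<cdot> c) = I (lm (dob X)) \<cdot> (I (I (iv (al X))) \<cdot> c)"
proof -
  show *: "D (iv (lm X)) \<cdot> al (io X) = lm (dob X) \<cdot> I (iv (al X))"
    using square_inv[OF al_lm[OF assms, symmetric]] assms by simp
  show "D (iv (lm X)) \<cdot> (al (io X) \<cdot> c) = lm (dob X) \<cdot> (I (iv (al X)) \<cdot> c)"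
    by (rule square_reassoc[OF *])
  show "I (D (iv (lm X))) \<cdot> I (al (io X)) = I (lm (dob X)) \<cdot> I (I (iv (al X)))"
    and "I (D (iv (lm X))) \<cdot> (I (al (io X)) \<cdot> c) = I (lm (dob X)) \<cdot> (I (I (iv (al X))) \<cdot> c)"
    using I_square[OF *] assms by simp_all
qed

lemma inv_al_lm:
  assumes "X \<in> Obj C"
  shows "iv (al (io X)) \<cdot> D (lm X) = I (al X) \<cdot> iv (lm (dob X))"
    and "iv (al (io X)) \<cdot> (D (lm X) \<cdot> c) = I (al X) \<cdot> (iv (lm (dob X)) \<cdot> c)"
proof -
  show *: "iv (al (io X)) \<cdot> D (lm X) = I (al X) \<cdot> iv (lm (dob X))"
    using square_inv[OF al_lm[OF assms]] assms by simp
  show "iv (al (io X)) \<cdot> (D (lm X) \<cdot> c) = I (al X) \<cdot> (iv (lm (dob X)) \<cdot> c)"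
    by (rule square_reassoc[OF *])
qed

lemma inv_al_D_al:
  assumes "X \<in> Obj C"
  shows "iv (al (dob X)) \<cdot> D (al X) = I (dl X) \<cdot> iv (dl (io X))"
  using square_inv[OF al_dl[OF assms]] assms by simp

lemmas al_lm_reassoc = square_reassoc[OF al_lm]
lemmas cancel = I.acov_cancel D.acon_cancel
lemmas vanish = I.acov_vanish D.acon_vanish
lemmas nats = al_nat inv_al_nat lm_nat lm_nat_io I_al_nat

section \<open>The duality \<open>\<iota>D\<close>\<close>

abbreviation "ID \<equiv> comp_con (cnj K) (dua K)"

definition "da X = I (al (dob X)) \<cdot> iv (lm (dob (dob X))) \<cdot> dl X"

lemma da_src_tgt [simp]: "src (da X) = X" "tgt (da X) = io (dob (io (dob X)))"
  by (simp_all add: da_def)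

lemma aiso_da [simp]: "X \<in> Obj C \<Longrightarrow> aiso C (da X)"
  and ok_da [simp]: "X \<in> Obj C \<Longrightarrow> ok C (da X)"
  by (simp_all add: da_def)

lemma da_nat:
  assumes "ok C a" "tgt a = Y"
  shows "da Y \<cdot> a = I (D (I (D a))) \<cdot> da (src a)"
proof -
  have "da Y \<cdot> a = I (al (dob Y)) \<cdot> iv (lm (dob (dob Y))) \<cdot> D (D a) \<cdot> dl (src a)"
    using assms by (simp add: da_def dl_nat)
  also have "\<dots> = I (al (dob Y)) \<cdot> I (I (D (D a))) \<cdot> iv (lm (dob (dob (src a)))) \<cdot> dl (src a)"
    using assms inv_lm_nat(2)[of "D (D a)"] by simp
  also have "\<dots> = I (D (I (D a))) \<cdot> da (src a)"
    using assms by (simp add: nats da_def)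
  finally show ?thesis .
qed

text \<open>
  Both \<open>I (D (da X))\<close> and \<open>da (io (dob X))\<close> contain \<open>\<lambda>\<close> and \<open>\<alpha>\<close>. The second axiom of the commutation
  replaces \<open>D(\<lambda>\<^sup>-\<^sup>1) \<alpha>\<close> by \<open>\<lambda> \<iota>(\<alpha>\<^sup>-\<^sup>1)\<close>, the first axiom turns the two remaining \<open>\<alpha>\<close> into \<open>\<delta>\<close>, and naturality of \<open>\<lambda>\<close>
  cancels \<open>\<lambda>\<close> against its inverse. What is left is the triangle identity of \<open>\<delta>\<close>.
\<close>

lemma da_triangle:
  assumes X: "X \<in> Obj C"
  shows "I (D (da X)) \<cdot> da (io (dob X)) = ide (io (dob X))"
proof -
  let ?d = "dob X" let ?dd = "dob ?d" let ?i = "io ?d"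
  have "I (D (da X)) \<cdot> da ?i
    = I (D (dl X)) \<cdot> I (D (iv (lm ?dd))) \<cdot> I (D (I (al ?d)) \<cdot> al (dob ?i)) \<cdot> iv (lm (dob (dob ?i))) \<cdot> dl ?i"
    using X by (simp add: da_def)
  also have "\<dots> = I (D (dl X)) \<cdot> I (D (iv (lm ?dd)) \<cdot> al (io ?dd)) \<cdot> I (I (D (al ?d))) \<cdot> iv (lm (dob (dob ?i))) \<cdot> dl ?i"
    using X by (simp add: I_al_nat)
  also have "\<dots> = I (D (dl X)) \<cdot> I (lm (dob ?dd)) \<cdot> I (I (iv (al ?dd) \<cdot> D (al ?d))) \<cdot> iv (lm (dob (dob ?i))) \<cdot> dl ?i"
    using X unfolding D_inv_lm_al(1)[OF D.fob_in[OF D.fob_in[OF X]]] by simp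
  also have "\<dots> = I (D (dl X)) \<cdot> I (lm (dob ?dd) \<cdot> I (I (dl ?d))) \<cdot> I (I (iv (dl ?i))) \<cdot> iv (lm (dob (dob ?i))) \<cdot> dl ?i"
    using X unfolding inv_al_D_al[OF D.fob_in[OF X]] by simp
  also have "\<dots> = I (D (dl X)) \<cdot> I (D (iv (dl X))) \<cdot> I (lm (dob X)) \<cdot> I (I (iv (dl ?i))) \<cdot> iv (lm (dob (dob ?i))) \<cdot> dl ?i"
    using X lm_nat(1)[of "dl ?d"] by simp
  also have "\<dots> = I (D (dl X)) \<cdot> I (D (iv (dl X))) \<cdot> iv (dl ?i) \<cdot> dl ?i"
    using X lm_nat(2)[of "iv (dl ?i)" ?i] by simp
  also have "\<dots> = ide ?i"
    using X by (simp add: cancel)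
  finally show ?thesis .
qed

lemma dual_category_ID: "dual_category C ID (\<lambda>X. mor (da X))"
proof -
  interpret ID: con_functor C C ID
    by (rule comp_con_functor) unfold_locales
  have "nat_iso_cov C C idf (comp_con ID ID) (\<lambda>X. mor (da X))"
    by (rule nat_iso_covI[where \<rho> = da]) (simp_all add: da_nat)
  moreover have "mor (da (fob ID X)) = Inv C (fob ID (fob ID (fob ID X))) (fob ID X) (fmor ID X (fob ID (fob ID X)) (mor (da X)))"
    if X: "X \<in> Obj C" for X
  proof -
    have "I (D (iv (da X))) = I (D (iv (da X))) \<cdot> (I (D (da X)) \<cdot> da (io (dob X)))"
      using X da_triangle[OF X] by simp
    also have "\<dots> = da (io (dob X))"
      using X by (simp add: cancel del: acmp_assoc flip: acmp_assoc)
    finally show ?thesis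
      using X by (simp add: ID.fmor_mor mor_ainv)
  qed
  ultimately show ?thesis
    by unfold_locales (simp add: duality_def ID.is_functor)
qed

text \<open>
  The double-dual isomorphism of \<open>dualID K\<close> as raw morphism; it agrees with \<open>mor (da X)\<close> on objects only,
  hence the two names.
\<close>

definition "dID X = fmor (cnj K) (io (dob (dob X))) (dob (io (dob X))) (alp K (dob X))
      \<cdot>\<^bsub>C\<^esub> Inv C (io (io (dob (dob X)))) (dob (dob X)) (lam K (dob (dob X))) \<cdot>\<^bsub>C\<^esub> del K X"

lemma dualID_eq: "dualID K = (C, ID, dID)"
  by (simp add: dualID_def Let_def dID_def[abs_def])

lemma dID: "X \<in> Obj C \<Longrightarrow> dID X = mor (da X)"
  by (simp add: dID_def da_def to_arrow)

lemma category_with_duality_ID: "category_with_duality (dualID K)"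
proof -
  interpret ID: dual_category C ID "\<lambda>X. mor (da X)"
    by (rule dual_category_ID)
  have "duality C ID dID"
    using ID.dual by (simp add: duality_def nat_iso_cov_def dID)
  then show ?thesis
    by (simp add: dualID_eq pseudo_abelian_category_axioms)
qed

lemma category_with_duality_D: "category_with_duality (dualD K)"
  using dual by (simp add: dualD_def pseudo_abelian_category_axioms)

end

section \<open>Biproducts on arrows\<close>

definition "bi1 X b = arw X (bsum b) (in1 b)"
definition "bi2 Y b = arw Y (bsum b) (in2 b)"
definition "bp1 X b = arw (bsum b) X (pr1 b)"
definition "bp2 Y b = arw (bsum b) Y (pr2 b)"

lemma bip_src_tgt [simp]:
  "src (bi1 X b) = X" "tgt (bi1 X b) = bsum b" "src (bi2 Y b) = Y" "tgt (bi2 Y b) = bsum b"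
  "src (bp1 X b) = bsum b" "tgt (bp1 X b) = X" "src (bp2 Y b) = bsum b" "tgt (bp2 Y b) = Y"
  by (simp_all add: bi1_def bi2_def bp1_def bp2_def)

lemma mor_bip:
  "in1 b = mor (bi1 X b)" "in2 b = mor (bi2 Y b)" "pr1 b = mor (bp1 X b)" "pr2 b = mor (bp2 Y b)"
  by (simp_all add: bi1_def bi2_def bp1_def bp2_def)

definition amat where
  "amat C X Y b X' Y' b' a11 a12 a21 a22 =
     (bi1 X' b' \<star>\<^bsub>C\<^esub> a11 \<star>\<^bsub>C\<^esub> bp1 X b \<boxplus>\<^bsub>C\<^esub> bi1 X' b' \<star>\<^bsub>C\<^esub> a12 \<star>\<^bsub>C\<^esub> bp2 Y b)
     \<boxplus>\<^bsub>C\<^esub> (bi2 Y' b' \<star>\<^bsub>C\<^esub> a21 \<star>\<^bsub>C\<^esub> bp1 X b \<boxplus>\<^bsub>C\<^esub> bi2 Y' b' \<star>\<^bsub>C\<^esub> a22 \<star>\<^bsub>C\<^esub> bp2 Y b)"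

context linear_category
begin

lemma biproduct_iff:
  assumes "X \<in> Obj C" "Y \<in> Obj C"
  shows "biproduct C X Y b \<longleftrightarrow> bsum b \<in> Obj C \<and>
    ok C (bi1 X b) \<and> ok C (bi2 Y b) \<and> ok C (bp1 X b) \<and> ok C (bp2 Y b) \<and>
    bp1 X b \<star> bi1 X b = aid C X \<and> bp2 Y b \<star> bi2 Y b = aid C Y \<and>
    bp1 X b \<star> bi2 Y b = azer C Y X \<and> bp2 Y b \<star> bi1 X b = azer C X Y \<and>
    bi1 X b \<star> bp1 X b \<boxplus> bi2 Y b \<star> bp2 Y b = aid C (bsum b)"
proof (cases "bsum b \<in> Obj C \<and> ok C (bi1 X b) \<and> ok C (bi2 Y b) \<and> ok C (bp1 X b) \<and> ok C (bp2 Y b)")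
  case True
  then show ?thesis
    using assms
    by (simp add: biproduct_def mor_bip(1)[of b X] mor_bip(2)[of b Y] mor_bip(3)[of b X] mor_bip(4)[of b Y] to_arr)
next
  case False
  then show ?thesis
    using assms by (auto simp: biproduct_def bi1_def bi2_def bp1_def bp2_def)
qed

text \<open>
  The equations of a biproduct as rewrite rules; the repeated ones serve longer composites.
\<close>

lemma bip_simps:
  assumes "biproduct C X Y b" "X \<in> Obj C" "Y \<in> Obj C"
  shows "bsum b \<in> Obj C" "ok C (bi1 X b)" "ok C (bi2 Y b)" "ok C (bp1 X b)" "ok C (bp2 Y b)"
    "bp1 X b \<star> bi1 X b = aid C X" "bp2 Y b \<star> bi2 Y b = aid C Y"
    "bp1 X b \<star> bi2 Y b = azer C Y X" "bp2 Y b \<star> bi1 X b = azer C X Y"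
    "\<lbrakk>ok C c; tgt c = X\<rbrakk> \<Longrightarrow> bp1 X b \<star> (bi1 X b \<star> c) = c"
    "\<lbrakk>ok C c; tgt c = Y\<rbrakk> \<Longrightarrow> bp2 Y b \<star> (bi2 Y b \<star> c) = c"
    "\<lbrakk>ok C c; tgt c = Y\<rbrakk> \<Longrightarrow> bp1 X b \<star> (bi2 Y b \<star> c) = azer C (src c) X"
    "\<lbrakk>ok C c; tgt c = X\<rbrakk> \<Longrightarrow> bp2 Y b \<star> (bi1 X b \<star> c) = azer C (src c) Y"
    "bi1 X b \<star> bp1 X b \<boxplus> bi2 Y b \<star> bp2 Y b = aid C (bsum b)"
  using assms(1)[unfolded biproduct_iff[OF assms(2,3)]] assms(2,3) by (auto simp: acmp_reassoc)

lemma bip_ext: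
  assumes "biproduct C X Y b" "X \<in> Obj C" "Y \<in> Obj C"
    "ok C u" "ok C v" "src u = bsum b" "src v = bsum b" "tgt u = tgt v"
    "u \<star> bi1 X b = v \<star> bi1 X b" "u \<star> bi2 Y b = v \<star> bi2 Y b"
  shows "u = v"
proof -
  note b = bip_simps[OF assms(1-3)]
  have "u \<star> (bi1 X b \<star> bp1 X b \<boxplus> bi2 Y b \<star> bp2 Y b) = v \<star> (bi1 X b \<star> bp1 X b \<boxplus> bi2 Y b \<star> bp2 Y b)"
    by (simp add: acmp_reassoc[OF assms(9)] acmp_reassoc[OF assms(10)])
  then show ?thesis
    using assms(4-8) by (simp add: b)
qed

lemma mat_arr:
  assumes b: "biproduct C X Y b" "X \<in> Obj C" "Y \<in> Obj C"
    and b': "biproduct C X' Y' b'" "X' \<in> Obj C" "Y' \<in> Obj C"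
    and "ok C a11" "src a11 = X" "tgt a11 = X'" "ok C a12" "src a12 = Y" "tgt a12 = X'"
    and "ok C a21" "src a21 = X" "tgt a21 = Y'" "ok C a22" "src a22 = Y" "tgt a22 = Y'"
  shows "mat C b b' (mor a11) (mor a12) (mor a21) (mor a22) = mor (amat C X Y b X' Y' b' a11 a12 a21 a22)"
    and "ok C (amat C X Y b X' Y' b' a11 a12 a21 a22)"
  using assms(7-) bip_simps(1-5)[OF b] bip_simps(1-5)[OF b']
  by (simp_all add: mat_def amat_def mor_bip(1)[of b X] mor_bip(2)[of b Y] mor_bip(3)[of b X] mor_bip(4)[of b Y] mor_bip(1)[of b' X'] mor_bip(2)[of b' Y'] mor_bip(3)[of b' X'] mor_bip(4)[of b' Y'] to_arr)

end

lemma (in cov_functor) biproduct_bip_cov: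
  assumes "biproduct C1 X Y b" "X \<in> Obj C1" "Y \<in> Obj C1"
  shows "biproduct C2 (fo X) (fo Y) (bip_cov F X Y b)"
    and "bi1 (fo X) (bip_cov F X Y b) = fa (bi1 X b)" "bi2 (fo Y) (bip_cov F X Y b) = fa (bi2 Y b)"
    and "bp1 (fo X) (bip_cov F X Y b) = fa (bp1 X b)" "bp2 (fo Y) (bip_cov F X Y b) = fa (bp2 Y b)"
proof -
  note b = C1.bip_simps[OF assms]
  show e: "bi1 (fo X) (bip_cov F X Y b) = fa (bi1 X b)" "bi2 (fo Y) (bip_cov F X Y b) = fa (bi2 Y b)"
    "bp1 (fo X) (bip_cov F X Y b) = fa (bp1 X b)" "bp2 (fo Y) (bip_cov F X Y b) = fa (bp2 Y b)"
    using b(2-5) by (simp_all add: bi1_def bi2_def bp1_def bp2_def bip_cov_def acov_def, simp_all add: arw_def)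
  have "fa (bi1 X b) \<star>\<^bsub>C2\<^esub> fa (bp1 X b) \<boxplus>\<^bsub>C2\<^esub> fa (bi2 Y b) \<star>\<^bsub>C2\<^esub> fa (bp2 Y b)
    = fa (bi1 X b \<star>\<^bsub>C1\<^esub> bp1 X b \<boxplus>\<^bsub>C1\<^esub> bi2 Y b \<star>\<^bsub>C1\<^esub> bp2 Y b)"
    by simp
  then show "biproduct C2 (fo X) (fo Y) (bip_cov F X Y b)"
    using assms b by (simp add: C2.biproduct_iff e) (simp add: acov_cancel acov_vanish b bip_cov_def)
qed

lemma (in con_functor) biproduct_bip_con:
  assumes "biproduct C1 X Y b" "X \<in> Obj C1" "Y \<in> Obj C1"
  shows "biproduct C2 (fo X) (fo Y) (bip_con F X Y b)"
    and "bi1 (fo X) (bip_con F X Y b) = fa (bp1 X b)" "bi2 (fo Y) (bip_con F X Y b) = fa (bp2 Y b)"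
    and "bp1 (fo X) (bip_con F X Y b) = fa (bi1 X b)" "bp2 (fo Y) (bip_con F X Y b) = fa (bi2 Y b)"
proof -
  note b = C1.bip_simps[OF assms]
  show e: "bi1 (fo X) (bip_con F X Y b) = fa (bp1 X b)" "bi2 (fo Y) (bip_con F X Y b) = fa (bp2 Y b)"
    "bp1 (fo X) (bip_con F X Y b) = fa (bi1 X b)" "bp2 (fo Y) (bip_con F X Y b) = fa (bi2 Y b)"
    using b(2-5) by (simp_all add: bi1_def bi2_def bp1_def bp2_def bip_con_def acon_def, simp_all add: arw_def)
  have "fa (bp1 X b) \<star>\<^bsub>C2\<^esub> fa (bi1 X b) \<boxplus>\<^bsub>C2\<^esub> fa (bp2 Y b) \<star>\<^bsub>C2\<^esub> fa (bi2 Y b)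
    = fa (bi1 X b \<star>\<^bsub>C1\<^esub> bp1 X b \<boxplus>\<^bsub>C1\<^esub> bi2 Y b \<star>\<^bsub>C1\<^esub> bp2 Y b)"
    by simp
  then show "biproduct C2 (fo X) (fo Y) (bip_con F X Y b)"
    using assms b by (simp add: C2.biproduct_iff e) (simp add: acon_cancel acon_vanish b bip_con_def)
qed

section \<open>The double\<close>

context conj_dual
begin

abbreviation "C' \<equiv> ucat (double K)"

text \<open>
  An object \<open>(X, f)\<close> of \<open>\<C>'\<close> is represented by the typed arrow \<open>a\<close> of \<open>\<C>\<close> with underlying morphism \<open>f\<close>, since
  \<open>X = tgt a\<close>; \<open>cj a\<close> says that \<open>ob a\<close> is an object of \<open>\<C>'\<close>. A morphism \<open>ob a \<rightarrow> ob b\<close> is an arrow \<open>p\<close> of \<open>\<C>\<close> with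
  \<open>p \<cdot> a = b \<cdot> I p\<close>. In this way all claims about \<open>\<C>'\<close>, and later \<open>\<C>''\<close>, become equations between arrows of \<open>\<C>\<close>.
\<close>

definition "cj a \<longleftrightarrow> aiso C a \<and> src a = io (tgt a) \<and> a \<cdot> I a = lm (tgt a)"

abbreviation "ob a \<equiv> (tgt a, mor a)"

lemma cjI: "\<lbrakk>aiso C a; src a = io (tgt a); a \<cdot> I a = lm (tgt a)\<rbrakk> \<Longrightarrow> cj a"
  by (simp add: cj_def)

lemma cjD [simp]:
  assumes "cj a"
  shows "aiso C a" "ok C a" "src a = io (tgt a)" "a \<cdot> I a = lm (tgt a)" "tgt a \<in> Obj C"
  using assms by (auto simp: cj_def ok_aiso)

lemma cj_reassoc: "cj a \<Longrightarrow> a \<cdot> (I a \<cdot> c) = lm (tgt a) \<cdot> c"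
  by (rule acmp_reassoc) simp

lemma iv_cj: "cj a \<Longrightarrow> iv a = I a \<cdot> iv (lm (tgt a))"
proof -
  assume a: "cj a"
  then have "I a \<cdot> iv (lm (tgt a)) = iv a \<cdot> (a \<cdot> I a) \<cdot> iv (lm (tgt a))"
    by (simp del: cjD(4))
  also have "\<dots> = iv a"
    using a by simp
  finally show ?thesis ..
qed

lemma double_simps:
  "Cmp C' = Cmp C" "Add C' = Add C" "Scl C' = Scl C"
  "Zer C' P Q = Zer C (fst P) (fst Q)" "Idn C' P = Idn C (fst P)" "\<ominus>\<^bsub>C'\<^esub> m = \<ominus>\<^bsub>C\<^esub> m"
  "fmor (cnj (double K)) P Q m = fmor (cnj K) (fst P) (fst Q) m"
  "fmor (dua (double K)) P Q m = fmor (dua K) (fst P) (fst Q) m"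
  "fst (fob (cnj (double K)) P) = io (fst P)" "fst (fob (dua (double K)) P) = dob (fst P)"
  "lam (double K) P = \<ominus>\<^bsub>C\<^esub> lam K (fst P)" "del (double K) P = del K (fst P)"
  "alp (double K) P = \<ominus>\<^bsub>C\<^esub> alp K (fst P)"
  by (simp_all add: double_def double_cat_def Neg_def Let_def split: prod.splits)

lemma Obj_double: "P \<in> Obj C' \<longleftrightarrow> (\<exists>a. P = ob a \<and> cj a)"
proof (cases P)
  case (Pair X f)
  have "(X, f) \<in> Obj C' \<longleftrightarrow> X \<in> Obj C \<and> isom C (io X) X f \<and> f \<cdot>\<^bsub>C\<^esub> fmor (cnj K) (io X) X f = lam K X"
    by (simp add: double_def double_cat_def Let_def)
  also have "\<dots> \<longleftrightarrow> (\<exists>a. (X, f) = ob a \<and> cj a)"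
  proof
    assume *: "X \<in> Obj C \<and> isom C (io X) X f \<and> f \<cdot>\<^bsub>C\<^esub> fmor (cnj K) (io X) X f = lam K X"
    then have "isom C (io X) X f" "io X \<in> Obj C" "X \<in> Obj C" by simp_all
    then obtain a where a: "f = mor a" "ok C a" "aiso C a" "src a = io X" "tgt a = X"
      by (rule iso_cases)
    then have "a \<cdot> I a = lm X"
      using * \<open>X \<in> Obj C\<close> by (simp add: to_arrow)
    with a show "\<exists>a. (X, f) = ob a \<and> cj a"
      by (intro exI[of _ a] conjI cjI) simp_all
  next
    assume "\<exists>a. (X, f) = ob a \<and> cj a"
    then show "X \<in> Obj C \<and> isom C (io X) X f \<and> f \<cdot>\<^bsub>C\<^esub> fmor (cnj K) (io X) X f = lam K X"
      by (elim exE conjE) (simp add: to_arrow)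
  qed
  finally show ?thesis unfolding Pair .
qed

lemma Obj_doubleE:
  assumes "P \<in> Obj C'"
  obtains a where "P = ob a" "cj a"
  using assms Obj_double by blast

lemma ob_in [simp]: "\<lbrakk>cj a; tgt a = X\<rbrakk> \<Longrightarrow> (X, mor a) \<in> Obj C'"
  using Obj_double by blast

lemma Hom_double [simp]:
  assumes "ok C p" "src p = X" "tgt p = Y" "cj a" "tgt a = X" "cj b" "tgt b = Y"
  shows "mor p \<in> Hom C' (X, mor a) (Y, mor b) \<longleftrightarrow> p \<cdot> a = b \<cdot> I p"
  using assms by (auto simp: double_def double_cat_def Let_def to_arrow)

lemma Hom_doubleE:
  assumes "m \<in> Hom C' (ob a) (ob b)" "cj a" "cj b"
  obtains p where "m = mor p" "ok C p" "src p = tgt a" "tgt p = tgt b" "p \<cdot> a = b \<cdot> I p"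
proof -
  have "m \<in> Hom C (tgt a) (tgt b)"
    using assms by (simp add: double_def double_cat_def Let_def)
  then obtain p where "m = mor p" "ok C p" "src p = tgt a" "tgt p = tgt b"
    by (rule arr_cases) (use assms in simp_all)
  then show ?thesis
    using that assms Hom_double[of p "tgt a" "tgt b" a b] by blast
qed

lemmas double_elims = Obj_doubleE Hom_doubleE

lemma linear_double: "linear_category C'"
proof (unfold_locales, goal_cases)
  case 2 then show ?case
    by (auto elim!: double_elims simp: double_simps to_arrow) (metis acmp_assoc)
next
  case 10 then show ?case
    by (auto elim!: double_elims simp: double_simps to_arrow) (simp add: aadd_commute)
next
  case (12 P Q m)
  then obtain a b p where e: "P = ob a" "cj a" "Q = ob b" "cj b" "m = mor p"
    and p: "ok C p" "src p = tgt a" "tgt p = tgt b" "p \<cdot> a = b \<cdot> I p"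
    by (auto elim!: double_elims)
  show ?case
    by (rule bexI[of _ "mor ((- 1) \<odot> p)"]) (use e p in \<open>simp_all add: double_simps to_arrow\<close>)
qed (auto elim!: double_elims simp: double_simps to_arrow ascl_add)

lemma
  assumes "cj a" "cj b" "aiso C p" "src p = tgt a" "tgt p = tgt b" "p \<cdot> a = b \<cdot> I p"
  shows isom_double: "isom C' (ob a) (ob b) (mor p)"
    and Inv_double: "Inv C' (ob a) (ob b) (mor p) = mor (iv p)"
proof -
  note p = assms ok_aiso[OF assms(3)]
  have sq: "iv p \<cdot> b = a \<cdot> I (iv p)"
    using square_inv[OF assms(6)] p by simp
  show "isom C' (ob a) (ob b) (mor p)"
    unfolding isom_def using p sq
    by (intro conjI bexI[of _ "mor (iv p)"]) (simp_all add: double_simps to_arrow)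
  show "Inv C' (ob a) (ob b) (mor p) = mor (iv p)"
    unfolding Inv_def
  proof (rule the_equality)
    show "mor (iv p) \<in> Hom C' (ob b) (ob a) \<and> mor (iv p) \<cdot>\<^bsub>C'\<^esub> mor p = Idn C' (ob a)
        \<and> mor p \<cdot>\<^bsub>C'\<^esub> mor (iv p) = Idn C' (ob b)"
      using p sq by (simp add: double_simps to_arrow)
    fix g
    assume g: "g \<in> Hom C' (ob b) (ob a) \<and> g \<cdot>\<^bsub>C'\<^esub> mor p = Idn C' (ob a) \<and> mor p \<cdot>\<^bsub>C'\<^esub> g = Idn C' (ob b)"
    then obtain c where c: "g = mor c" "ok C c" "src c = tgt b" "tgt c = tgt a"
      using p(1,2) by (auto elim: Hom_doubleE)
    then have "iv p = c"
      using g p by (intro ainv_eqI) (simp_all add: double_simps to_arrow)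
    then show "g = mor (iv p)" using c by simp
  qed
qed

definition "icj a = (- 1) \<odot> I a"
definition "dcj a = (- 1) \<odot> (D (iv a) \<cdot> al (tgt a))"

lemma icj_dcj_tgt [simp]: "tgt (icj a) = io (tgt a)" "tgt (dcj a) = dob (tgt a)"
  by (simp_all add: icj_def dcj_def)

lemma cj_icj [simp]: "cj a \<Longrightarrow> cj (icj a)"
  by (rule cjI) (simp_all add: icj_def flip: I.acov_acmp)

text \<open>
  The signs cancel, and after moving \<open>\<alpha>\<close> past \<open>D (iv a)\<close> the second axiom of the commutation remains.
\<close>

lemma cj_dcj [simp]:
  assumes a: "cj a"
  shows "cj (dcj a)"
proof (rule cjI)
  let ?X = "tgt a"
  have "D (iv a) \<cdot> al ?X \<cdot> I (D (iv a)) \<cdot> I (al ?X) = D (iv a) \<cdot> D (I (iv a)) \<cdot> (al (io ?X) \<cdot> I (al ?X))"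
    using a by (simp add: al_nat)
  also have "\<dots> = D (lm ?X \<cdot> I (iv a) \<cdot> iv a) \<cdot> lm (dob ?X)"
    unfolding al_lm[OF cjD(5)[OF a]] using a by simp
  also have "lm ?X \<cdot> I (iv a) \<cdot> iv a = ide ?X"
    using a by (simp add: cancel flip: cj_reassoc)
  finally show "dcj a \<cdot> I (dcj a) = lm (tgt (dcj a))"
    using a by (simp add: dcj_def)
qed (use a in \<open>simp_all add: dcj_def\<close>)

lemma fob_double [simp]:
  assumes "cj a" "tgt a = X"
  shows "fob (cnj (double K)) (X, mor a) = (io X, mor (icj a))" "fob (dua (double K)) (X, mor a) = (dob X, mor (dcj a))"
  using assms by (auto simp add: double_def Let_def to_arrow icj_def dcj_def)

lemma additive_double: "additive_category C'"
proof -
  interpret C': linear_category C' by (rule linear_double)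
  show ?thesis
  proof unfold_locales
    obtain Z where Z: "Z \<in> Obj C" "ide Z = zer Z Z"
      using zero_object by (auto simp: to_arrow)
    have zero: "a = b" if "ok C a" "ok C b" "src a = src b" "tgt a = Z" "tgt b = Z" for a b
    proof -
      have "ide Z \<cdot> a = ide Z \<cdot> b"
        unfolding Z(2) using that Z(1) by simp
      then show ?thesis using that by simp
    qed
    have iz: "ide (io Z) = zer (io Z) (io Z)"
      using arg_cong[OF Z(2), of I] Z(1) by simp
    \<comment> \<open>As \<open>ide Z = zer Z Z\<close>, all arrows into \<open>Z\<close> agree, so the only candidate for the structure map is zero.\<close>
    let ?z = "zer (io Z) Z"
    have "cj ?z"
    proof (rule cjI)
      show "aiso C ?z"
        using Z iz by (intro aisoI[of _ "zer Z (io Z)"]) simp_all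
    qed (use Z in \<open>simp_all add: zero\<close>)
    then show "\<exists>Z\<in>Obj C'. Idn C' Z = Zer C' Z Z"
      using Z by (intro bexI[of _ "ob ?z"]) (simp_all add: double_simps to_arrow)
  next
    fix P Q assume "P \<in> Obj C'" "Q \<in> Obj C'"
    then obtain f g where f: "P = ob f" "cj f" and g: "Q = ob g" "cj g"
      by (auto elim!: Obj_doubleE)
    obtain b where b: "biproduct C (tgt f) (tgt g) b"
      using biproducts f g by (metis cjD(5))
    note b' = bip_simps[OF b cjD(5)[OF f(2)] cjD(5)[OF g(2)]]
    note [simp] = b'(1-13)
    note e [simp] = cancel vanish
    let ?i = "bi1 (tgt f) b" and ?j = "bi2 (tgt g) b" and ?p = "bp1 (tgt f) b" and ?q = "bp2 (tgt g) b"
    \<comment> \<open>The structure map of the direct sum is diagonal; this makes the inclusions and projections morphisms of \<open>\<C>'\<close>.\<close>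
    define h where "h = ?i \<cdot> f \<cdot> I ?p \<oplus> ?j \<cdot> g \<cdot> I ?q"
    have [simp]: "tgt h = bsum b" by (simp add: h_def)
    let ?S = "bsum b"
    have sum: "?i \<cdot> (?p \<cdot> c) \<oplus> ?j \<cdot> (?q \<cdot> c) = c" if "ok C c" "tgt c = ?S" for c
      using arg_cong[OF b'(14), of "\<lambda>x. x \<cdot> c"] that by simp
    have Isum: "I ?i \<cdot> I ?p \<oplus> I ?j \<cdot> I ?q = ide (io ?S)"
      using arg_cong[OF b'(14), of I] by simp
    have "cj h"
    proof (rule cjI)
      show "aiso C h"
        using f(2) g(2) Isum
        by (intro aisoI[of h "I ?i \<cdot> iv f \<cdot> ?p \<oplus> I ?j \<cdot> iv g \<cdot> ?q"]) (simp_all add: h_def b'(14))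
      show "h \<cdot> I h = lm (tgt h)"
        using f(2) g(2) by (simp add: h_def cj_reassoc lm_nat sum)
    qed (use f g in \<open>simp add: h_def\<close>)
    moreover from this have "?i \<cdot> f = h \<cdot> I ?i" "?j \<cdot> g = h \<cdot> I ?j" "?p \<cdot> h = f \<cdot> I ?p" "?q \<cdot> h = g \<cdot> I ?q"
      using f(2) g(2) by (simp_all add: h_def)
    ultimately have "biproduct C' P Q \<lparr>bsum = ob h, in1 = mor ?i, in2 = mor ?j, pr1 = mor ?p, pr2 = mor ?q\<rparr>"
      unfolding biproduct_def f g by (simp add: f g double_simps to_arrow b'(14))
    then show "\<exists>b. biproduct C' P Q b" ..
  qed
qed

lemma pseudo_abelian_double: "pseudo_abelian_category C'"
proof -
  interpret C': additive_category C' by (rule additive_double)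
  show ?thesis
  proof unfold_locales
    fix P e assume "P \<in> Obj C'" "e \<in> Hom C' P P" "e \<cdot>\<^bsub>C'\<^esub> e = e"
    then obtain a p where a: "P = ob a" "cj a" and p: "e = mor p" "ok C p" "src p = tgt a" "tgt p = tgt a"
      "p \<cdot> a = a \<cdot> I p" "p \<cdot> p = p"
      by (auto elim!: Obj_doubleE Hom_doubleE simp: double_simps to_arrow)
    then obtain Y t s where Y: "Y \<in> Obj C" and t: "t \<in> Hom C Y (tgt a)" and s: "s \<in> Hom C (tgt a) Y"
      and st: "s \<cdot>\<^bsub>C\<^esub> t = Idn C Y" "t \<cdot>\<^bsub>C\<^esub> s = e"
      using idempotents_split[of "tgt a" e] by (auto simp: to_arrow)
    have X: "tgt a \<in> Obj C" using a(2) by simp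
    obtain u where u: "t = mor u" "ok C u" "src u = Y" "tgt u = tgt a"
      using t Y X by (rule arr_cases)
    obtain v where v: "s = mor v" "ok C v" "src v = tgt a" "tgt v = Y"
      using s X Y by (rule arr_cases)
    have vu: "v \<cdot> u = ide Y" and uv: "u \<cdot> v = p"
      using st u v p Y by (simp_all add: to_arrow)
    have Ivu: "I v \<cdot> I u = ide (io Y)" and Iuv: "I u \<cdot> I v = I p"
      using arg_cong[OF vu, of I] arg_cong[OF uv, of I] u v Y by simp_all
    have vp: "v \<cdot> p = v" and pu: "p \<cdot> u = u"
      using u v vu by (simp_all flip: uv) (metis acmp_assoc aid_left)
    have ap: "a \<cdot> I p = p \<cdot> a" and iap: "iv a \<cdot> p = I p \<cdot> iv a"
      using p a square_inv[OF p(5)[symmetric]] by simp_all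
    have Ipu: "I p \<cdot> I u = I u"
      using arg_cong[OF pu, of I] p u by simp
    have pau: "p \<cdot> a \<cdot> I u = a \<cdot> I u"
      by (metis acmp_assoc p(5) Ipu)
    note [simp] = pau vu Ivu acmp_reassoc[OF vu] acmp_reassoc[OF Ivu]
      uv Iuv acmp_reassoc[OF uv] acmp_reassoc[OF Iuv]
      vp acmp_reassoc[OF vp] pu acmp_reassoc[OF pu] Ipu acmp_reassoc[OF Ipu]
      ap square_reassoc[OF ap] iap square_reassoc[OF iap]
    \<comment> \<open>The idempotent commutes with the structure map \<open>a\<close>, which therefore restricts to the summand.\<close>
    define h where "h = v \<cdot> a \<cdot> I u"
    have [simp]: "tgt h = Y" using v by (simp add: h_def)
    have "cj h"
    proof (rule cjI)
      show "aiso C h"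
        using a u v p Y
        by (intro aisoI[of h "I v \<cdot> iv a \<cdot> u"]) (simp_all add: h_def)
      show "h \<cdot> I h = lm (tgt h)"
        using a(2) u v Y by (simp add: h_def cj_reassoc lm_nat)
    qed (use u v in \<open>simp add: h_def\<close>)
    moreover have "u \<cdot> h = a \<cdot> I u" "v \<cdot> a = h \<cdot> I v"
      using a(2) u v Y by (simp_all add: h_def)
    ultimately show "\<exists>Q\<in>Obj C'. \<exists>t\<in>Hom C' Q P. \<exists>s\<in>Hom C' P Q. s \<cdot>\<^bsub>C'\<^esub> t = Idn C' Q \<and> t \<cdot>\<^bsub>C'\<^esub> s = e"
      using a u v Y p(1)
      by (intro bexI[of _ "ob h"] bexI[of _ "mor u"] bexI[of _ "mor v"]) (simp_all add: double_simps to_arrow)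
  qed
qed

lemma double_isoI:
  assumes "cj a" "cj b" "aiso C p" "src p = X" "tgt p = Y" "p \<cdot> a = b \<cdot> I p" "tgt a = X" "tgt b = Y"
  shows "isom C' (X, mor a) (Y, mor b) (mor p)" "Inv C' (X, mor a) (Y, mor b) (mor p) = mor (iv p)"
  using isom_double[of a b p] Inv_double[of a b p] assms by auto

lemma conjugation_double: "conjugation C' (cnj (double K)) (lam (double K))"
  unfolding conjugation_def
proof (intro conjI)
  show "covariant_functor C' C' (cnj (double K))"
    unfolding covariant_functor_def
    by (auto elim!: double_elims simp: double_simps to_arrow)
      (simp add: icj_def flip: I.acov_acmp)
  show "nat_iso_cov C' C' (comp_cov (cnj (double K)) (cnj (double K))) idf (lam (double K))"
    unfolding nat_iso_cov_def
    by (auto elim!: double_elims simp: fmor_simps double_simps to_arrow lm_nat intro!: double_isoI)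
      (simp add: icj_def lm_nat)
  show "\<forall>P\<in>Obj C'. lam (double K) (fob (cnj (double K)) P)
     = fmor (cnj (double K)) (fob (cnj (double K)) (fob (cnj (double K)) P)) P (lam (double K) P)"
    by (auto elim!: double_elims simp: double_simps to_arrow)
qed

text \<open>
  The squares that make \<open>D p\<close>, \<open>\<delta>\<close>, \<open>\<alpha>\<close> and \<open>\<lambda>\<close> morphisms of \<open>\<C>'\<close>.
\<close>

lemma D_double_square:
  assumes "cj a" "cj b" "ok C p" "src p = tgt a" "tgt p = tgt b" "p \<cdot> a = b \<cdot> I p"
  shows "D p \<cdot> dcj b = dcj a \<cdot> I (D p)"
proof -
  have "iv b \<cdot> p = I p \<cdot> iv a"
    using square_inv[OF assms(6)[symmetric]] assms by simp
  from D_square[OF this] show ?thesis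
    using assms by (simp add: dcj_def al_nat)
qed

lemma dl_double_square:
  assumes "cj a"
  shows "dl (tgt a) \<cdot> a = dcj (dcj a) \<cdot> I (dl (tgt a))"
    and "D (D a) \<cdot> dl (io (tgt a)) = dcj (dcj a) \<cdot> I (dl (tgt a))"
  using assms by (simp_all add: dcj_def dl_nat al_dl cancel)

lemma al_double_square:
  assumes "cj a"
  shows "al (tgt a) \<cdot> icj (dcj a) = dcj (icj a) \<cdot> I (al (tgt a))"
  using assms by (simp add: dcj_def icj_def al_nat)

lemma lm_double_square:
  assumes "cj a"
  shows "lm (tgt a) \<cdot> icj (icj a) = a \<cdot> I (lm (tgt a))"
  using assms by (simp add: icj_def lm_nat)

lemma duality_double: "duality C' (dua (double K)) (del (double K))"
  unfolding duality_def
proof (intro conjI)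
  show "contravariant_functor C' C' (dua (double K))"
    unfolding contravariant_functor_def
    by (auto elim!: double_elims simp: double_simps to_arrow D_double_square)
  show "nat_iso_cov C' C' idf (comp_con (dua (double K)) (dua (double K))) (del (double K))"
    unfolding nat_iso_cov_def
    by (auto elim!: double_elims simp: fmor_simps double_simps to_arrow dl_nat dl_double_square intro!: double_isoI)
  show "\<forall>P\<in>Obj C'. del (double K) (fob (dua (double K)) P)
     = Inv C' (fob (dua (double K)) (fob (dua (double K)) (fob (dua (double K)) P))) (fob (dua (double K)) P)
      (fmor (dua (double K)) P (fob (dua (double K)) (fob (dua (double K)) P)) (del (double K) P))"
    by (auto elim!: double_elims simp: double_simps to_arrow double_isoI(2) D_double_square dl_double_square)
qed

lemma commutation_double:
  "commutation C' (cnj (double K)) (lam (double K)) (dua (double K)) (del (double K)) (alp (double K))"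
  unfolding commutation_def
proof (intro conjI ballI)
  show "nat_iso_con C' C' (comp_con (cnj (double K)) (dua (double K))) (comp_cov (dua (double K)) (cnj (double K))) (alp (double K))"
    unfolding nat_iso_con_def
    by (auto elim!: double_elims simp: fmor_simps double_simps to_arrow al_nat al_double_square intro!: double_isoI)
next
  fix P assume "P \<in> Obj C'"
  then obtain a where a: "P = ob a" "cj a" by (rule Obj_doubleE)
  show "alp (double K) (fob (dua (double K)) P) \<cdot>\<^bsub>C'\<^esub>
      fmor (cnj (double K)) P (fob (dua (double K)) (fob (dua (double K)) P)) (del (double K) P) =
      fmor (dua (double K)) (fob (cnj (double K)) (fob (dua (double K)) P))
       (fob (dua (double K)) (fob (cnj (double K)) P)) (alp (double K) P) \<cdot>\<^bsub>C'\<^esub>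
      del (double K) (fob (cnj (double K)) P)"
    using a by (simp add: double_simps to_arrow al_dl)
  have "Inv C' (fob (cnj (double K)) (fob (dua (double K)) (fob (cnj (double K)) P)))
     (fob (dua (double K)) (fob (cnj (double K)) (fob (cnj (double K)) P)))
     (alp (double K) (fob (cnj (double K)) P)) = mor ((- 1) \<odot> iv (al (io (tgt a))))"
    using a al_double_square[of "icj a"] by (simp add: double_simps to_arrow double_isoI(2))
  moreover have "Inv C' (fob (cnj (double K)) (fob (cnj (double K)) (fob (dua (double K)) P))) (fob (dua (double K)) P)
       (lam (double K) (fob (dua (double K)) P)) = mor ((- 1) \<odot> iv (lm (dob (tgt a))))"
    using a lm_double_square[of "dcj a"] by (simp add: double_simps to_arrow double_isoI(2))
  moreover have "iv (al (io (tgt a))) \<cdot> D (lm (tgt a)) = I (al (tgt a)) \<cdot> iv (lm (dob (tgt a)))"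
    using a square_inv[OF al_lm] by simp
  ultimately show "Inv C' (fob (cnj (double K)) (fob (dua (double K)) (fob (cnj (double K)) P)))
     (fob (dua (double K)) (fob (cnj (double K)) (fob (cnj (double K)) P)))
     (alp (double K) (fob (cnj (double K)) P)) \<cdot>\<^bsub>C'\<^esub>
    fmor (dua (double K)) (fob (cnj (double K)) (fob (cnj (double K)) P)) P (lam (double K) P) =
    fmor (cnj (double K)) (fob (cnj (double K)) (fob (dua (double K)) P))
     (fob (dua (double K)) (fob (cnj (double K)) P)) (alp (double K) P) \<cdot>\<^bsub>C'\<^esub>
    Inv C' (fob (cnj (double K)) (fob (cnj (double K)) (fob (dua (double K)) P))) (fob (dua (double K)) P)
     (lam (double K) (fob (dua (double K)) P))"
    using a by (simp add: double_simps to_arrow)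
qed

text \<open>
  The double carries the same kind of structure, so every result of this context also holds for
  \<open>double K\<close> and \<open>double (double K)\<close>.
\<close>

lemma conj_dual_double: "conj_dual (double K)"
  by unfold_locales
    (simp add: conjugation_duality_category_def pseudo_abelian_double conjugation_double
      duality_double commutation_double)

end

section \<open>The functors \<open>F\<close> and \<open>G\<close> between \<open>\<C>\<close> and \<open>\<C>'\<close>\<close>

context conj_dual
begin

lemma dualID_double: "dualID (double K) = (C', comp_con (cnj (double K)) (dua (double K)), conj_dual.dID (double K))"
  by (rule conj_dual.dualID_eq) (rule conj_dual_double)

lemma dID_double:
  assumes "cj a" "tgt a = X"
  shows "conj_dual.dID (double K) (X, mor a) = mor (da X)"
proof -
  interpret K': conj_dual "double K" by (rule conj_dual_double)
  have [simp]: "X \<in> Obj C" using assms by auto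
  have "Inv C' (fob (cnj (double K)) (fob (cnj (double K)) (fob (dua (double K)) (fob (dua (double K)) (X, mor a)))))
      (fob (dua (double K)) (fob (dua (double K)) (X, mor a)))
       (lam (double K) (fob (dua (double K)) (fob (dua (double K)) (X, mor a)))) = mor ((- 1) \<odot> iv (lm (dob (dob X))))"
    using assms lm_double_square[of "dcj (dcj a)"] by (simp add: double_simps to_arrow double_isoI(2))
  then show ?thesis
    using assms by (auto simp: K'.dID_def da_def double_simps to_arrow)
qed

end

locale conj_dual_sums = conj_dual K
  for K :: "('o, 'm, 'k::{comm_ring, comm_monoid_mult}) cdcat" +
  fixes B :: "'o \<Rightarrow> 'o \<Rightarrow> ('o, 'm) bip"
  assumes B: "direct_sums (ucat K) B"
begin

definition "S X = bsum (dsum K B X)"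
definition "j1 X = bi1 X (dsum K B X)"
definition "j2 X = bi2 (io X) (dsum K B X)"
definition "q1 X = bp1 X (dsum K B X)"
definition "q2 X = bp2 (io X) (dsum K B X)"

lemma jq_src_tgt [simp]:
  "src (j1 X) = X" "tgt (j1 X) = S X" "src (j2 X) = io X" "tgt (j2 X) = S X"
  "src (q1 X) = S X" "tgt (q1 X) = X" "src (q2 X) = S X" "tgt (q2 X) = io X"
  by (simp_all add: S_def j1_def j2_def q1_def q2_def)

lemma dsum_biproduct: "X \<in> Obj C \<Longrightarrow> biproduct C X (io X) (dsum K B X)"
  using B by (simp add: direct_sums_def dsum_def)

lemma jq [simp]:
  assumes "X \<in> Obj C"
  shows "S X \<in> Obj C" "ok C (j1 X)" "ok C (j2 X)" "ok C (q1 X)" "ok C (q2 X)"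
    "q1 X \<cdot> j1 X = ide X" "q2 X \<cdot> j2 X = ide (io X)"
    "q1 X \<cdot> j2 X = zer (io X) X" "q2 X \<cdot> j1 X = zer X (io X)"
    "\<lbrakk>ok C c; tgt c = X\<rbrakk> \<Longrightarrow> q1 X \<cdot> (j1 X \<cdot> c) = c"
    "\<lbrakk>ok C c; tgt c = io X\<rbrakk> \<Longrightarrow> q2 X \<cdot> (j2 X \<cdot> c) = c"
    "\<lbrakk>ok C c; tgt c = io X\<rbrakk> \<Longrightarrow> q1 X \<cdot> (j2 X \<cdot> c) = zer (src c) X"
    "\<lbrakk>ok C c; tgt c = X\<rbrakk> \<Longrightarrow> q2 X \<cdot> (j1 X \<cdot> c) = zer (src c) (io X)"
  using bip_simps[OF dsum_biproduct[OF assms] assms I.fob_in[OF assms]]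
  by (simp_all add: S_def j1_def j2_def q1_def q2_def)

lemma jq_sum:
  assumes "X \<in> Obj C"
  shows "j1 X \<cdot> q1 X \<oplus> j2 X \<cdot> q2 X = ide (S X)"
    "\<lbrakk>ok C c; tgt c = S X\<rbrakk> \<Longrightarrow> j1 X \<cdot> (q1 X \<cdot> c) \<oplus> j2 X \<cdot> (q2 X \<cdot> c) = c"
    "j2 X \<cdot> q2 X \<oplus> j1 X \<cdot> q1 X = ide (S X)"
    "\<lbrakk>ok C c; tgt c = S X\<rbrakk> \<Longrightarrow> j2 X \<cdot> (q2 X \<cdot> c) \<oplus> j1 X \<cdot> (q1 X \<cdot> c) = c"
proof -
  show *: "j1 X \<cdot> q1 X \<oplus> j2 X \<cdot> q2 X = ide (S X)"
    using bip_simps(14)[OF dsum_biproduct[OF assms] assms I.fob_in[OF assms]]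
    by (simp add: S_def j1_def j2_def q1_def q2_def)
  show "\<lbrakk>ok C c; tgt c = S X\<rbrakk> \<Longrightarrow> j1 X \<cdot> (q1 X \<cdot> c) \<oplus> j2 X \<cdot> (q2 X \<cdot> c) = c"
    using arg_cong[OF *, of "\<lambda>x. x \<cdot> c"] by simp
  show **: "j2 X \<cdot> q2 X \<oplus> j1 X \<cdot> q1 X = ide (S X)"
    using * by (subst aadd_commute) simp_all
  show "\<lbrakk>ok C c; tgt c = S X\<rbrakk> \<Longrightarrow> j2 X \<cdot> (q2 X \<cdot> c) \<oplus> j1 X \<cdot> (q1 X \<cdot> c) = c"
    using arg_cong[OF **, of "\<lambda>x. x \<cdot> c"] by simp
qed

lemma S_ext:
  assumes "X \<in> Obj C" "ok C u" "ok C v" "src u = S X" "src v = S X" "tgt u = tgt v"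
    "u \<cdot> j1 X = v \<cdot> j1 X" "u \<cdot> j2 X = v \<cdot> j2 X"
  shows "u = v"
  using bip_ext[OF dsum_biproduct assms(1) I.fob_in assms(2,3)] assms by (simp add: S_def j1_def j2_def)

text \<open>
  The matrices \<open>\<Lambda>\<close> and \<open>\<Delta>\<close> are \<open>La 1\<close> and \<open>La (- 1)\<close>, \<open>Li\<close> is the inverse matrix, and \<open>dg\<close> is the action
  of \<open>F\<close> and of \<open>\<Psi>\<close> on arrows.
\<close>

definition "La r X = r \<odot> (j1 X \<cdot> lm X \<cdot> I (q2 X)) \<oplus> j2 X \<cdot> I (q1 X)"
definition "Li r X = I (j1 X) \<cdot> q2 X \<oplus> r \<odot> (I (j2 X) \<cdot> iv (lm X) \<cdot> q1 X)"
definition "dg a = j1 (tgt a) \<cdot> a \<cdot> q1 (src a) \<oplus> j2 (tgt a) \<cdot> I a \<cdot> q2 (src a)"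

lemma La_src_tgt [simp]: "src (La r X) = io (S X)" "tgt (La r X) = S X" "src (Li r X) = S X" "tgt (Li r X) = io (S X)"
    "src (dg a) = S (src a)" "tgt (dg a) = S (tgt a)"
  by (simp_all add: La_def Li_def dg_def)

lemma ok_La [simp]: "X \<in> Obj C \<Longrightarrow> ok C (La r X)" "X \<in> Obj C \<Longrightarrow> ok C (Li r X)" "ok C a \<Longrightarrow> ok C (dg a)"
  by (simp_all add: La_def Li_def dg_def)

lemma bip_cov_dsum:
  assumes "X \<in> Obj C"
  shows "biproduct C (io X) (io (io X)) (bip_cov (cnj K) X (io X) (dsum K B X))"
    "bi1 (io X) (bip_cov (cnj K) X (io X) (dsum K B X)) = I (j1 X)"
    "bi2 (io (io X)) (bip_cov (cnj K) X (io X) (dsum K B X)) = I (j2 X)"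
    "bp1 (io X) (bip_cov (cnj K) X (io X) (dsum K B X)) = I (q1 X)"
    "bp2 (io (io X)) (bip_cov (cnj K) X (io X) (dsum K B X)) = I (q2 X)"
  using I.biproduct_bip_cov[OF dsum_biproduct[OF assms] assms I.fob_in[OF assms]]
  by (simp_all add: j1_def j2_def q1_def q2_def)

lemma D_sum:
  assumes "X \<in> Obj C"
  shows "biproduct C (dob X) (dob (io X)) (D_sum K B X)"
    "bi1 (dob X) (D_sum K B X) = D (q1 X)"
    "bi2 (dob (io X)) (D_sum K B X) = D (q2 X)"
    "bp1 (dob X) (D_sum K B X) = D (j1 X)"
    "bp2 (dob (io X)) (D_sum K B X) = D (j2 X)"
  using D.biproduct_bip_con[OF dsum_biproduct[OF assms] assms I.fob_in[OF assms]]
  by (simp_all add: D_sum_def j1_def j2_def q1_def q2_def)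

lemma ID_sum:
  assumes "X \<in> Obj C"
  shows "biproduct C (io (dob X)) (io (dob (io X))) (ID_sum K B X)"
    "bi1 (io (dob X)) (ID_sum K B X) = I (D (q1 X))"
    "bi2 (io (dob (io X))) (ID_sum K B X) = I (D (q2 X))"
    "bp1 (io (dob X)) (ID_sum K B X) = I (D (j1 X))"
    "bp2 (io (dob (io X))) (ID_sum K B X) = I (D (j2 X))"
proof -
  interpret ID: con_functor C C ID
    by (rule comp_con_functor) unfold_locales
  show "biproduct C (io (dob X)) (io (dob (io X))) (ID_sum K B X)"
    "bi1 (io (dob X)) (ID_sum K B X) = I (D (q1 X))"
    "bi2 (io (dob (io X))) (ID_sum K B X) = I (D (q2 X))"
    "bp1 (io (dob X)) (ID_sum K B X) = I (D (j1 X))"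
    "bp2 (io (dob (io X))) (ID_sum K B X) = I (D (j2 X))"
    using ID.biproduct_bip_con[OF dsum_biproduct[OF assms] assms I.fob_in[OF assms]]
    by (simp_all add: ID_sum_def j1_def j2_def q1_def q2_def)
qed

lemma mat_dsum:
  assumes X: "X \<in> Obj C"
  shows "Lambda_mat K B X = mor (La 1 X)" "Delta_mat K B X = mor (La (- 1) X)"
  using X mat_arr[OF bip_cov_dsum(1)[OF X] _ _ dsum_biproduct[OF X] X]
  by (simp_all add: Lambda_mat_def Delta_mat_def Let_def to_arrow amat_def bip_cov_dsum La_def flip: j1_def j2_def)

lemma diag_mor:
  assumes "ok C a" "src a = X" "tgt a = Y"
  shows "diag_mor K B X Y (mor a) = mor (dg a)"
  using assms mat_arr[OF dsum_biproduct _ _ dsum_biproduct, of X Y] ok_src[OF assms(1)] ok_tgt[OF assms(1)]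
  by (simp add: diag_mor_def Let_def to_arrow amat_def dg_def flip: j1_def j2_def q1_def q2_def)

lemma Li_La:
  assumes "X \<in> Obj C" "r * r = 1"
  shows "Li r X \<cdot> La r X = ide (io (S X))" "La r X \<cdot> Li r X = ide (S X)"
proof -
  have I: "I (j1 X) \<cdot> I (q1 X) \<oplus> I (j2 X) \<cdot> I (q2 X) = ide (io (S X))"
    using arg_cong[OF jq_sum(1)[OF assms(1)], of I] assms(1) by simp
  then have I': "I (j2 X) \<cdot> I (q2 X) \<oplus> I (j1 X) \<cdot> I (q1 X) = ide (io (S X))"
    by (subst aadd_commute) simp_all
  show "Li r X \<cdot> La r X = ide (io (S X))"
    using assms by (simp add: I' La_def Li_def)
  show "La r X \<cdot> Li r X = ide (S X)"
    using assms by (simp add: La_def Li_def cancel vanish jq_sum)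
qed

lemma aiso_La [simp]:
  assumes "X \<in> Obj C" "r * r = 1"
  shows "aiso C (La r X)" "iv (La r X) = Li r X"
  using Li_La[OF assms] assms(1) aisoI[of "La r X" "Li r X"] ainv_eqI[of "La r X" "Li r X"] by simp_all

lemma La_La:
  assumes "X \<in> Obj C"
  shows "La r X \<cdot> I (La q X) = q \<odot> (j2 X \<cdot> q2 X \<cdot> lm (S X)) \<oplus> r \<odot> (j1 X \<cdot> q1 X \<cdot> lm (S X))"
  using assms by (simp add: La_def cancel vanish lm_nat lm_nat_io)

lemma dg_La:
  assumes "ok C a" "src a = X"
  shows "dg a \<cdot> La r X = La r (tgt a) \<cdot> I (dg a)"
proof -
  have "X \<in> Obj C" using assms by auto
  then show ?thesis
    using assms by (simp add: La_def dg_def cancel vanish nats) (simp add: aadd_commute)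
qed

lemma cj_La [simp]: "X \<in> Obj C \<Longrightarrow> cj (La 1 X)"
  by (rule cjI) (simp_all add: La_La jq_sum)

lemma dg_simps [simp]:
  "X \<in> Obj C \<Longrightarrow> dg (ide X) = ide (S X)"
  "\<lbrakk>ok C b; ok C a; src b = tgt a\<rbrakk> \<Longrightarrow> dg (b \<cdot> a) = dg b \<cdot> dg a"
  "ok C a \<Longrightarrow> dg (r \<odot> a) = r \<odot> dg a"
  by (simp_all add: dg_def jq_sum)

lemma dg_aadd: "\<lbrakk>ok C a; ok C b; src b = src a; tgt b = tgt a\<rbrakk> \<Longrightarrow> dg (a \<oplus> b) = dg a \<oplus> dg b"
  by (simp add: dg_def aadd_ac)

lemma F_simps:
  "X \<in> Obj C \<Longrightarrow> fob (F_fun K B) X = (S X, mor (La 1 X))"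
  "\<lbrakk>ok C a; src a = X; tgt a = Y\<rbrakk> \<Longrightarrow> fmor (F_fun K B) X Y (mor a) = mor (dg a)"
  by (simp_all add: F_fun_def mat_dsum S_def diag_mor)

lemma F_functor: "covariant_functor C C' (F_fun K B)"
  unfolding covariant_functor_def
  by (auto elim!: arr_cases simp: F_simps to_arrow double_simps dg_La dg_aadd)

text \<open>
  The components of \<open>F_hat\<close> and \<open>F_check\<close> as typed arrows. The lemmas \<open>ph_La\<close>, \<open>ph_nat\<close>, \<open>ph_dl\<close> and their
  counterparts for \<open>pc\<close> say that they are morphisms of \<open>\<C>'\<close>, natural, and coherent; coherence is checked
  on the two summands.
\<close>

definition "ph X = D (q1 X) \<cdot> q1 (dob X) \<oplus> (- 1) \<odot> (D (q2 X) \<cdot> al X \<cdot> q2 (dob X))"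
definition "pc X = I (D (q1 X)) \<cdot> q1 (io (dob X)) \<oplus> I (D (q2 X)) \<cdot> I (al X) \<cdot> q2 (io (dob X))"

lemma ph_src_tgt [simp]: "src (ph X) = S (dob X)" "tgt (ph X) = dob (S X)"
    "src (pc X) = S (io (dob X))" "tgt (pc X) = io (dob (S X))"
  by (simp_all add: ph_def pc_def)

lemma ok_ph [simp]: "X \<in> Obj C \<Longrightarrow> ok C (ph X)" "X \<in> Obj C \<Longrightarrow> ok C (pc X)"
  by (simp_all add: ph_def pc_def)

lemma mor_ph: "X \<in> Obj C \<Longrightarrow> snd (F_hat K B) X = mor (ph X)"
  and mor_pc: "X \<in> Obj C \<Longrightarrow> snd (F_check K B) X = mor (pc X)"
  using mat_arr[OF dsum_biproduct _ _ D_sum(1), of "dob X" X] mat_arr[OF dsum_biproduct _ _ ID_sum(1), of "io (dob X)" X]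
  by (simp_all add: F_hat_def F_check_def Let_def to_arrow amat_def D_sum ID_sum ph_def pc_def flip: j1_def j2_def q1_def q2_def)

lemma aiso_ph [simp]:
  assumes "X \<in> Obj C"
  shows "aiso C (ph X)" "aiso C (pc X)"
proof -
  let ?p = "j1 (dob X) \<cdot> D (j1 X) \<oplus> (- 1) \<odot> (j2 (dob X) \<cdot> iv (al X) \<cdot> D (j2 X))"
  let ?c = "j1 (io (dob X)) \<cdot> I (D (j1 X)) \<oplus> j2 (io (dob X)) \<cdot> I (iv (al X)) \<cdot> I (D (j2 X))"
  have D: "D (q1 X) \<cdot> D (j1 X) \<oplus> D (q2 X) \<cdot> D (j2 X) = ide (dob (S X))"
    using arg_cong[OF jq_sum(1)[OF assms], of D] assms by simp
  have ID: "I (D (q1 X)) \<cdot> I (D (j1 X)) \<oplus> I (D (q2 X)) \<cdot> I (D (j2 X)) = ide (io (dob (S X)))"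
    using arg_cong[OF D, of I] assms by simp
  show "aiso C (ph X)"
    using assms by (intro aisoI[of _ ?p]) (simp_all add: ph_def cancel vanish jq_sum D)
  show "aiso C (pc X)"
    using assms by (intro aisoI[of _ ?c]) (simp_all add: pc_def cancel vanish jq_sum ID)
qed

lemma ph_La: "X \<in> Obj C \<Longrightarrow> ph X \<cdot> La 1 (dob X) = dcj (La 1 X) \<cdot> I (ph X)"
  by (simp add: ph_def La_def[of _ "dob X"] Li_def dcj_def nats cancel vanish D_inv_lm_al aadd_commute)

lemma pc_La: "X \<in> Obj C \<Longrightarrow> pc X \<cdot> La 1 (io (dob X)) = icj (dcj (La 1 X)) \<cdot> I (pc X)"
  by (simp add: pc_def La_def[of _ "io (dob X)"] Li_def dcj_def icj_def nats cancel vanish D_inv_lm_al aadd_commute)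

lemma ph_nat:
  assumes "ok C a" "src a = X"
  shows "ph X \<cdot> dg (D a) = D (dg a) \<cdot> ph (tgt a)" "pc X \<cdot> dg (I (D a)) = I (D (dg a)) \<cdot> pc (tgt a)"
proof -
  have "X \<in> Obj C" using assms by auto
  then show "ph X \<cdot> dg (D a) = D (dg a) \<cdot> ph (tgt a)" "pc X \<cdot> dg (I (D a)) = I (D (dg a)) \<cdot> pc (tgt a)"
    using assms by (simp_all add: ph_def pc_def dg_def nats cancel vanish)
qed

lemma ph_dl:
  assumes "X \<in> Obj C"
  shows "ph (dob X) \<cdot> dg (dl X) = D (ph X) \<cdot> dl (S X)"
  using assms by - (rule S_ext[OF assms], simp_all add: ph_def dg_def dl_nat cancel vanish al_dl)

text \<open>
  The second summand of the coherence of \<open>pc\<close>: naturality of \<open>\<lambda>\<close> and \<open>\<alpha>\<close> moves \<open>\<alpha>\<close> to the front, where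
  the first axiom of the commutation applies.
\<close>

lemma da_io:
  assumes X: "X \<in> Obj C"
  shows "I (al (io (dob X))) \<cdot> I (da X) = I (D (I (al X))) \<cdot> da (io X)"
proof -
  let ?i = "io (dob X)"
  have "I (D (I (al X))) \<cdot> da (io X)
      = I (al ?i) \<cdot> (iv (lm (dob ?i)) \<cdot> D (al X)) \<cdot> dl (io X)"
    using X inv_lm_nat(1)[of "D (al X)" "dob ?i"] I_al_nat(2)[of "al X" ?i] by (simp add: da_def)
  also have "\<dots> = I (al ?i) \<cdot> iv (lm (dob ?i)) \<cdot> al (dob X) \<cdot> I (dl X)"
    using X al_dl[OF X] by simp
  also have "\<dots> = I (al ?i) \<cdot> I (da X)"
    using X inv_lm_nat(2)[of "al (dob X)" "dob ?i"] by (simp add: da_def)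
  finally show ?thesis ..
qed

lemma pc_da:
  assumes "X \<in> Obj C"
  shows "pc (io (dob X)) \<cdot> dg (da X) = I (D (pc X)) \<cdot> da (S X)"
  using assms by - (rule S_ext[OF assms], simp_all add: pc_def dg_def da_nat cancel vanish da_io)

lemma F_hat: "dmorphism (dualD K) (dualD (double K)) (F_hat K B)"
proof -
  interpret K': conj_dual "double K" by (rule conj_dual_double)
  obtain \<phi> where F: "F_hat K B = (F_fun K B, \<phi>)" and \<phi>: "\<And>X. X \<in> Obj C \<Longrightarrow> \<phi> X = mor (ph X)"
    using mor_ph by (cases "F_hat K B") (simp add: F_hat_def Let_def)
  show ?thesis
    using category_with_duality_D K'.category_with_duality_D F_functor
    unfolding dualD_def F dmorphism.simps nat_iso_con_def
    by (auto elim!: arr_cases intro!: double_isoI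
        simp: fmor_simps to_arrow double_simps \<phi> F_simps ph_La ph_nat ph_dl)
qed

lemma F_check: "dmorphism (dualID K) (dualID (double K)) (F_check K B)"
proof -
  interpret K': conj_dual "double K" by (rule conj_dual_double)
  obtain \<phi> where F: "F_check K B = (F_fun K B, \<phi>)" and \<phi>: "\<And>X. X \<in> Obj C \<Longrightarrow> \<phi> X = mor (pc X)"
    using mor_pc by (cases "F_check K B") (simp add: F_check_def Let_def)
  show ?thesis
    using category_with_duality_ID K'.category_with_duality_ID F_functor
    unfolding dualID_double dualID_eq F dmorphism.simps nat_iso_con_def
    by (auto elim!: arr_cases intro!: double_isoI
        simp: fmor_simps to_arrow double_simps \<phi> F_simps pc_La ph_nat pc_da dID dID_double)
qed

end

context conj_dual
begin

lemma G_functor: "covariant_functor C' C G_fun"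
  unfolding covariant_functor_def
  by (auto elim!: double_elims simp: G_fun_def double_simps to_arrow)

text \<open>
  The component of \<open>G_hat\<close> at \<open>ob a\<close>; that of \<open>G_check\<close> is \<open>(- 1) \<odot> dcj a\<close>.
\<close>

definition "gh a = iv (al (tgt a)) \<cdot> D a"

lemma gh_src_tgt [simp]: "cj a \<Longrightarrow> src (gh a) = dob (tgt a)" "tgt (gh a) = io (dob (tgt a))"
  by (simp_all add: gh_def)

lemma aiso_gh [simp]: "cj a \<Longrightarrow> aiso C (gh a)" "cj a \<Longrightarrow> ok C (gh a)"
  by (simp_all add: gh_def)

lemma gh_nat:
  assumes "cj a" "cj b" "ok C p" "src p = tgt a" "tgt p = tgt b" "p \<cdot> a = b \<cdot> I p"
  shows "gh a \<cdot> D p = I (D p) \<cdot> gh b"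
  using D_square[OF assms(6)] assms by (simp add: gh_def inv_al_nat)

text \<open>
  The minus sign comes from the one in \<open>dcj\<close>; it is the reason why \<open>G_hat\<close> is a morphism to the
  duality \<open>\<iota>D\<close> with the opposite sign.
\<close>

lemma gh_dl:
  assumes "cj a"
  shows "gh (dcj a) \<cdot> dl (tgt a) = (- 1) \<odot> (I (D (gh a)) \<cdot> da (tgt a))"
proof -
  let ?X = "tgt a"
  have X: "?X \<in> Obj C" using assms by simp
  have "gh (dcj a) \<cdot> dl ?X = - 1 \<odot> (iv (al (dob ?X)) \<cdot> D (al ?X) \<cdot> (D (D (iv a)) \<cdot> dl ?X))"
    using assms by (simp add: gh_def dcj_def)
  also have "D (D (iv a)) \<cdot> dl ?X = dl (io ?X) \<cdot> iv a"
    using assms by (simp add: dl_nat)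
  also have "iv (al (dob ?X)) \<cdot> D (al ?X) \<cdot> dl (io ?X) \<cdot> iv a = I (dl ?X) \<cdot> iv a"
    using square_reassoc[OF inv_al_D_al[OF X]] assms by simp
  finally have L: "gh (dcj a) \<cdot> dl ?X = - 1 \<odot> (I (dl ?X) \<cdot> iv a)" .
  have D: "D (iv (al ?X)) \<cdot> al (dob ?X) = dl (io ?X) \<cdot> I (iv (dl ?X))"
    using square_inv[OF al_dl[OF X, symmetric]] X by simp
  have "I (D (gh a)) \<cdot> da ?X = I (D (D a)) \<cdot> I (D (iv (al ?X)) \<cdot> al (dob ?X)) \<cdot> (iv (lm (dob (dob ?X))) \<cdot> dl ?X)"
    using assms by (simp add: gh_def da_def)
  also have "iv (lm (dob (dob ?X))) \<cdot> dl ?X = I (I (dl ?X)) \<cdot> iv (lm ?X)"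
    using assms by (simp add: inv_lm_nat)
  also have "I (D (D a)) \<cdot> I (D (iv (al ?X)) \<cdot> al (dob ?X)) \<cdot> I (I (dl ?X)) \<cdot> iv (lm ?X)
      = I (D (D a) \<cdot> dl (io ?X)) \<cdot> iv (lm ?X)"
    unfolding D using assms by (simp add: cancel)
  also have "D (D a) \<cdot> dl (io ?X) = dl ?X \<cdot> a"
    using assms by (simp add: dl_nat)
  finally show ?thesis
    unfolding L using assms by (simp add: iv_cj)
qed

lemmas dcj_nat = D_double_square[symmetric]

lemma dcj_da:
  assumes "cj a"
  shows "dcj (icj (dcj a)) \<cdot> da (tgt a) = D (dcj a) \<cdot> dl (tgt a)"
proof -
  let ?X = "tgt a"
  have X: "?X \<in> Obj C" using assms by simp
  have "dcj a = - 1 \<odot> (lm (dob ?X) \<cdot> I (iv (al ?X)) \<cdot> I (D a))"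
  proof -
    have "dcj a = dcj a \<cdot> (I (dcj a) \<cdot> I (iv (dcj a)))"
      using assms by (simp add: cancel del: aiso_neg)
    also have "\<dots> = lm (dob ?X) \<cdot> I (iv (dcj a))"
      using assms by (simp add: cj_reassoc)
    also have "iv (dcj a) = - 1 \<odot> (iv (al ?X) \<cdot> D a)"
      using assms by (simp add: dcj_def)
    finally show ?thesis
      using assms by simp
  qed
  then have "D (dcj a) = - 1 \<odot> (D (I (D a)) \<cdot> D (I (iv (al ?X))) \<cdot> D (lm (dob ?X)))"
    using assms by simp
  then have "D (dcj a) \<cdot> dl ?X
      = - 1 \<odot> (D (I (D a)) \<cdot> D (I (iv (al ?X))) \<cdot> D (lm (dob ?X)) \<cdot> lm (dob (dob ?X)) \<cdot> iv (lm (dob (dob ?X))) \<cdot> dl ?X)"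
    using assms by simp
  also have "\<dots> = dcj (icj (dcj a)) \<cdot> da ?X"
    using assms al_lm_reassoc[OF D.fob_in[OF X]]
    by (simp add: dcj_def[of "icj (dcj a)"] icj_def) (simp add: dcj_def da_def)
  finally show ?thesis ..
qed

lemma G_hat: "dmorphism (dualD (double K)) (signed (- 1) (dualID K)) (G_hat K)"
proof -
  interpret K': conj_dual "double K" by (rule conj_dual_double)
  obtain \<phi> where G: "G_hat K = (G_fun, \<phi>)" and \<phi>: "\<And>a. cj a \<Longrightarrow> \<phi> (ob a) = mor (gh a)"
    by (auto simp: G_hat_def Let_def to_arrow gh_def)
  have \<phi>': "\<phi> (X, mor a) = mor (gh a)" if "cj a" "tgt a = X" for a X
    using \<phi>[OF that(1)] that(2) by simp
  have "category_with_duality (signed (- 1) (dualID K))"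
    using category_with_duality_ID unfolding dualID_eq by (intro dual_category_signed) simp_all
  then show ?thesis
    using K'.category_with_duality_D G_functor
    unfolding dualD_def G dmorphism.simps nat_iso_con_def dualID_eq signed.simps
    by (auto elim!: double_elims
        simp: fmor_simps to_arrow double_simps \<phi>' G_fun_def gh_nat gh_dl dID)
qed

lemma G_check: "dmorphism (dualID (double K)) (dualD K) (G_check K)"
proof -
  interpret K': conj_dual "double K" by (rule conj_dual_double)
  obtain \<phi> where G: "G_check K = (G_fun, \<phi>)" and \<phi>: "\<And>a. cj a \<Longrightarrow> \<phi> (ob a) = mor ((- 1) \<odot> dcj a)"
    by (auto simp: G_check_def Let_def to_arrow dcj_def)
  have \<phi>': "\<phi> (X, mor a) = mor ((- 1) \<odot> dcj a)" if "cj a" "tgt a = X" for a X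
    using \<phi>[OF that(1)] that(2) by simp
  show ?thesis
    using category_with_duality_D K'.category_with_duality_ID G_functor
    unfolding dualD_def G dmorphism.simps nat_iso_con_def dualID_double
    by (auto elim!: double_elims
        simp: fmor_simps to_arrow double_simps \<phi>' G_fun_def dcj_nat dcj_da dID_double)
qed

end

section \<open>The double of the double\<close>

lemma G_fst [simp]: "fst (G_hat K) = G_fun" "fst (G_check K) = G_fun"
  by (simp_all add: G_hat_def G_check_def Let_def)

lemma fob_double_raw:
  "fob (cnj (double K)) (P, f) = (fob (cnj K) P, \<ominus>\<^bsub>ucat K\<^esub> fmor (cnj K) (fob (cnj K) P) P f)"
  "fob (dua (double K)) (P, f) = (fob (dua K) P,
    \<ominus>\<^bsub>ucat K\<^esub> (Inv (ucat K) (fob (dua K) P) (fob (dua K) (fob (cnj K) P))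
      (fmor (dua K) (fob (cnj K) P) P f) \<cdot>\<^bsub>ucat K\<^esub> alp K P))"
  by (simp_all add: double_def Let_def)

context conj_dual
begin

abbreviation "C'' \<equiv> ucat (double (double K))"

text \<open>
  The pair \<open>(a, b)\<close> represents the object \<open>(X, f, g)\<close> of \<open>\<C>''\<close> with \<open>X = tgt a\<close>. Since \<open>\<iota>'(X, f)\<close> has structure map
  \<open>-\<iota>(f)\<close> and \<open>\<lambda>' = -\<lambda>\<close>, the conditions on \<open>g\<close> carry signs: \<open>g \<iota>(f) = -f \<iota>(g)\<close> and \<open>g \<iota>(g) = -\<lambda>\<close>.
\<close>

definition "cj2 a b \<longleftrightarrow> cj a \<and> aiso C b \<and> src b = io (tgt a) \<and> tgt b = tgt a
  \<and> b \<cdot> I a = (- 1) \<odot> (a \<cdot> I b) \<and> b \<cdot> I b = (- 1) \<odot> lm (tgt a)"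

abbreviation "ob2 a b \<equiv> ((tgt a, mor a), mor b)"

lemma cj2I:
  "\<lbrakk>cj a; aiso C b; src b = io (tgt a); tgt b = tgt a;
    b \<cdot> I a = (- 1) \<odot> (a \<cdot> I b); b \<cdot> I b = (- 1) \<odot> lm (tgt a)\<rbrakk> \<Longrightarrow> cj2 a b"
  by (simp add: cj2_def)

lemma cj2D [simp]:
  assumes "cj2 a b"
  shows "cj a" "aiso C b" "ok C b" "src b = io (tgt a)" "tgt b = tgt a"
    "b \<cdot> I a = (- 1) \<odot> (a \<cdot> I b)" "b \<cdot> I b = (- 1) \<odot> lm (tgt a)"
  using assms by (auto simp: cj2_def intro: ok_aiso)

lemma isom_double_iff:
  assumes "cj a" "cj b" "ok C p" "src p = X" "tgt p = Y" "tgt a = X" "tgt b = Y"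
  shows "isom C' (X, mor a) (Y, mor b) (mor p) \<longleftrightarrow> aiso C p \<and> p \<cdot> a = b \<cdot> I p"
proof
  assume "isom C' (X, mor a) (Y, mor b) (mor p)"
  then have "mor p \<in> Hom C' (ob a) (ob b)"
    and "\<exists>g\<in>Hom C' (ob b) (ob a). g \<cdot>\<^bsub>C\<^esub> mor p = Idn C X \<and> mor p \<cdot>\<^bsub>C\<^esub> g = Idn C Y"
    using assms by (auto simp: isom_def double_simps)
  then obtain g where "p \<cdot> a = b \<cdot> I p" and g: "g \<in> Hom C' (ob b) (ob a)"
    "g \<cdot>\<^bsub>C\<^esub> mor p = Idn C X" "mor p \<cdot>\<^bsub>C\<^esub> g = Idn C Y"
    using assms by auto
  moreover obtain q where "g = mor q" "ok C q" "src q = tgt b" "tgt q = tgt a"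
    using Hom_doubleE[OF g(1) assms(2,1)] by blast
  ultimately show "aiso C p \<and> p \<cdot> a = b \<cdot> I p"
    using assms by (auto intro!: aisoI[of p q] simp: to_arrow)
next
  assume "aiso C p \<and> p \<cdot> a = b \<cdot> I p"
  then show "isom C' (X, mor a) (Y, mor b) (mor p)"
    using assms by (intro double_isoI) auto
qed

lemma Obj_double2: "P \<in> Obj C'' \<longleftrightarrow> (\<exists>a b. P = ob2 a b \<and> cj2 a b)"
proof -
  obtain Q g where P: "P = (Q, g)" by (cases P)
  have "P \<in> Obj C'' \<longleftrightarrow> Q \<in> Obj C' \<and> isom C' (fob (cnj (double K)) Q) Q g
     \<and> g \<cdot>\<^bsub>C\<^esub> fmor (cnj (double K)) (fob (cnj (double K)) Q) Q g = lam (double K) Q"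
    unfolding P by (subst double_def) (simp add: double_cat_def Let_def double_simps)
  also have "\<dots> \<longleftrightarrow> (\<exists>a b. P = ob2 a b \<and> cj2 a b)" (is "?L \<longleftrightarrow> ?R")
  proof
    assume L: ?L
    then obtain a where a: "Q = ob a" "cj a" by (auto elim: Obj_doubleE)
    have "isom C' (ob (icj a)) (ob a) g" using L a by simp
    moreover then obtain b where b: "g = mor b" "ok C b" "src b = io (tgt a)" "tgt b = tgt a"
      using Hom_doubleE[of g "icj a" a] a by (auto simp: isom_def)
    ultimately have "aiso C b" and ba: "b \<cdot> icj a = a \<cdot> I b"
      using a by (simp_all add: isom_double_iff)
    moreover have "b \<cdot> I b = (- 1) \<odot> lm (tgt a)"
      using L a b by (simp add: double_simps to_arrow)
    moreover have "b \<cdot> I a = (- 1) \<odot> (a \<cdot> I b)"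
      unfolding ba[symmetric] using a b by (simp add: icj_def)
    ultimately show ?R
      unfolding P using a b by (intro exI[of _ a] exI[of _ b] conjI cj2I) simp_all
  next
    assume ?R
    then obtain a b where "Q = ob a" "g = mor b" "cj2 a b"
      unfolding P by auto
    then show ?L
      by (simp add: isom_double_iff double_simps to_arrow) (simp add: icj_def)
  qed
  finally show ?thesis .
qed

lemma Obj_double2E:
  assumes "P \<in> Obj C''"
  obtains a b where "P = ob2 a b" "cj2 a b"
  using assms Obj_double2 by blast

lemma ob2_in [simp]: "\<lbrakk>cj2 a b; tgt a = X\<rbrakk> \<Longrightarrow> ((X, mor a), mor b) \<in> Obj C''"
  using Obj_double2 by blast

lemma ob2_in_iff:
  assumes "ok C a" "ok C b" "src a = io X" "tgt a = X" "src b = io X" "tgt b = X"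
  shows "((X, mor a), mor b) \<in> Obj C'' \<longleftrightarrow> cj2 a b"
proof
  assume "((X, mor a), mor b) \<in> Obj C''"
  then obtain c d where *: "ob2 c d = ((X, mor a), mor b)" "cj2 c d"
    by (metis Obj_double2E)
  then have "a = c"
    using assms by - (rule arr_eqI, simp_all)
  moreover have "b = d"
    using assms * by - (rule arr_eqI, simp_all)
  ultimately show "cj2 a b" using *(2) by simp
qed (use assms in auto)

lemmas double2_simps = conj_dual.double_simps[OF conj_dual_double, unfolded double_simps]

lemma Hom_double2 [simp]:
  assumes "ok C p" "src p = X" "tgt p = Y" "cj2 a b" "tgt a = X" "cj2 c d" "tgt c = Y"
  shows "mor p \<in> Hom C'' ((X, mor a), mor b) ((Y, mor c), mor d) \<longleftrightarrow> p \<cdot> a = c \<cdot> I p \<and> p \<cdot> b = d \<cdot> I p"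
proof -
  have "mor p \<in> Hom C'' ((X, mor a), mor b) ((Y, mor c), mor d) \<longleftrightarrow>
    mor p \<in> Hom C' (X, mor a) (Y, mor c) \<and> mor p \<cdot>\<^bsub>C\<^esub> mor b = mor d \<cdot>\<^bsub>C\<^esub> fmor (cnj (double K)) (X, mor a) (Y, mor c) (mor p)"
    by (subst double_def) (simp add: double_cat_def Let_def double_simps)
  then show ?thesis
    using assms by (auto simp: double_simps to_arrow)
qed

lemma Hom_double2E:
  assumes "m \<in> Hom C'' (ob2 a b) (ob2 c d)" "cj2 a b" "cj2 c d"
  obtains p where "m = mor p" "ok C p" "src p = tgt a" "tgt p = tgt c" "p \<cdot> a = c \<cdot> I p" "p \<cdot> b = d \<cdot> I p"
proof -
  have "m \<in> Hom C' (ob a) (ob c)"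
    using assms by (subst (asm) double_def) (simp add: double_cat_def Let_def)
  then obtain p where p: "m = mor p" "ok C p" "src p = tgt a" "tgt p = tgt c"
    using assms by (auto elim!: Hom_doubleE)
  show ?thesis
    by (rule that[OF p]) (use assms p in auto)
qed

lemma double2_isoI:
  assumes "cj2 a b" "cj2 c d" "aiso C p" "src p = X" "tgt p = Y" "p \<cdot> a = c \<cdot> I p" "p \<cdot> b = d \<cdot> I p"
    "tgt a = X" "tgt c = Y"
  shows "isom C'' ((X, mor a), mor b) ((Y, mor c), mor d) (mor p)"
proof -
  note p = assms ok_aiso[OF assms(3)]
  have "iv p \<cdot> c = a \<cdot> I (iv p)" "iv p \<cdot> d = b \<cdot> I (iv p)"
    using square_inv[OF assms(6)] square_inv[OF assms(7)] p by simp_all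
  moreover have "X \<in> Obj C" "Y \<in> Obj C" using p by auto
  ultimately show ?thesis
    unfolding isom_def using p
    by (intro conjI bexI[of _ "mor (iv p)"]) (simp_all add: double2_simps to_arrow)
qed

lemma fob_double2 [simp]:
  assumes "cj2 a b" "tgt a = X"
  shows "fob (cnj (double (double K))) ((X, mor a), mor b) = ((io X, mor (icj a)), mor (icj b))"
    and "fob (dua (double (double K))) ((X, mor a), mor b) = ((dob X, mor (dcj a)), mor ((- 1) \<odot> dcj b))"
proof -
  have "D b \<cdot> dcj a = dcj (icj a) \<cdot> I (D b)"
    using assms by (intro D_double_square) (simp_all, simp add: icj_def)
  then have "Inv C' (dob X, mor (dcj a)) (dob (io X), mor (dcj (icj a))) (mor (D b)) = mor (D (iv b))"
    using assms by (subst double_isoI(2)) auto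
  moreover have "X \<in> Obj C" using assms by auto
  ultimately show "fob (cnj (double (double K))) ((X, mor a), mor b) = ((io X, mor (icj a)), mor (icj b))"
    and "fob (dua (double (double K))) ((X, mor a), mor b) = ((dob X, mor (dcj a)), mor ((- 1) \<odot> dcj b))"
    using assms by (simp_all add: fob_double_raw[of "double K"] double_simps to_arrow)
      (simp_all add: icj_def dcj_def)
qed

lemma conj_dual_double2: "conj_dual (double (double K))"
  by (rule conj_dual.conj_dual_double[OF conj_dual_double])

text \<open>
  That these pairs are objects of \<open>\<C>''\<close> follows from the conjugation and the duality on \<open>\<C>''\<close> being functors.
\<close>

lemma cj2_icj [simp]:
  assumes "cj2 a b"
  shows "cj2 (icj a) (icj b)"
proof -
  interpret K'': conj_dual "double (double K)" by (rule conj_dual_double2)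
  have "fob (cnj (double (double K))) (ob2 a b) \<in> Obj C''"
    using assms by (intro K''.I.fob_in) simp
  then show ?thesis
    using assms by (simp add: ob2_in_iff icj_def)
qed

lemma cj2_dcj [simp]:
  assumes "cj2 a b"
  shows "cj2 (dcj a) ((- 1) \<odot> dcj b)"
proof -
  interpret K'': conj_dual "double (double K)" by (rule conj_dual_double2)
  have "fob (dua (double (double K))) (ob2 a b) \<in> Obj C''"
    using assms by (intro K''.D.fob_in) simp
  moreover have "ok C (dcj b)" "src (dcj b) = io (dob (tgt a))" "tgt (dcj b) = dob (tgt a)"
    using assms by (simp_all add: dcj_def)
  ultimately show ?thesis
    using assms by (simp add: ob2_in_iff)
qed

lemma dualID_double2:
  "dualID (double (double K)) =
    (C'', comp_con (cnj (double (double K))) (dua (double (double K))), conj_dual.dID (double (double K)))"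
  by (rule conj_dual.dualID_eq) (rule conj_dual_double2)

end

context conj_dual_sums
begin

section \<open>The functor \<open>\<Psi>\<close>\<close>

lemma cj2_La [simp]: "X \<in> Obj C \<Longrightarrow> cj2 (La 1 X) (La (- 1) X)"
proof (rule cj2I)
  assume X: "X \<in> Obj C"
  show "La (- 1) X \<cdot> I (La (- 1) X) = (- 1) \<odot> lm (tgt (La 1 X))"
    using X by (simp add: La_La jq_sum del: ascl_aadd flip: ascl_aadd)
qed (simp_all add: La_La)

lemma Psi_simps:
  "X \<in> Obj C \<Longrightarrow> fob (Psi_fun K B) X = ((S X, mor (La 1 X)), mor (La (- 1) X))"
  "\<lbrakk>ok C a; src a = X; tgt a = Y\<rbrakk> \<Longrightarrow> fmor (Psi_fun K B) X Y (mor a) = mor (dg a)"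
  by (simp_all add: Psi_fun_def mat_dsum S_def diag_mor)

lemma Psi_functor: "covariant_functor C C'' (Psi_fun K B)"
  unfolding covariant_functor_def
  by (auto elim!: arr_cases simp: Psi_simps to_arrow double2_simps dg_La dg_aadd)

text \<open>
  The components of \<open>Psi_hat\<close> and \<open>Psi_check\<close> as typed arrows.
\<close>

definition "ps X = I (D (q1 X)) \<cdot> q2 (dob X) \<oplus> I (D (q2 X)) \<cdot> I (al X) \<cdot> iv (lm (dob X)) \<cdot> q1 (dob X)"
definition "pk X = D (q1 X) \<cdot> lm (dob X) \<cdot> q2 (io (dob X)) \<oplus> (- 1) \<odot> (D (q2 X) \<cdot> al X \<cdot> q1 (io (dob X)))"

lemma ps_src_tgt [simp]: "src (ps X) = S (dob X)" "tgt (ps X) = io (dob (S X))"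
    "src (pk X) = S (io (dob X))" "tgt (pk X) = dob (S X)"
  by (simp_all add: ps_def pk_def)

lemma ok_ps [simp]: "X \<in> Obj C \<Longrightarrow> ok C (ps X)" "X \<in> Obj C \<Longrightarrow> ok C (pk X)"
  by (simp_all add: ps_def pk_def)

lemma mor_ps: "X \<in> Obj C \<Longrightarrow> snd (Psi_hat K B) X = mor (ps X)"
  and mor_pk: "X \<in> Obj C \<Longrightarrow> snd (Psi_check K B) X = mor (pk X)"
  using mat_arr[OF dsum_biproduct _ _ ID_sum(1), of "dob X" X] mat_arr[OF dsum_biproduct _ _ D_sum(1), of "io (dob X)" X]
  by (simp_all add: Psi_hat_def Psi_check_def Let_def to_arrow amat_def D_sum ID_sum ps_def pk_def flip: j1_def j2_def q1_def q2_def)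

lemma aiso_ps [simp]:
  assumes "X \<in> Obj C"
  shows "aiso C (ps X)" "aiso C (pk X)"
proof -
  let ?p = "j2 (dob X) \<cdot> I (D (j1 X)) \<oplus> j1 (dob X) \<cdot> lm (dob X) \<cdot> I (iv (al X)) \<cdot> I (D (j2 X))"
  let ?c = "j2 (io (dob X)) \<cdot> iv (lm (dob X)) \<cdot> D (j1 X) \<oplus> (- 1) \<odot> (j1 (io (dob X)) \<cdot> iv (al X) \<cdot> D (j2 X))"
  have D: "D (q1 X) \<cdot> D (j1 X) \<oplus> D (q2 X) \<cdot> D (j2 X) = ide (dob (S X))"
    using arg_cong[OF jq_sum(1)[OF assms], of D] assms by simp
  have ID: "I (D (q1 X)) \<cdot> I (D (j1 X)) \<oplus> I (D (q2 X)) \<cdot> I (D (j2 X)) = ide (io (dob (S X)))"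
    using arg_cong[OF D, of I] assms by simp
  show "aiso C (ps X)"
    using assms by (intro aisoI[of _ ?p]) (simp_all add: ps_def cancel vanish jq_sum ID)
  show "aiso C (pk X)"
    using assms by (intro aisoI[of _ ?c]) (simp_all add: pk_def cancel vanish jq_sum D)
qed

lemma ps_La:
  assumes "X \<in> Obj C" "r * r = 1"
  shows "ps X \<cdot> La r (dob X) = r \<odot> (icj (dcj (La r X)) \<cdot> I (ps X))"
  using assms by (simp add: icj_def ps_def dcj_def La_def[of _ "dob X"] Li_def nats cancel vanish D_inv_lm_al aadd_commute)

lemma pk_La:
  assumes "X \<in> Obj C" "r * r = 1"
  shows "pk X \<cdot> La r (io (dob X)) = r \<odot> (dcj (La r X) \<cdot> I (pk X))"
  using assms by (simp add: pk_def dcj_def La_def[of _ "io (dob X)"] Li_def nats cancel vanish D_inv_lm_al aadd_commute)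

text \<open>
  After application of the forgetful functors, \<open>ps\<close> and \<open>pk\<close> become the components of \<open>F_hat\<close> and \<open>F_check\<close>.
\<close>

lemma dcj_ps: "X \<in> Obj C \<Longrightarrow> dcj (La (- 1) X) \<cdot> ps X = ph X"
  by (simp add: ps_def ph_def dcj_def Li_def nats cancel vanish D_inv_lm_al aadd_commute)

lemma gh_pk: "X \<in> Obj C \<Longrightarrow> (- 1) \<odot> (gh (La (- 1) X) \<cdot> pk X) = pc X"
  by (simp add: pk_def pc_def gh_def La_def nats cancel vanish inv_al_lm aadd_commute)

lemma hat_fst [simp]:
  "fst (Psi_hat K B) = Psi_fun K B" "fst (Psi_check K B) = Psi_fun K B"
  "fst (F_hat K B) = F_fun K B" "fst (F_check K B) = F_fun K B"
  by (simp_all add: Psi_hat_def Psi_check_def F_hat_def F_check_def Let_def)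

lemma Psi_faithful:
  assumes "ok C a" "ok C b" "src a = src b" "tgt a = tgt b" "acov C (Psi_fun K B) a = acov C (Psi_fun K B) b"
  shows "a = b"
proof -
  have "dg a = dg b"
    using assms by (simp add: acov_def Psi_simps)
  then have "q1 (tgt a) \<cdot> dg a \<cdot> j1 (src a) = q1 (tgt a) \<cdot> dg b \<cdot> j1 (src a)"
    by simp
  then show ?thesis
    using assms(1-4) by (simp add: dg_def)
qed

end

context conj_dual
begin

lemma dual_fst [simp]: "fst (dualD K) = C" "fst (snd (dualD K)) = dua K" "fst (dualID K) = C" "fst (snd (dualID K)) = ID"
  by (simp_all add: dualD_def dualID_eq)

lemma G_signed:
  assumes "\<epsilon> * \<epsilon> = 1"
  shows "dmorphism (signed \<epsilon> (dualD (double K))) (signed (- \<epsilon>) (dualID K)) (G_hat K)"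
    and "dmorphism (signed \<epsilon> (dualID (double K))) (signed \<epsilon> (dualD K)) (G_check K)"
  using dmorphism_signed[OF G_hat category_with_duality_ID _ assms]
    dmorphism_signed[OF dmorphism_signed_one[OF G_check] category_with_duality_D _ assms] by simp_all

lemma G_snd:
  assumes "cj a" "tgt a = X"
  shows "snd (G_hat K) (X, mor a) = mor (gh a)" "snd (G_check K) (X, mor a) = mor ((- 1) \<odot> dcj a)"
  using assms by (auto simp: G_hat_def G_check_def Let_def to_arrow gh_def dcj_def)

lemma G2_snd:
  assumes "cj2 a b" "tgt a = X"
  shows "snd (G_hat (double K)) ((X, mor a), mor b) = mor ((- 1) \<odot> gh b)"
    "snd (G_check (double K)) ((X, mor a), mor b) = mor (dcj b)"
proof -
  have X: "X \<in> Obj C" using assms by auto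
  have "Inv C' (io (dob X), mor (icj (dcj a))) (dob (io X), mor (dcj (icj a))) (mor ((- 1) \<odot> al X)) = mor ((- 1) \<odot> iv (al X))"
    using assms al_double_square[of a] by (subst double_isoI(2)) auto
  then show "snd (G_hat (double K)) ((X, mor a), mor b) = mor ((- 1) \<odot> gh b)"
    using assms X by (simp add: G_hat_def Let_def double_simps to_arrow gh_def)
  have "b \<cdot> icj a = a \<cdot> I b" using assms by (simp add: icj_def)
  then have "Inv C' (io X, mor (icj a)) (X, mor a) (mor b) = mor (iv b)"
    using assms by (subst double_isoI(2)) auto
  then show "snd (G_check (double K)) ((X, mor a), mor b) = mor (dcj b)"
    using assms X by (simp add: G_check_def Let_def double_simps to_arrow dcj_def)
qed

lemma G_faithful:
  assumes "ok M a" "ok M b" "src a = src b" "tgt a = tgt b" "acov M G_fun a = acov M G_fun b"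
  shows "a = b"
  using assms iffD1[OF ok_iff, of M a] iffD1[OF ok_iff, of M b]
  by (intro arr.expand) (auto simp: acov_def G_fun_def)

end

context conj_dual_sums
begin

lemma F_signed:
  assumes "\<epsilon> * \<epsilon> = 1"
  shows "dmorphism (signed \<epsilon> (dualD K)) (signed \<epsilon> (dualD (double K))) (F_hat K B)"
    and "dmorphism (signed \<epsilon> (dualID K)) (signed \<epsilon> (dualID (double K))) (F_check K B)"
proof -
  interpret K': conj_dual "double K" by (rule conj_dual_double)
  show "dmorphism (signed \<epsilon> (dualD K)) (signed \<epsilon> (dualD (double K))) (F_hat K B)"
    and "dmorphism (signed \<epsilon> (dualID K)) (signed \<epsilon> (dualID (double K))) (F_check K B)"
  using dmorphism_signed[OF dmorphism_signed_one[OF F_hat] K'.category_with_duality_D _ assms]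
    dmorphism_signed[OF dmorphism_signed_one[OF F_check] K'.category_with_duality_ID _ assms] by simp_all
qed

lemma dcj_gh_typed [simp]:
  assumes "aiso C a" "src a = io (tgt a)"
  shows "ok C (dcj a)" "src (dcj a) = io (dob (tgt a))" "ok C (gh a)" "src (gh a) = dob (tgt a)"
  using assms by (simp_all add: dcj_def gh_def ok_aiso)

lemma icj_ascl: "icj (r \<odot> a) = r \<odot> icj a"
  by (simp add: icj_def)

lemma G_Psi_pointwise:
  assumes "fst \<C> = C'" "X \<in> Obj C"
  shows "snd (dcomp \<A> \<B> \<C> (G_check (double K)) (Psi_hat K B)) X = snd (F_hat K B) X"
    and "snd (dcomp \<A> \<B> \<C> (G_hat (double K)) (Psi_check K B)) X = snd (F_check K B) X"
  using assms gh_pk[OF assms(2)]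
  by (simp_all add: dcomp_simps mor_ps mor_ph mor_pk mor_pc F_simps Psi_simps G_fun_def double_simps to_arrow G2_snd dcj_ps)

text \<open>
  On objects and morphisms the composites agree with \<open>F_hat\<close> and \<open>F_check\<close>, so they are morphisms of
  categories with duality. The forgetful functor is faithful and reflects this property to \<open>Psi_hat\<close> and
  \<open>Psi_check\<close>, which leaves only the squares \<open>ps_La\<close> and \<open>pk_La\<close> to be checked by computation.
\<close>

lemma G_Psi:
  assumes "\<epsilon> * \<epsilon> = 1"
  shows G_Psi_hat: "dmor_eq (signed \<epsilon> (dualD K)) (signed \<epsilon> (dualD (double K)))
      (dcomp (signed \<epsilon> (dualD K)) (signed \<epsilon> (dualID (double (double K)))) (signed \<epsilon> (dualD (double K)))
        (G_check (double K)) (Psi_hat K B)) (F_hat K B)" (is "dmor_eq ?D ?D' ?GP ?F")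
    and Psi_hat_signed: "dmorphism (signed \<epsilon> (dualD K)) (signed \<epsilon> (dualID (double (double K)))) (Psi_hat K B)"
    and G_Psi_check: "dmor_eq (signed \<epsilon> (dualID K)) (signed \<epsilon> (dualID (double K)))
      (dcomp (signed \<epsilon> (dualID K)) (signed (- \<epsilon>) (dualD (double (double K)))) (signed \<epsilon> (dualID (double K)))
        (G_hat (double K)) (Psi_check K B)) (F_check K B)" (is "dmor_eq ?I ?I' ?GPc ?Fc")
    and Psi_check_signed: "dmorphism (signed \<epsilon> (dualID K)) (signed (- \<epsilon>) (dualD (double (double K)))) (Psi_check K B)"
proof -
  interpret K': conj_dual "double K" by (rule conj_dual_double)
  interpret K'': conj_dual "double (double K)" by (rule conj_dual_double2)
  have e: "- \<epsilon> * - \<epsilon> = 1" using assms by simp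
  have fob: "fob G_fun (fob (Psi_fun K B) X) = fob (F_fun K B) X" if "X \<in> Obj C" for X
    using that by (simp add: F_simps Psi_simps G_fun_def)
  have fmor: "fmor (comp_cov G_fun (Psi_fun K B)) X Y m = fmor (F_fun K B) X Y m" for X Y m
    by (simp add: fmor_simps G_fun_def F_fun_def Psi_fun_def)
  have hat: "dmorphism ?D ?D' ?GP" "dmor_eq ?D ?D' ?GP ?F"
    by (rule dmor_eqI(1)[OF F_signed(1)[OF assms]]; simp add: G_Psi_pointwise; simp add: dcomp_simps fob fmor)
      (rule dmor_eqI(2)[OF F_signed(1)[OF assms]]; simp add: G_Psi_pointwise; simp add: dcomp_simps fob fmor)
  have check: "dmorphism ?I ?I' ?GPc" "dmor_eq ?I ?I' ?GPc ?Fc"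
    by (rule dmor_eqI(1)[OF F_signed(2)[OF assms]]; simp add: G_Psi_pointwise; simp add: dcomp_simps fob fmor)
      (rule dmor_eqI(2)[OF F_signed(2)[OF assms]]; simp add: G_Psi_pointwise; simp add: dcomp_simps fob fmor)
  show "dmor_eq ?D ?D' ?GP ?F" "dmor_eq ?I ?I' ?GPc ?Fc"
    by (fact hat(2), fact check(2))
  show "dmorphism ?D (signed \<epsilon> (dualID (double (double K)))) (Psi_hat K B)"
  proof (rule dmorphism_reflectI[OF K'.G_signed(2)[OF assms] hat(1)], goal_cases)
    case (2 X)
    then have "ps X \<cdot> La (- 1) (dob X) = icj ((- 1) \<odot> dcj (La (- 1) X)) \<cdot> I (ps X)"
      using ps_La[of X "- 1"] by (simp add: icj_ascl)
    with 2 show ?case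
      using ps_La[of X 1] by (auto simp: mor_ps Psi_simps intro!: double2_isoI)
  qed (use Psi_functor G_faithful in auto)
  show "dmorphism ?I (signed (- \<epsilon>) (dualD (double (double K)))) (Psi_check K B)"
  proof (rule dmorphism_reflectI[OF K'.G_signed(1)[OF e, unfolded minus_minus] check(1)], goal_cases)
    case (2 X)
    then show ?case
      using pk_La[of X 1] pk_La[of X "- 1"]
      by (auto simp: mor_pk Psi_simps intro!: double2_isoI)
  qed (use Psi_functor G_faithful in auto)
qed

end

section \<open>The functor \<open>\<Theta>\<close>\<close>

locale conj_dual_split = conj_dual_sums K B
  for K :: "('o, 'm, 'k::{comm_ring, comm_monoid_mult}) cdcat" and B +
  fixes half :: 'k and T :: "('o \<times> 'm) \<times> 'm \<Rightarrow> 'o" and t s :: "('o \<times> 'm) \<times> 'm \<Rightarrow> 'm"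
  assumes half: "(1 + 1) * half = 1"
    and Theta: "Theta_choice K half T t s"
begin

definition "tt a b = arw (T (ob2 a b)) (tgt a) (t (ob2 a b))"
definition "ss a b = arw (tgt a) (T (ob2 a b)) (s (ob2 a b))"
definition "ee a b = half \<odot> (ide (tgt a) \<oplus> (- 1) \<odot> (b \<cdot> iv a))"

lemma tt_src_tgt [simp]: "src (tt a b) = T (ob2 a b)" "tgt (tt a b) = tgt a"
    "src (ss a b) = tgt a" "tgt (ss a b) = T (ob2 a b)"
    "src (ee a b) = tgt a" "tgt (ee a b) = tgt a"
  by (simp_all add: tt_def ss_def ee_def)

lemma mor_tt: "tgt a = X \<Longrightarrow> t ((X, mor a), mor b) = mor (tt a b)"
  and mor_ss: "tgt a = X \<Longrightarrow> s ((X, mor a), mor b) = mor (ss a b)"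
  by (auto simp: tt_def ss_def)

lemma split [simp]:
  assumes "cj2 a b"
  shows "T (ob2 a b) \<in> Obj C" "ok C (tt a b)" "ok C (ss a b)" "ok C (ee a b)"
    "ss a b \<cdot> tt a b = ide (T (ob2 a b))"
    and tt_ss: "tt a b \<cdot> ss a b = ee a b"
proof -
  have "ob2 a b \<in> Obj C''" using assms by simp
  then have *: "T (ob2 a b) \<in> Obj C" "t (ob2 a b) \<in> Hom C (T (ob2 a b)) (tgt a)"
    "s (ob2 a b) \<in> Hom C (tgt a) (T (ob2 a b))"
    "s (ob2 a b) \<cdot>\<^bsub>C\<^esub> t (ob2 a b) = Idn C (T (ob2 a b))"
    "t (ob2 a b) \<cdot>\<^bsub>C\<^esub> s (ob2 a b) = half \<odot>\<^bsub>C\<^esub> (Idn C (tgt a) \<oplus>\<^bsub>C\<^esub> \<ominus>\<^bsub>C\<^esub> (mor b \<cdot>\<^bsub>C\<^esub> Inv C (io (tgt a)) (tgt a) (mor a)))"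
    using Theta by (simp_all add: Theta_choice_def Let_def)
  then show 1: "T (ob2 a b) \<in> Obj C" "ok C (tt a b)" "ok C (ss a b)" "ok C (ee a b)"
    using assms by (simp_all add: tt_def ss_def ee_def)
  show "ss a b \<cdot> tt a b = ide (T (ob2 a b))" "tt a b \<cdot> ss a b = ee a b"
    using *(4,5) 1 assms by (simp_all add: mor_tt mor_ss to_arrow ee_def)
qed

lemma ss_tt_reassoc [simp]:
  "\<lbrakk>cj2 a b; ok C c; tgt c = T (ob2 a b)\<rbrakk> \<Longrightarrow> ss a b \<cdot> (tt a b \<cdot> c) = c"
  using acmp_reassoc[OF split(5), of a b c] by simp

lemma tt_ss_reassoc: "cj2 a b \<Longrightarrow> tt a b \<cdot> (ss a b \<cdot> c) = ee a b \<cdot> c"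
  by (rule acmp_reassoc) (rule tt_ss)

lemma ee_tt [simp]: "cj2 a b \<Longrightarrow> ee a b \<cdot> tt a b = tt a b"
  "cj2 a b \<Longrightarrow> ss a b \<cdot> ee a b = ss a b"
  by (simp_all flip: tt_ss)

lemma half_twice: "ok C x \<Longrightarrow> half \<odot> x \<oplus> half \<odot> x = x"
  using half by (simp add: ascl_add distrib_right)

lemma eq_neg_zero:
  assumes "x = (- 1) \<odot> x" "ok C x"
  shows "x = zer (src x) (tgt x)"
proof -
  have "x = half \<odot> (x \<oplus> x)"
    using half_twice[OF assms(2)] by simp
  also have "x \<oplus> x = x \<oplus> (- 1) \<odot> x"
    using assms(1) by simp
  also have "half \<odot> (x \<oplus> (- 1) \<odot> x) = zer (src x) (tgt x)"
    using assms(2) by (simp del: ascl_aadd)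
  finally show ?thesis .
qed

lemma neg_eqD: "(- 1) \<odot> x = y \<Longrightarrow> ok C x \<Longrightarrow> x = (- 1) \<odot> y"
  by auto

lemma half_average:
  assumes "ok C x" "ok C u" "src u = src x" "tgt u = tgt x"
  shows "half \<odot> (x \<oplus> (- 1) \<odot> u) \<oplus> half \<odot> (x \<oplus> u) = x"
proof -
  have "(x \<oplus> (- 1) \<odot> u) \<oplus> (x \<oplus> u) = x \<oplus> x"
    using assms by (simp add: aadd_left_commute[of x "(- 1) \<odot> u"])
  then have "half \<odot> (x \<oplus> (- 1) \<odot> u) \<oplus> half \<odot> (x \<oplus> u) = half \<odot> (x \<oplus> x)"
    by (metis ascl_aadd)
  then show ?thesis
    using half_twice assms by simp
qed

lemma aadd_cancel:
  assumes "x \<oplus> y = x \<oplus> z" "ok C x" "ok C y" "ok C z" "src y = src x" "tgt y = tgt x" "src z = src x" "tgt z = tgt x"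
  shows "y = z"
proof -
  have "(- 1) \<odot> x \<oplus> (x \<oplus> y) = (- 1) \<odot> x \<oplus> (x \<oplus> z)"
    by (simp only: assms(1))
  then show ?thesis
    using assms(2-) by simp
qed

lemma half_fixed:
  assumes "half \<odot> (x \<oplus> (- 1) \<odot> y) = x" "ok C x" "ok C y" "src y = src x" "tgt y = tgt x"
  shows "y = (- 1) \<odot> x"
proof -
  have "x \<oplus> x = x \<oplus> (- 1) \<odot> y"
    using half_twice[of "x \<oplus> (- 1) \<odot> y"] assms by (simp del: ascl_aadd)
  then have "x = (- 1) \<odot> y"
    using assms by - (rule aadd_cancel[of x], simp_all)
  then show ?thesis
    using assms by (metis ascl_ascl ascl_one minus_mult_minus mult_1)
qed

text \<open>
  The endomorphism \<open>u = g f\<^sup>-\<^sup>1\<close> is an involution with \<open>u f = -f \<iota>(u)\<close>, and \<open>ee\<close> is the projection onto its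
  eigenspace for \<open>-1\<close>. So \<open>u\<close> acts as \<open>-1\<close> on \<open>t\<close> from the left and on \<open>s\<close> from the right.
\<close>

lemma b_inv_a_tt:
  assumes "cj2 a b"
  shows "b \<cdot> (iv a \<cdot> tt a b) = (- 1) \<odot> tt a b"
  using ee_tt(1)[OF assms] assms by - (rule half_fixed, simp_all add: ee_def)

lemma ss_b_inv_a:
  assumes "cj2 a b"
  shows "ss a b \<cdot> (b \<cdot> iv a) = (- 1) \<odot> ss a b"
  using ee_tt(2)[OF assms] assms by - (rule half_fixed, simp_all add: ee_def)

lemma a_inv_b_tt:
  assumes "cj2 a b"
  shows "a \<cdot> (iv b \<cdot> tt a b) = (- 1) \<odot> tt a b"
proof -
  have "a \<cdot> iv b \<cdot> ((- 1) \<odot> (b \<cdot> (iv a \<cdot> tt a b))) = (- 1) \<odot> tt a b"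
    using assms by simp
  then show ?thesis
    unfolding b_inv_a_tt[OF assms] using assms by simp
qed

text \<open>
  On \<open>\<iota>(t)\<close> the involution \<open>\<iota>(u)\<close> is \<open>-1\<close>, so \<open>g = u f = -f \<iota>(u)\<close> coincides with \<open>f\<close> there.
\<close>

lemma b_I_tt:
  assumes "cj2 a b"
  shows "b \<cdot> I (tt a b) = a \<cdot> I (tt a b)" "b \<cdot> (I (tt a b) \<cdot> c) = a \<cdot> (I (tt a b) \<cdot> c)"
    "I b \<cdot> (I (I (tt a b)) \<cdot> c) = I a \<cdot> (I (I (tt a b)) \<cdot> c)"
proof -
  have "I b \<cdot> (I (iv a) \<cdot> I (tt a b)) = (- 1) \<odot> I (tt a b)"
    using arg_cong[OF b_inv_a_tt[OF assms], of I] assms by simp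
  then have "b \<cdot> I (tt a b) = (- 1) \<odot> (b \<cdot> (I b \<cdot> (I (iv a) \<cdot> I (tt a b))))"
    using assms by simp
  also have "\<dots> = lm (tgt a) \<cdot> (I (iv a) \<cdot> I (tt a b))"
    using acmp_reassoc[OF cj2D(7)[OF assms]] assms by simp
  also have "\<dots> = a \<cdot> I (tt a b)"
    using assms by (simp add: cancel flip: cj_reassoc)
  finally show *: "b \<cdot> I (tt a b) = a \<cdot> I (tt a b)" .
  show "b \<cdot> (I (tt a b) \<cdot> c) = a \<cdot> (I (tt a b) \<cdot> c)"
    by (rule square_reassoc[OF *])
  show "I b \<cdot> (I (I (tt a b)) \<cdot> c) = I a \<cdot> (I (I (tt a b)) \<cdot> c)"
    using I_square[OF *] assms by simp_all
qed

lemma ee_nat: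
  assumes "cj2 a b" "cj2 c d" "ok C p" "src p = tgt a" "tgt p = tgt c" "p \<cdot> a = c \<cdot> I p" "p \<cdot> b = d \<cdot> I p"
  shows "ee c d \<cdot> p = p \<cdot> ee a b"
proof -
  have "iv c \<cdot> p = I p \<cdot> iv a"
    using square_inv[OF assms(6)[symmetric]] assms by simp
  then have "d \<cdot> iv c \<cdot> p = p \<cdot> b \<cdot> iv a"
    using square_reassoc[OF assms(7)] by simp
  then show ?thesis
    using assms by (simp add: ee_def)
qed

lemma Theta_simps:
  "fob (Theta_fun K T t s) = T"
  "\<lbrakk>cj2 a b; cj2 c d; ok C p; src p = X; tgt p = Y; tgt a = X; tgt c = Y\<rbrakk> \<Longrightarrow>
    fmor (Theta_fun K T t s) ((X, mor a), mor b) ((Y, mor c), mor d) (mor p) = mor (ss c d \<cdot> p \<cdot> tt a b)"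
  by (auto simp: Theta_fun_def mor_tt mor_ss to_arrow)

lemma Theta_functor: "covariant_functor C'' C (Theta_fun K T t s)"
  unfolding covariant_functor_def
proof (intro conjI ballI allI, goal_cases)
  case (4 P Q R m n)
  then obtain a b c d f g where P: "P = ob2 a b" "cj2 a b" and Q: "Q = ob2 c d" "cj2 c d" and R: "R = ob2 f g" "cj2 f g"
    by (metis Obj_double2E)
  obtain p where p: "m = mor p" "ok C p" "src p = tgt a" "tgt p = tgt c" "p \<cdot> a = c \<cdot> I p" "p \<cdot> b = d \<cdot> I p"
    using Hom_double2E[OF 4(4)[unfolded P Q] P(2) Q(2)] .
  obtain q where q: "n = mor q" "ok C q" "src q = tgt c" "tgt q = tgt f" "q \<cdot> c = f \<cdot> I q" "q \<cdot> d = g \<cdot> I q"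
    using Hom_double2E[OF 4(5)[unfolded Q R] Q(2) R(2)] .
  have "ee c d \<cdot> (p \<cdot> tt a b) = p \<cdot> tt a b"
    using acmp_reassoc[OF ee_nat[OF P(2) Q(2) p(2-)]] P by simp
  then show ?case
    using P Q R p q by (simp add: Theta_simps double2_simps to_arrow tt_ss_reassoc)
qed (auto elim!: Obj_double2E Hom_double2E simp: Theta_simps double2_simps to_arrow)

subsection \<open>The isomorphism \<open>\<Psi>\<Theta> \<cong> 1\<close>\<close>

text \<open>
  The arrow \<open>(t, f \<iota>(t))\<close> from \<open>\<Theta>(C'') \<oplus> \<iota>(\<Theta>(C''))\<close> to \<open>C\<close>. As \<open>u f = -f \<iota>(u)\<close>, the structure map \<open>f\<close> carries
  the \<open>-1\<close>-eigenspace of \<open>\<iota>(u)\<close> to the \<open>1\<close>-eigenspace of \<open>u\<close>, so this decomposes \<open>C\<close> into the eigenspaces of \<open>u\<close>.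
\<close>

definition "rh a b = tt a b \<cdot> q1 (T (ob2 a b)) \<oplus> a \<cdot> I (tt a b) \<cdot> q2 (T (ob2 a b))"

lemma rh_typed [simp]: "src (rh a b) = S (T (ob2 a b))" "tgt (rh a b) = tgt a" "cj2 a b \<Longrightarrow> ok C (rh a b)"
  by (simp_all add: rh_def)

text \<open>
  The two mixed composites of \<open>rh\<close> with its inverse vanish because they relate different eigenvalues: each
  equals its own negative, and \<open>2\<close> is invertible.
\<close>

lemma ss_a_I_tt:
  assumes "cj2 a b"
  shows "ss a b \<cdot> (a \<cdot> I (tt a b)) = zer (io (T (ob2 a b))) (T (ob2 a b))"
    "ok C c \<Longrightarrow> tgt c = io (T (ob2 a b)) \<Longrightarrow> ss a b \<cdot> (a \<cdot> (I (tt a b) \<cdot> c)) = zer (src c) (T (ob2 a b))"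
proof -
  let ?x = "ss a b \<cdot> (a \<cdot> I (tt a b))"
  have "?x = ss a b \<cdot> (b \<cdot> iv a) \<cdot> a \<cdot> I (tt a b)"
    using assms by (simp add: b_I_tt)
  also have "\<dots> = (ss a b \<cdot> (b \<cdot> iv a)) \<cdot> a \<cdot> I (tt a b)"
    by simp
  also have "\<dots> = (- 1) \<odot> ?x"
    unfolding ss_b_inv_a[OF assms] by simp
  finally have x: "?x = (- 1) \<odot> ?x" .
  show *: "?x = zer (io (T (ob2 a b))) (T (ob2 a b))"
    using eq_neg_zero[OF x] assms by simp
  show "ss a b \<cdot> (a \<cdot> (I (tt a b) \<cdot> c)) = zer (src c) (T (ob2 a b))"
    if "ok C c" "tgt c = io (T (ob2 a b))"
    using arg_cong[OF *, of "\<lambda>x. x \<cdot> c"] that assms by simp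
qed

lemma I_ss_inv_a_tt:
  assumes "cj2 a b"
  shows "I (ss a b) \<cdot> (iv a \<cdot> tt a b) = zer (T (ob2 a b)) (io (T (ob2 a b)))"
    "ok C c \<Longrightarrow> tgt c = T (ob2 a b) \<Longrightarrow> I (ss a b) \<cdot> (iv a \<cdot> (tt a b \<cdot> c)) = zer (src c) (io (T (ob2 a b)))"
proof -
  let ?x = "I (ss a b) \<cdot> (iv a \<cdot> tt a b)"
  have ba: "iv a \<cdot> b = (- 1) \<odot> (I b \<cdot> I (iv a))"
    using square_inv[of a "I b" "(- 1) \<odot> b" "I a"] assms by - (rule neg_eqD, simp_all)
  have "?x = (- 1) \<odot> (I (ss a b) \<cdot> (iv a \<cdot> (b \<cdot> (iv a \<cdot> tt a b))))"
    unfolding b_inv_a_tt[OF assms] using assms by simp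
  also have "iv a \<cdot> (b \<cdot> (iv a \<cdot> tt a b)) = (- 1) \<odot> (I (b \<cdot> iv a) \<cdot> iv a \<cdot> tt a b)"
    using acmp_reassoc[OF ba] assms by simp
  also have "(- 1) \<odot> (I (ss a b) \<cdot> ((- 1) \<odot> (I (b \<cdot> iv a) \<cdot> iv a \<cdot> tt a b)))
      = I (ss a b \<cdot> (b \<cdot> iv a)) \<cdot> iv a \<cdot> tt a b"
    using assms by simp
  also have "\<dots> = (- 1) \<odot> ?x"
    unfolding ss_b_inv_a[OF assms] by simp
  finally have x: "?x = (- 1) \<odot> ?x" .
  show *: "?x = zer (T (ob2 a b)) (io (T (ob2 a b)))"
    using eq_neg_zero[OF x] assms by simp
  show "I (ss a b) \<cdot> (iv a \<cdot> (tt a b \<cdot> c)) = zer (src c) (io (T (ob2 a b)))"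
    if "ok C c" "tgt c = T (ob2 a b)"
    using arg_cong[OF *, of "\<lambda>x. x \<cdot> c"] that assms by simp
qed

text \<open>
  \<open>f \<iota>(e) f\<^sup>-\<^sup>1\<close> is the projection \<open>(1 + u) / 2\<close> onto the other eigenspace.
\<close>

lemma ee_sum:
  assumes "cj2 a b"
  shows "ee a b \<oplus> a \<cdot> I (ee a b) \<cdot> iv a = ide (tgt a)"
proof -
  have "(- 1) \<odot> (a \<cdot> I b \<cdot> I (iv a)) = b \<cdot> (I a \<cdot> I (iv a))"
    using acmp_reassoc[OF cj2D(6)[OF assms]] by simp
  also have "\<dots> = b"
    using assms by (simp add: cancel)
  finally have "a \<cdot> I b \<cdot> I (iv a) = (- 1) \<odot> b"
    using assms by - (rule neg_eqD, simp_all)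
  from acmp_reassoc[OF this[folded acmp_assoc]] have "a \<cdot> I b \<cdot> I (iv a) \<cdot> iv a = (- 1) \<odot> (b \<cdot> iv a)"
    by simp
  then have "a \<cdot> I (ee a b) \<cdot> iv a = half \<odot> (ide (tgt a) \<oplus> b \<cdot> iv a)"
    using assms by (simp add: ee_def)
  then show ?thesis
    using half_average[of "ide (tgt a)" "b \<cdot> iv a"] assms by (simp add: ee_def del: ascl_aadd)
qed

lemma I_tt_ss: "cj2 a b \<Longrightarrow> I (tt a b) \<cdot> (I (ss a b) \<cdot> c) = I (ee a b) \<cdot> c"
  by (intro acmp_reassoc) (simp flip: tt_ss)

lemma aiso_rh [simp]:
  assumes "cj2 a b"
  shows "aiso C (rh a b)"
  using assms
  by (intro aisoI[of _ "j1 (T (ob2 a b)) \<cdot> ss a b \<oplus> j2 (T (ob2 a b)) \<cdot> I (ss a b) \<cdot> iv a"])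
    (simp_all add: rh_def tt_ss I_tt_ss ee_sum ss_a_I_tt I_ss_inv_a_tt cancel jq_sum)

text \<open>
  Thus \<open>rh\<close> is a morphism of \<open>\<C>''\<close>: it carries \<open>\<Lambda>\<close> to \<open>f\<close> and \<open>\<Delta>\<close> to \<open>g\<close>.
\<close>

lemma rh_La:
  assumes "cj2 a b"
  shows "rh a b \<cdot> La 1 (T (ob2 a b)) = a \<cdot> I (rh a b)" "rh a b \<cdot> La (- 1) (T (ob2 a b)) = b \<cdot> I (rh a b)"
  using assms acmp_reassoc[OF cj2D(6)[OF assms]]
  by (simp_all add: rh_def La_def b_I_tt cj_reassoc nats aadd_commute)

lemma rh_nat:
  assumes "cj2 a b" "cj2 c d" "ok C p" "src p = tgt a" "tgt p = tgt c" "p \<cdot> a = c \<cdot> I p" "p \<cdot> b = d \<cdot> I p"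
  shows "rh c d \<cdot> dg (ss c d \<cdot> p \<cdot> tt a b) = p \<cdot> rh a b"
proof -
  have e: "ee c d \<cdot> (p \<cdot> tt a b) = p \<cdot> tt a b"
    using acmp_reassoc[OF ee_nat[OF assms]] assms(1) by simp
  have e': "ee c d \<cdot> (p \<cdot> (tt a b \<cdot> x)) = p \<cdot> (tt a b \<cdot> x)" for x
    using acmp_reassoc[OF e, of x] by simp
  have "I (ee c d) \<cdot> I (p \<cdot> tt a b) = I p \<cdot> I (tt a b)"
    using arg_cong[OF e, of I] assms(1-5) by simp
  from acmp_reassoc[OF this] have Ie: "I (ee c d) \<cdot> (I p \<cdot> (I (tt a b) \<cdot> x)) = I p \<cdot> (I (tt a b) \<cdot> x)" for x
    using assms(1-5) by simp
  show ?thesis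
    using assms(1-5) square_reassoc[OF assms(6)]
    by (simp add: rh_def dg_def tt_ss_reassoc I_tt_ss e e' Ie)
qed

subsection \<open>Compatibility of \<open>\<Theta>\<close> with the dualities\<close>

text \<open>
  The components of \<open>Theta_check\<close> and \<open>Theta_hat\<close>. The aim is that \<open>ps \<cdot> dg thc\<close> and \<open>pk \<cdot> dg thh\<close>, the
  components of \<open>\<Psi>\<Theta>\<close>, arise from the identity by transport along \<open>rh\<close>.
\<close>

definition "thc a b = D (tt a b) \<cdot> D (iv a) \<cdot> al (tgt a) \<cdot> tt (icj (dcj a)) (icj ((- 1) \<odot> dcj b))"
definition "thh a b = (- 1) \<odot> (I (D (tt a b)) \<cdot> iv (al (tgt a)) \<cdot> D a \<cdot> tt (dcj a) ((- 1) \<odot> dcj b))"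

lemma th_typed [simp]:
  "src (thc a b) = T (ob2 (icj (dcj a)) (icj ((- 1) \<odot> dcj b)))" "tgt (thc a b) = dob (T (ob2 a b))"
  "src (thh a b) = T (ob2 (dcj a) ((- 1) \<odot> dcj b))" "tgt (thh a b) = io (dob (T (ob2 a b)))"
  "cj2 a b \<Longrightarrow> ok C (thc a b)" "cj2 a b \<Longrightarrow> ok C (thh a b)"
  by (simp_all add: thc_def thh_def)

lemma Theta_hat_fst [simp]: "fst (Theta_hat K T t s) = Theta_fun K T t s" "fst (Theta_check K T t s) = Theta_fun K T t s"
  by (simp_all add: Theta_hat_def Theta_check_def Let_def)

lemma Theta_snd:
  assumes "cj2 a b" "tgt a = X"
  shows "snd (Theta_check K T t s) ((X, mor a), mor b) = mor (thc a b)"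
    "snd (Theta_hat K T t s) ((X, mor a), mor b) = mor (thh a b)"
proof -
  have X: "X \<in> Obj C" using assms by auto
  show "snd (Theta_check K T t s) ((X, mor a), mor b) = mor (thc a b)"
    "snd (Theta_hat K T t s) ((X, mor a), mor b) = mor (thh a b)"
    using assms X
    by (simp_all add: Theta_check_def Theta_hat_def Let_def mor_tt[of a] mor_tt[of "dcj a"] mor_tt[of "icj (dcj a)"] to_arrow fmor_simps
        thc_def thh_def)
qed

lemma neg_inj: "\<lbrakk>(- 1) \<odot> x = (- 1) \<odot> y; ok C x; ok C y\<rbrakk> \<Longrightarrow> x = y"
  using neg_eqD[of x "(- 1) \<odot> y"] by simp

text \<open>
  The involutions belonging to the two dual objects of \<open>(X, f, g)\<close>. The minus sign means that duality
  exchanges the eigenspaces.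
\<close>

lemma dual_involution:
  assumes "cj2 a b"
  shows "\<lbrakk>ok C y; tgt y = io (dob (tgt a))\<rbrakk> \<Longrightarrow> icj ((- 1) \<odot> dcj b) \<cdot> (iv (icj (dcj a)) \<cdot> y) = (- 1) \<odot> (I (D (iv b)) \<cdot> (I (D a) \<cdot> y))"
    and "\<lbrakk>ok C y; tgt y = dob (tgt a)\<rbrakk> \<Longrightarrow> ((- 1) \<odot> dcj b) \<cdot> (iv (dcj a) \<cdot> y) = (- 1) \<odot> (D (iv b) \<cdot> (D a \<cdot> y))"
  using assms by (simp_all add: icj_def dcj_def cancel)

lemma D_inv_b_D_a_tt:
  assumes "cj2 a b"
  shows "I (D (iv b)) \<cdot> (I (D a) \<cdot> tt (icj (dcj a)) (icj ((- 1) \<odot> dcj b))) = tt (icj (dcj a)) (icj ((- 1) \<odot> dcj b))"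
    "D (iv b) \<cdot> (D a \<cdot> tt (dcj a) ((- 1) \<odot> dcj b)) = tt (dcj a) ((- 1) \<odot> dcj b)"
proof -
  have 3: "cj2 (dcj a) ((- 1) \<odot> dcj b)" and 2: "cj2 (icj (dcj a)) (icj ((- 1) \<odot> dcj b))"
    using assms by simp_all
  let ?t = "tt (icj (dcj a)) (icj ((- 1) \<odot> dcj b))" and ?u = "tt (dcj a) ((- 1) \<odot> dcj b)"
  have "(- 1) \<odot> (I (D (iv b)) \<cdot> (I (D a) \<cdot> ?t)) = (- 1) \<odot> ?t"
    unfolding b_inv_a_tt[OF 2, symmetric] using 2 by (subst dual_involution(1)[OF assms]) simp_all
  then show "I (D (iv b)) \<cdot> (I (D a) \<cdot> ?t) = ?t"
    by (rule neg_inj) (use assms 2 in simp_all)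
  have "(- 1) \<odot> (D (iv b) \<cdot> (D a \<cdot> ?u)) = (- 1) \<odot> ?u"
    unfolding b_inv_a_tt[OF 3, symmetric] using 3 by (subst dual_involution(2)[OF assms]) simp_all
  then show "D (iv b) \<cdot> (D a \<cdot> ?u) = ?u"
    by (rule neg_inj) (use assms 3 in simp_all)
qed

text \<open>
  The arrow \<open>D(t)\<close> belongs to the eigenvalue \<open>-1\<close> of \<open>D(g\<^sup>-\<^sup>1) D(f)\<close>, the splitting of the dual object to
  the eigenvalue \<open>1\<close>.
\<close>

lemma D_tt_tt:
  assumes "cj2 a b"
  shows "I (D (tt a b)) \<cdot> tt (icj (dcj a)) (icj ((- 1) \<odot> dcj b)) = zer (T (ob2 (icj (dcj a)) (icj ((- 1) \<odot> dcj b)))) (io (dob (T (ob2 a b))))"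
    "D (tt a b) \<cdot> tt (dcj a) ((- 1) \<odot> dcj b) = zer (T (ob2 (dcj a) ((- 1) \<odot> dcj b))) (dob (T (ob2 a b)))"
proof -
  let ?t = "tt (icj (dcj a)) (icj ((- 1) \<odot> dcj b))" and ?u = "tt (dcj a) ((- 1) \<odot> dcj b)"
  have 3: "cj2 (dcj a) ((- 1) \<odot> dcj b)" and 2: "cj2 (icj (dcj a)) (icj ((- 1) \<odot> dcj b))"
    using assms by simp_all
  have D: "D (tt a b) \<cdot> (D (iv b) \<cdot> D a) = (- 1) \<odot> D (tt a b)"
    using arg_cong[OF a_inv_b_tt[OF assms], of D] assms by simp
  have ID: "I (D (tt a b)) \<cdot> (I (D (iv b)) \<cdot> I (D a)) = (- 1) \<odot> I (D (tt a b))"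
    using arg_cong[OF D, of I] assms by simp
  have "I (D (tt a b)) \<cdot> ?t = I (D (tt a b)) \<cdot> (I (D (iv b)) \<cdot> (I (D a) \<cdot> ?t))"
    by (simp only: D_inv_b_D_a_tt(1)[OF assms])
  also have "\<dots> = (- 1) \<odot> (I (D (tt a b)) \<cdot> ?t)"
    using acmp_reassoc[OF ID, of ?t] by simp
  finally have x: "I (D (tt a b)) \<cdot> ?t = (- 1) \<odot> (I (D (tt a b)) \<cdot> ?t)" .
  have "D (tt a b) \<cdot> ?u = D (tt a b) \<cdot> (D (iv b) \<cdot> (D a \<cdot> ?u))"
    by (simp only: D_inv_b_D_a_tt(2)[OF assms])
  also have "\<dots> = (- 1) \<odot> (D (tt a b) \<cdot> ?u)"
    using acmp_reassoc[OF D, of ?u] by simp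
  finally have y: "D (tt a b) \<cdot> ?u = (- 1) \<odot> (D (tt a b) \<cdot> ?u)" .
  show "I (D (tt a b)) \<cdot> ?t = zer (T (ob2 (icj (dcj a)) (icj ((- 1) \<odot> dcj b)))) (io (dob (T (ob2 a b))))"
    "D (tt a b) \<cdot> ?u = zer (T (ob2 (dcj a) ((- 1) \<odot> dcj b))) (dob (T (ob2 a b)))"
    using eq_neg_zero[OF x] eq_neg_zero[OF y] assms 2 3 by simp_all
qed

text \<open>
  Both equations restate \<open>dcj a \<cdot> I (dcj a) = \<lambda>\<close>, the condition for \<open>ob (dcj a)\<close> to be an object of \<open>\<C>'\<close>.
\<close>

lemma dcj_inverse:
  assumes "cj a"
  shows "iv (lm (dob (tgt a))) \<cdot> (D (iv a) \<cdot> (al (tgt a) \<cdot> c)) = I (iv (al (tgt a))) \<cdot> (I (D a) \<cdot> c)"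
    "lm (dob (tgt a)) \<cdot> (I (iv (al (tgt a))) \<cdot> (I (D a) \<cdot> c)) = D (iv a) \<cdot> (al (tgt a) \<cdot> c)"
proof -
  let ?X = "tgt a"
  have k: "(D (iv a) \<cdot> al ?X) \<cdot> I (D (iv a) \<cdot> al ?X) = lm (dob ?X)"
    using cjD(4)[OF cj_dcj[OF assms]] assms by (simp add: dcj_def)
  have "lm (dob ?X) \<cdot> ide (io (io (dob ?X))) = (D (iv a) \<cdot> al ?X) \<cdot> I (D (iv a) \<cdot> al ?X)"
    unfolding k using assms by simp
  from square_inv[OF this] have 1: "iv (lm (dob ?X)) \<cdot> (D (iv a) \<cdot> al ?X) = I (iv (al ?X)) \<cdot> I (D a)"
    using assms by simp
  from acmp_reassoc[OF this, of c]
  show 2: "iv (lm (dob ?X)) \<cdot> (D (iv a) \<cdot> (al ?X \<cdot> c)) = I (iv (al ?X)) \<cdot> (I (D a) \<cdot> c)"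
    by simp
  have "lm (dob ?X) \<cdot> (I (iv (al ?X)) \<cdot> I (D a)) = D (iv a) \<cdot> al ?X"
    unfolding 1[symmetric] using assms by simp
  from acmp_reassoc[OF this, of c]
  show "lm (dob ?X) \<cdot> (I (iv (al ?X)) \<cdot> (I (D a) \<cdot> c)) = D (iv a) \<cdot> (al ?X \<cdot> c)"
    by simp
qed

text \<open>
  The matrix product has four entries, of which two contain \<open>\<iota>D(t) y\<close> or its image under \<open>\<iota>\<close> and vanish. The other two
  form the matrix of \<open>ps\<close> times the diagonal matrix of the component of \<open>\<Theta>\<close>.
\<close>

lemma ps_dg:
  assumes "cj2 a b" and y: "ok C y" "tgt y = io (dob (tgt a))" "I (D (tt a b)) \<cdot> y = zer (src y) (io (dob (T (ob2 a b))))"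
  shows "I (D (rh a b)) \<cdot> (y \<cdot> q1 (src y) \<oplus> icj (dcj a) \<cdot> I y \<cdot> q2 (src y))
    = ps (T (ob2 a b)) \<cdot> dg (D (tt a b) \<cdot> D (iv a) \<cdot> al (tgt a) \<cdot> y)"
proof -
  let ?X = "tgt a" and ?T = "T (ob2 a b)"
  have z1: "I (D (tt a b)) \<cdot> (y \<cdot> c) = zer (src c) (io (dob ?T))" if "ok C c" "tgt c = src y" for c
    using acmp_reassoc[OF y(3), of c] that assms by simp
  have "I (I (D (tt a b))) \<cdot> I y = zer (io (src y)) (io (io (dob ?T)))"
    using assms by (simp add: vanish)
  then have z2: "I (D (I (tt a b))) \<cdot> (I (al ?X) \<cdot> (I y \<cdot> c)) = zer (src c) (io (dob (io ?T)))"
    if "ok C c" "tgt c = io (src y)" for c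
    using acmp_reassoc[of "I (I (D (tt a b)))" "I y" _ c] I_al_nat(2)[of "tt a b" ?T "I y \<cdot> c"] that assms by simp
  have "iv (lm (dob ?T)) \<cdot> (D (tt a b) \<cdot> (D (iv a) \<cdot> (al ?X \<cdot> c)))
      = I (I (D (tt a b))) \<cdot> (I (iv (al ?X)) \<cdot> (I (D a) \<cdot> c))" for c
    using inv_lm_nat(2)[of "D (tt a b)" "dob ?T" "D (iv a) \<cdot> (al ?X \<cdot> c)"] dcj_inverse[of a c] assms by simp
  then show ?thesis
    using assms
    by (simp add: rh_def ps_def dg_def icj_def dcj_def z1 z2 cancel nats aadd_commute)
qed

lemma pk_dg:
  assumes "cj2 a b" and y: "ok C y" "tgt y = dob (tgt a)" "D (tt a b) \<cdot> y = zer (src y) (dob (T (ob2 a b)))"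
  shows "D (rh a b) \<cdot> (y \<cdot> q1 (src y) \<oplus> dcj a \<cdot> I y \<cdot> q2 (src y))
    = pk (T (ob2 a b)) \<cdot> dg ((- 1) \<odot> (I (D (tt a b)) \<cdot> iv (al (tgt a)) \<cdot> D a \<cdot> y))"
proof -
  let ?X = "tgt a" and ?T = "T (ob2 a b)"
  have z1: "D (tt a b) \<cdot> (y \<cdot> c) = zer (src c) (dob ?T)" if "ok C c" "tgt c = src y" for c
    using acmp_reassoc[OF y(3), of c] that assms by simp
  have "I (D (tt a b)) \<cdot> I y = zer (io (src y)) (io (dob ?T))"
    using assms by (simp add: vanish)
  then have z2: "D (I (tt a b)) \<cdot> (al ?X \<cdot> (I y \<cdot> c)) = zer (src c) (dob (io ?T))"
    if "ok C c" "tgt c = io (src y)" for c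
    using acmp_reassoc[of "I (D (tt a b))" "I y" _ c] al_nat(2)[of "tt a b" ?T "I y \<cdot> c"] that assms by simp
  have "lm (dob ?T) \<cdot> (I (I (D (tt a b))) \<cdot> (I (iv (al ?X)) \<cdot> (I (D a) \<cdot> c)))
      = D (tt a b) \<cdot> (D (iv a) \<cdot> (al ?X \<cdot> c))" for c
    using lm_nat(2)[of "D (tt a b)" "dob ?T"] dcj_inverse[of a c] assms by simp
  then show ?thesis
    using assms
    by (simp add: rh_def pk_def dg_def dcj_def z1 z2 cancel al_nat aadd_commute)
qed

lemma ps_thc:
  assumes "cj2 a b"
  shows "I (D (rh a b)) \<cdot> rh (icj (dcj a)) (icj ((- 1) \<odot> dcj b)) = ps (T (ob2 a b)) \<cdot> dg (thc a b)"
  using ps_dg[OF assms, of "tt (icj (dcj a)) (icj ((- 1) \<odot> dcj b))"] D_tt_tt(1)[OF assms] assms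
  unfolding thc_def rh_def[of "icj (dcj a)"] by simp

lemma pk_thh:
  assumes "cj2 a b"
  shows "D (rh a b) \<cdot> rh (dcj a) ((- 1) \<odot> dcj b) = pk (T (ob2 a b)) \<cdot> dg (thh a b)"
  using pk_dg[OF assms, of "tt (dcj a) ((- 1) \<odot> dcj b)"] D_tt_tt(2)[OF assms] assms
  unfolding thh_def rh_def[of "dcj a"] by simp

text \<open>
  The functor \<open>\<Psi>\<close> reflects isomorphisms. By \<open>ps_thc\<close> and \<open>pk_thh\<close>, the images of \<open>thc\<close> and \<open>thh\<close> are products
  of isomorphisms.
\<close>

lemma aiso_dg:
  assumes "ok C x" "aiso C (dg x)"
  shows "aiso C x"
proof (rule aisoI)
  let ?y = "q1 (src x) \<cdot> iv (dg x) \<cdot> j1 (tgt x)"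
  have 1: "dg x \<cdot> j1 (src x) = j1 (tgt x) \<cdot> x" and 2: "x \<cdot> q1 (src x) = q1 (tgt x) \<cdot> dg x"
    using assms(1) by (simp_all add: dg_def)
  have "iv (dg x) \<cdot> (j1 (tgt x) \<cdot> x) = j1 (src x)"
    unfolding 1[symmetric] using assms by simp
  then show "?y \<cdot> x = ide (src x)"
    using assms by simp
  show "x \<cdot> ?y = ide (tgt x)"
    using acmp_reassoc[OF 2] assms by simp
qed (use assms in simp_all)

lemma aiso_th [simp]:
  assumes "cj2 a b"
  shows "aiso C (thc a b)" "aiso C (thh a b)"
proof -
  let ?T = "T (ob2 a b)"
  have "dg (thc a b) = iv (ps ?T) \<cdot> I (D (rh a b)) \<cdot> rh (icj (dcj a)) (icj ((- 1) \<odot> dcj b))"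
    unfolding ps_thc[OF assms] using assms by simp
  then show "aiso C (thc a b)"
    using assms by - (rule aiso_dg, simp_all)
  have "dg (thh a b) = iv (pk ?T) \<cdot> D (rh a b) \<cdot> rh (dcj a) ((- 1) \<odot> dcj b)"
    unfolding pk_thh[OF assms] using assms by simp
  then show "aiso C (thh a b)"
    using assms by - (rule aiso_dg, simp_all)
qed

end

lemma id_dmor_simps [simp]: "fst (id_dmor \<A>) = idf" "snd (id_dmor \<A>) X = Idn (fst \<A>) (fob (fst (snd \<A>)) X)"
  by (cases \<A>; simp add: id_dmor_def)+

context conj_dual_split
begin

definition "rho P = (case P of ((X, f), g) \<Rightarrow> mor (rh (arw (io X) X f) (arw (io X) X g)))"

lemma rho:
  assumes "cj2 a b" "tgt a = X"
  shows "rho ((X, mor a), mor b) = mor (rh a b)"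
proof -
  have "arw (io X) X (mor a) = a" "arw (io X) X (mor b) = b"
    using assms by (auto intro!: arr_eqI)
  then show ?thesis by (simp add: rho_def)
qed

lemma rh_nat_dg:
  assumes "cj2 a b" "cj2 c d" "ok C p" "src p = tgt a" "tgt p = tgt c" "p \<cdot> a = c \<cdot> I p" "p \<cdot> b = d \<cdot> I p"
  shows "rh c d \<cdot> dg (ss c d) \<cdot> dg p \<cdot> dg (tt a b) = p \<cdot> rh a b"
  using rh_nat[OF assms] assms(1-5) by simp

lemma rho_nat_iso: "nat_iso_cov C'' C'' (comp_cov (Psi_fun K B) (Theta_fun K T t s)) idf rho"
  unfolding nat_iso_cov_def
  by (auto elim!: Obj_double2E Hom_double2E intro!: double2_isoI
      simp: Theta_simps Psi_simps rho fmor_simps double2_simps to_arrow rh_La rh_nat_dg)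

lemma Psi_Theta_functor: "covariant_functor C'' C'' (comp_cov (Psi_fun K B) (Theta_fun K T t s))"
proof -
  interpret K'': conj_dual "double (double K)" by (rule conj_dual_double2)
  interpret Theta: cov_functor C'' C "Theta_fun K T t s"
    by unfold_locales (rule Theta_functor)
  interpret Psi: cov_functor C C'' "Psi_fun K B"
    by unfold_locales (rule Psi_functor)
  interpret comp: cov_functor C'' C'' "comp_cov (Psi_fun K B) (Theta_fun K T t s)"
    by (rule comp_cov_functor) unfold_locales
  show ?thesis by (rule comp.is_functor)
qed

text \<open>
  Transport of the identity along \<open>rho : \<Psi>\<Theta> \<cong> 1\<close> gives a morphism of categories with duality, and by
  \<open>ps_thc\<close> and \<open>pk_thh\<close> its components are those of the composite of \<open>Psi_hat\<close> with \<open>Theta_check\<close>, respectively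
  of \<open>Psi_check\<close> with \<open>Theta_hat\<close>. As \<open>\<Psi>\<close> is faithful, \<open>Theta_check\<close> and \<open>Theta_hat\<close> are morphisms themselves.
\<close>

lemma Psi_Theta:
  assumes "\<epsilon> * \<epsilon> = 1"
  defines "\<A> \<equiv> signed \<epsilon> (dualD K)" and "\<B> \<equiv> signed \<epsilon> (dualID (double (double K)))"
    and "\<A>' \<equiv> signed \<epsilon> (dualID K)" and "\<B>' \<equiv> signed (- \<epsilon>) (dualD (double (double K)))"
  shows Theta_check_signed: "dmorphism \<B> \<A> (Theta_check K T t s)"
    and Psi_Theta_check: "disomorphic \<B> \<B> (dcomp \<B> \<A> \<B> (Psi_hat K B) (Theta_check K T t s)) (id_dmor \<B>)"
    and Theta_hat_signed: "dmorphism \<B>' \<A>' (Theta_hat K T t s)"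
    and Psi_Theta_hat: "disomorphic \<B>' \<B>' (dcomp \<B>' \<A>' \<B>' (Psi_check K B) (Theta_hat K T t s)) (id_dmor \<B>')"
proof -
  interpret K'': conj_dual "double (double K)" by (rule conj_dual_double2)
  let ?P = "dcomp \<B> \<A> \<B> (Psi_hat K B) (Theta_check K T t s)"
    and ?P' = "dcomp \<B>' \<A>' \<B>' (Psi_check K B) (Theta_hat K T t s)"
  have [simp]: "fst \<A> = C" "fst \<B> = C''" "fst \<A>' = C" "fst \<B>' = C''" "fst (snd \<A>) = dua K" "fst (snd \<A>') = ID"
      "fst (snd \<B>) = K''.ID" "fst (snd \<B>') = dua (double (double K))"
    by (simp_all add: \<A>_def \<B>_def \<A>'_def \<B>'_def)
  have e: "- \<epsilon> * - \<epsilon> = 1" using assms(1) by simp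
  have cB: "category_with_duality \<B>" and cB': "category_with_duality \<B>'"
    using K''.category_with_duality_D K''.category_with_duality_ID assms(1) e
    unfolding \<B>_def \<B>'_def dualD_def dualID_double2 by (intro dual_category_signed; simp)+
  note idB = dmorphism_id[OF cB] and idB' = dmorphism_id[OF cB']
  note P = Psi_hat_signed[OF assms(1), folded \<A>_def \<B>_def]
    and P' = Psi_check_signed[OF assms(1), folded \<A>'_def \<B>'_def]
  have 1: "fmor (fst (snd \<B>)) (fob (fst ?P) Q) (fob (fst (id_dmor \<B>)) Q) (rho Q)
      \<cdot>\<^bsub>fst \<B>\<^esub> snd (id_dmor \<B>) Q \<cdot>\<^bsub>fst \<B>\<^esub> rho (fob (fst (snd \<B>)) Q) = snd ?P Q" if "Q \<in> Obj C''" for Q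
    using that
    by (auto elim!: Obj_double2E simp: dcomp_simps Theta_simps Psi_simps rho fmor_simps double2_simps to_arrow Theta_snd mor_ps ps_thc)
  have 2: "fmor (fst (snd \<B>')) (fob (fst ?P') Q) (fob (fst (id_dmor \<B>')) Q) (rho Q)
      \<cdot>\<^bsub>fst \<B>'\<^esub> snd (id_dmor \<B>') Q \<cdot>\<^bsub>fst \<B>'\<^esub> rho (fob (fst (snd \<B>')) Q) = snd ?P' Q" if "Q \<in> Obj C''" for Q
    using that
    by (auto elim!: Obj_double2E simp: dcomp_simps Theta_simps Psi_simps rho fmor_simps double2_simps to_arrow Theta_snd mor_pk pk_thh)
  have PT: "dmorphism \<B> \<B> ?P"
    by (rule dmorphism_transportI[OF idB _ _ 1]) (simp_all add: dcomp_simps Psi_Theta_functor rho_nat_iso)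
  have PT': "dmorphism \<B>' \<B>' ?P'"
    by (rule dmorphism_transportI[OF idB' _ _ 2]) (simp_all add: dcomp_simps Psi_Theta_functor rho_nat_iso)
  show "dmorphism \<B> \<A> (Theta_check K T t s)"
    by (rule dmorphism_reflectI[OF P PT])
      (auto elim!: Obj_double2E simp: Theta_functor Theta_simps Theta_snd isom_mor intro: Psi_faithful)
  show "dmorphism \<B>' \<A>' (Theta_hat K T t s)"
    by (rule dmorphism_reflectI[OF P' PT'])
      (auto elim!: Obj_double2E simp: Theta_functor Theta_simps Theta_snd isom_mor intro: Psi_faithful)
  have one: "1 \<odot>\<^bsub>C''\<^esub> snd ?P Q = snd ?P Q" "1 \<odot>\<^bsub>C''\<^esub> snd ?P' Q = snd ?P' Q" if "Q \<in> Obj C''" for Q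
    using that
    by (auto elim!: Obj_double2E simp: dcomp_simps Theta_simps Psi_simps fmor_simps double2_simps to_arrow Theta_snd mor_ps mor_pk)
  show "disomorphic \<B> \<B> ?P (id_dmor \<B>)"
    unfolding disomorphic_def
    by (rule similar_viaI[OF PT idB]) (use rho_nat_iso 1 one in \<open>simp_all add: dcomp_simps\<close>)
  show "disomorphic \<B>' \<B>' ?P' (id_dmor \<B>')"
    unfolding disomorphic_def
    by (rule similar_viaI[OF PT' idB']) (use rho_nat_iso 2 one in \<open>simp_all add: dcomp_simps\<close>)
qed

subsection \<open>The isomorphism \<open>\<Theta>\<Psi> \<cong> 1\<close>\<close>

abbreviation "lt X \<equiv> tt (La 1 X) (La (- 1) X)"
abbreviation "ls X \<equiv> ss (La 1 X) (La (- 1) X)"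

lemma T_in [simp]: "\<lbrakk>cj2 a b; tgt a = X\<rbrakk> \<Longrightarrow> T ((X, mor a), mor b) \<in> Obj C"
  using split(1) by auto

text \<open>
  For \<open>\<Psi>(X)\<close> the involution \<open>\<Delta> \<Lambda>\<^sup>-\<^sup>1\<close> is diagonal with entries \<open>-1\<close> and \<open>1\<close>, so its \<open>-1\<close>-eigenspace is the first
  summand \<open>X\<close>.
\<close>

lemma ee_La: "X \<in> Obj C \<Longrightarrow> ee (La 1 X) (La (- 1) X) = j1 X \<cdot> q1 X"
proof -
  assume X: "X \<in> Obj C"
  then have "La (- 1) X \<cdot> iv (La 1 X) = j2 X \<cdot> q2 X \<oplus> (- 1) \<odot> (j1 X \<cdot> q1 X)"
    by (simp add: La_def[of "- 1"] Li_def cancel vanish aadd_commute)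
  moreover have "ide (S X) \<oplus> (- 1) \<odot> (j2 X \<cdot> q2 X \<oplus> (- 1) \<odot> (j1 X \<cdot> q1 X)) = j1 X \<cdot> q1 X \<oplus> j1 X \<cdot> q1 X"
    unfolding jq_sum(3)[OF X, symmetric] using X
    by (simp add: aadd_ac)
  ultimately have "ee (La 1 X) (La (- 1) X) = half \<odot> (j1 X \<cdot> q1 X \<oplus> j1 X \<cdot> q1 X)"
    using X by (simp add: ee_def del: ascl_aadd)
  then show ?thesis
    using half_twice[of "j1 X \<cdot> q1 X"] X by simp
qed

lemma lt_simps:
  assumes "X \<in> Obj C"
  shows "j1 X \<cdot> (q1 X \<cdot> lt X) = lt X" "q2 X \<cdot> lt X = zer (T (ob2 (La 1 X) (La (- 1) X))) (io X)"
proof -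
  show 1: "j1 X \<cdot> (q1 X \<cdot> lt X) = lt X"
    using ee_tt(1)[OF cj2_La[OF assms]] assms by (simp add: ee_La)
  have "q2 X \<cdot> lt X = q2 X \<cdot> (j1 X \<cdot> (q1 X \<cdot> lt X))"
    by (simp only: 1)
  then show "q2 X \<cdot> lt X = zer (T (ob2 (La 1 X) (La (- 1) X))) (io X)"
    using assms by simp
qed

lemma aiso_q1_lt [simp]:
  assumes "X \<in> Obj C"
  shows "aiso C (q1 X \<cdot> lt X)"
proof (rule aisoI)
  have "lt X \<cdot> ls X = j1 X \<cdot> q1 X"
    using tt_ss[OF cj2_La[OF assms]] assms by (simp add: ee_La)
  then show "(q1 X \<cdot> lt X) \<cdot> (ls X \<cdot> j1 X) = ide (tgt (q1 X \<cdot> lt X))"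
    using acmp_reassoc[of "lt X" "ls X" _ "j1 X"] assms by simp
  show "(ls X \<cdot> j1 X) \<cdot> (q1 X \<cdot> lt X) = ide (src (q1 X \<cdot> lt X))"
    using assms by (simp add: lt_simps)
qed (use assms in simp_all)

lemma q1_lt_nat_iso: "nat_iso_cov C C (comp_cov (Theta_fun K T t s) (Psi_fun K B)) idf (\<lambda>X. mor (q1 X \<cdot> lt X))"
  unfolding nat_iso_cov_def
proof (intro conjI ballI)
  fix X Y m assume X: "X \<in> Obj C" and Y: "Y \<in> Obj C" and m: "m \<in> Hom C X Y"
  obtain a where a: "m = mor a" "ok C a" "src a = X" "tgt a = Y"
    using arr_cases[OF m X Y] .
  have "q1 Y \<cdot> lt Y \<cdot> ls Y \<cdot> dg a \<cdot> lt X = a \<cdot> q1 X \<cdot> lt X"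
    using Y X a by (simp add: tt_ss_reassoc ee_La dg_def lt_simps)
  then show "mor (q1 Y \<cdot> lt Y) \<cdot>\<^bsub>C\<^esub> fmor (comp_cov (Theta_fun K T t s) (Psi_fun K B)) X Y m
      = fmor idf X Y m \<cdot>\<^bsub>C\<^esub> mor (q1 X \<cdot> lt X)"
    using X Y a by (simp add: Theta_simps Psi_simps fmor_simps to_arrow dg_La)
qed (simp add: Psi_simps Theta_simps isom_mor)

text \<open>
  The idempotent \<open>t s\<close> of the dual object commutes with \<open>ps\<close>, since \<open>ps\<close> is a morphism of \<open>\<C>''\<close>, and is absorbed by
  \<open>lt (dob X)\<close>; as \<open>q2 \<cdot> lt = 0\<close>, of the remaining matrix only the entry \<open>1\<close> on the first summand survives.
\<close>

lemma thc_La: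
  assumes "X \<in> Obj C"
  shows "thc (La 1 X) (La (- 1) X) \<cdot> ss (icj (dcj (La 1 X))) (icj ((- 1) \<odot> dcj (La (- 1) X))) \<cdot> ps X \<cdot> lt (dob X)
    = D (q1 X \<cdot> lt X) \<cdot> q1 (dob X) \<cdot> lt (dob X)"
proof -
  let ?a = "icj (dcj (La 1 X))" and ?b = "icj ((- 1) \<odot> dcj (La (- 1) X))"
  have 2: "cj2 ?a ?b" using assms by simp
  have "ee ?a ?b \<cdot> ps X = ps X \<cdot> ee (La 1 (dob X)) (La (- 1) (dob X))"
    using assms ps_La[of X 1] ps_La[of X "- 1"] by (intro ee_nat 2) (simp_all add: icj_ascl del: cj2_dcj)
  from acmp_reassoc[OF this, of "lt (dob X)"] have e: "ee ?a ?b \<cdot> (ps X \<cdot> lt (dob X)) = ps X \<cdot> lt (dob X)"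
    using assms by simp
  have "thc (La 1 X) (La (- 1) X) \<cdot> ss ?a ?b \<cdot> ps X \<cdot> lt (dob X)
    = D (lt X) \<cdot> D (Li 1 X) \<cdot> al (S X) \<cdot> (ee ?a ?b \<cdot> (ps X \<cdot> lt (dob X)))"
    using assms by (simp add: thc_def tt_ss_reassoc[OF 2])
  also have "\<dots> = D (lt X) \<cdot> (D (Li 1 X) \<cdot> al (S X) \<cdot> ps X) \<cdot> lt (dob X)"
    unfolding e by simp
  also have "D (Li 1 X) \<cdot> al (S X) \<cdot> ps X = D (q1 X) \<cdot> q1 (dob X) \<oplus> D (q2 X) \<cdot> al X \<cdot> q2 (dob X)"
    using assms by (simp add: ps_def Li_def nats cancel vanish D_inv_lm_al aadd_commute)
  also have "D (lt X) \<cdot> (D (q1 X) \<cdot> q1 (dob X) \<oplus> D (q2 X) \<cdot> al X \<cdot> q2 (dob X)) \<cdot> lt (dob X)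
      = D (q1 X \<cdot> lt X) \<cdot> q1 (dob X) \<cdot> lt (dob X)"
    using assms by (simp add: lt_simps)
  finally show ?thesis .
qed

lemma thh_La:
  assumes "X \<in> Obj C"
  shows "thh (La 1 X) (La (- 1) X) \<cdot> ss (dcj (La 1 X)) ((- 1) \<odot> dcj (La (- 1) X)) \<cdot> pk X \<cdot> lt (io (dob X))
    = I (D (q1 X \<cdot> lt X)) \<cdot> q1 (io (dob X)) \<cdot> lt (io (dob X))"
proof -
  let ?a = "dcj (La 1 X)" and ?b = "(- 1) \<odot> dcj (La (- 1) X)" and ?Y = "io (dob X)"
  have 2: "cj2 ?a ?b" using assms by simp
  have "ee ?a ?b \<cdot> pk X = pk X \<cdot> ee (La 1 ?Y) (La (- 1) ?Y)"
    using assms pk_La[of X 1] pk_La[of X "- 1"] by (intro ee_nat 2) simp_all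
  from acmp_reassoc[OF this, of "lt ?Y"] have e: "ee ?a ?b \<cdot> (pk X \<cdot> lt ?Y) = pk X \<cdot> lt ?Y"
    using assms by simp
  have "thh (La 1 X) (La (- 1) X) \<cdot> ss ?a ?b \<cdot> pk X \<cdot> lt ?Y
    = (- 1) \<odot> (I (D (lt X)) \<cdot> iv (al (S X)) \<cdot> D (La 1 X) \<cdot> (ee ?a ?b \<cdot> (pk X \<cdot> lt ?Y)))"
    using assms by (simp add: thh_def tt_ss_reassoc[OF 2])
  also have "\<dots> = (- 1) \<odot> (I (D (lt X)) \<cdot> (iv (al (S X)) \<cdot> D (La 1 X) \<cdot> pk X) \<cdot> lt ?Y)"
    unfolding e by simp
  also have "iv (al (S X)) \<cdot> D (La 1 X) \<cdot> pk X = I (D (q2 X)) \<cdot> I (al X) \<cdot> q2 ?Y \<oplus> (- 1) \<odot> (I (D (q1 X)) \<cdot> q1 ?Y)"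
    using assms by (simp add: pk_def La_def nats cancel vanish inv_al_lm aadd_commute)
  also have "(- 1) \<odot> (I (D (lt X)) \<cdot> (I (D (q2 X)) \<cdot> I (al X) \<cdot> q2 ?Y \<oplus> (- 1) \<odot> (I (D (q1 X)) \<cdot> q1 ?Y)) \<cdot> lt ?Y)
      = I (D (q1 X \<cdot> lt X)) \<cdot> q1 ?Y \<cdot> lt ?Y"
    using assms by (simp add: lt_simps)
  finally show ?thesis .
qed

lemma Theta_Psi:
  assumes "\<epsilon> * \<epsilon> = 1"
  defines "\<A> \<equiv> signed \<epsilon> (dualD K)" and "\<B> \<equiv> signed \<epsilon> (dualID (double (double K)))"
    and "\<A>' \<equiv> signed \<epsilon> (dualID K)" and "\<B>' \<equiv> signed (- \<epsilon>) (dualD (double (double K)))"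
  shows Theta_Psi_check: "disomorphic \<A> \<A> (dcomp \<A> \<B> \<A> (Theta_check K T t s) (Psi_hat K B)) (id_dmor \<A>)"
    and Theta_Psi_hat: "disomorphic \<A>' \<A>' (dcomp \<A>' \<B>' \<A>' (Theta_hat K T t s) (Psi_check K B)) (id_dmor \<A>')"
proof -
  interpret K'': conj_dual "double (double K)" by (rule conj_dual_double2)
  let ?P = "dcomp \<A> \<B> \<A> (Theta_check K T t s) (Psi_hat K B)"
    and ?P' = "dcomp \<A>' \<B>' \<A>' (Theta_hat K T t s) (Psi_check K B)"
  have [simp]: "fst \<A> = C" "fst \<B> = C''" "fst \<A>' = C" "fst \<B>' = C''" "fst (snd \<A>) = dua K" "fst (snd \<A>') = ID"
      "fst (snd \<B>) = K''.ID" "fst (snd \<B>') = dua (double (double K))"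
    by (simp_all add: \<A>_def \<B>_def \<A>'_def \<B>'_def)
  have cA: "category_with_duality \<A>" and cA': "category_with_duality \<A>'"
    using category_with_duality_D category_with_duality_ID assms(1)
    unfolding \<A>_def \<A>'_def dualD_def dualID_eq by (intro dual_category_signed; simp)+
  note idA = dmorphism_id[OF cA] and idA' = dmorphism_id[OF cA']
  have dm: "dmorphism \<A> \<A> ?P" "dmorphism \<A>' \<A>' ?P'"
    unfolding \<A>_def \<B>_def \<A>'_def \<B>'_def
    by (rule dmorphism_dcomp[OF Psi_hat_signed[OF assms(1)] Theta_check_signed[OF assms(1)]])
      (rule dmorphism_dcomp[OF Psi_check_signed[OF assms(1)] Theta_hat_signed[OF assms(1)]])
  have sq: "ps X \<cdot> La 1 (dob X) = icj (dcj (La 1 X)) \<cdot> I (ps X)"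
    "ps X \<cdot> La (- 1) (dob X) = icj ((- 1) \<odot> dcj (La (- 1) X)) \<cdot> I (ps X)"
    "pk X \<cdot> La 1 (io (dob X)) = dcj (La 1 X) \<cdot> I (pk X)"
    "pk X \<cdot> La (- 1) (io (dob X)) = ((- 1) \<odot> dcj (La (- 1) X)) \<cdot> I (pk X)" if "X \<in> Obj C" for X
    using that ps_La[of X 1] ps_La[of X "- 1"] pk_La[of X 1] pk_La[of X "- 1"] by (simp_all add: icj_ascl)
  have 1: "fmor (fst (snd \<A>)) (fob (fst ?P) X) (fob (fst (id_dmor \<A>)) X) (mor (q1 X \<cdot> lt X))
      \<cdot>\<^bsub>fst \<A>\<^esub> snd (id_dmor \<A>) X \<cdot>\<^bsub>fst \<A>\<^esub> mor (q1 (fob (fst (snd \<A>)) X) \<cdot> lt (fob (fst (snd \<A>)) X))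
      = 1 \<odot>\<^bsub>fst \<A>\<^esub> snd ?P X" if "X \<in> Obj C" for X
    using that thc_La[OF that] sq[OF that]
    by (simp add: dcomp_simps Theta_simps Psi_simps fmor_simps to_arrow Theta_snd mor_ps)
  have 2: "fmor (fst (snd \<A>')) (fob (fst ?P') X) (fob (fst (id_dmor \<A>')) X) (mor (q1 X \<cdot> lt X))
      \<cdot>\<^bsub>fst \<A>'\<^esub> snd (id_dmor \<A>') X \<cdot>\<^bsub>fst \<A>'\<^esub> mor (q1 (fob (fst (snd \<A>')) X) \<cdot> lt (fob (fst (snd \<A>')) X))
      = 1 \<odot>\<^bsub>fst \<A>'\<^esub> snd ?P' X" if "X \<in> Obj C" for X
    using that thh_La[OF that] sq[OF that]
    by (simp add: dcomp_simps Theta_simps Psi_simps fmor_simps to_arrow Theta_snd mor_pk)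
  show "disomorphic \<A> \<A> ?P (id_dmor \<A>)"
    unfolding disomorphic_def
    by (rule similar_viaI[OF dm(1) idA _ 1]) (use q1_lt_nat_iso in \<open>simp_all add: dcomp_simps\<close>)
  show "disomorphic \<A>' \<A>' ?P' (id_dmor \<A>')"
    unfolding disomorphic_def
    by (rule similar_viaI[OF dm(2) idA' _ 2]) (use q1_lt_nat_iso in \<open>simp_all add: dcomp_simps\<close>)
qed

end

section \<open>\<open>\<Theta>\<close> applied to the doubles of objects of \<open>\<C>'\<close>\<close>

lemma dmorphism_in_Hom:
  assumes "dmorphism \<A> \<B> P" "X \<in> Obj (fst \<A>)"
  shows "snd P X \<in> Hom (fst \<B>) (fob (fst P) (fob (fst (snd \<A>)) X)) (fob (fst (snd \<B>)) (fob (fst P) X))"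
  using assms by (cases \<A>; cases \<B>; cases P) (auto simp: nat_iso_con_def isom_def)

locale conj_dual_double_sums = conj_dual_split K B half T t s
  for K :: "('o, 'm, 'k::{comm_ring, comm_monoid_mult}) cdcat" and B half T t s +
  fixes B' :: "'o \<times> 'm \<Rightarrow> 'o \<times> 'm \<Rightarrow> ('o \<times> 'm, 'm) bip"
  assumes B': "direct_sums (ucat (double K)) B'"
begin

text \<open>
  The biproduct \<open>bb a\<close> of \<open>(X, f)\<close> and \<open>\<iota>'(X, f)\<close> in \<open>\<C>'\<close> is arbitrary; its object is \<open>ob (hh a)\<close>, and its
  morphisms are arrows of \<open>\<C>\<close> compatible with the structure maps. \<open>LL\<close> is the matrix \<open>\<Lambda>\<close> formed in \<open>\<C>'\<close>; the
  sign is that of \<open>\<lambda>' = -\<lambda>\<close>.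
\<close>

definition "bb a = B' (ob a) (ob (icj a))"
definition "hh a = arw (io (fst (bsum (bb a)))) (fst (bsum (bb a))) (snd (bsum (bb a)))"
definition "i1 a = arw (tgt a) (tgt (hh a)) (in1 (bb a))"
definition "i2 a = arw (io (tgt a)) (tgt (hh a)) (in2 (bb a))"
definition "p1 a = arw (tgt (hh a)) (tgt a) (pr1 (bb a))"
definition "p2 a = arw (tgt (hh a)) (io (tgt a)) (pr2 (bb a))"
definition "LL a = (- 1) \<odot> (i1 a \<cdot> lm (tgt a) \<cdot> I (p2 a)) \<oplus> i2 a \<cdot> I (p1 a)"

lemma ip_src_tgt [simp]:
  "src (i1 a) = tgt a" "tgt (i1 a) = tgt (hh a)" "src (i2 a) = io (tgt a)" "tgt (i2 a) = tgt (hh a)"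
  "src (p1 a) = tgt (hh a)" "tgt (p1 a) = tgt a" "src (p2 a) = tgt (hh a)" "tgt (p2 a) = io (tgt a)"
  "src (LL a) = io (tgt (hh a))" "tgt (LL a) = tgt (hh a)"
  by (simp_all add: i1_def i2_def p1_def p2_def LL_def)

lemma arw_mor: "\<lbrakk>ok C p; src p = X; tgt p = Y\<rbrakk> \<Longrightarrow> arw X Y (mor p) = p"
  by (auto intro!: arr_eqI)

lemma mor_bb: "in1 (bb a) = mor (i1 a)" "in2 (bb a) = mor (i2 a)" "pr1 (bb a) = mor (p1 a)" "pr2 (bb a) = mor (p2 a)"
  by (simp_all add: i1_def i2_def p1_def p2_def)

lemma dsum_double: "\<lbrakk>cj a; tgt a = X\<rbrakk> \<Longrightarrow> dsum (double K) B' (X, mor a) = bb a"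
  by (auto simp: dsum_def bb_def)

lemma bb:
  assumes a: "cj a"
  shows cj_hh [simp]: "cj (hh a)" and bsum_bb: "bsum (bb a) = ob (hh a)"
    and ok_ip [simp]: "ok C (i1 a)" "ok C (i2 a)" "ok C (p1 a)" "ok C (p2 a)"
    and ip_squares: "i1 a \<cdot> a = hh a \<cdot> I (i1 a)" "i2 a \<cdot> icj a = hh a \<cdot> I (i2 a)"
      "p1 a \<cdot> hh a = a \<cdot> I (p1 a)" "p2 a \<cdot> hh a = icj a \<cdot> I (p2 a)"
    and ip [simp]: "p1 a \<cdot> i1 a = ide (tgt a)" "p2 a \<cdot> i2 a = ide (io (tgt a))"
      "p1 a \<cdot> i2 a = zer (io (tgt a)) (tgt a)" "p2 a \<cdot> i1 a = zer (tgt a) (io (tgt a))"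
    and ip_sum: "i1 a \<cdot> p1 a \<oplus> i2 a \<cdot> p2 a = ide (tgt (hh a))"
proof -
  have "biproduct C' (ob a) (ob (icj a)) (bb a)"
    using B' a by (simp add: direct_sums_def bb_def)
  note b = this[unfolded biproduct_def]
  then obtain h where h: "bsum (bb a) = ob h" "cj h"
    using Obj_doubleE by blast
  then have hh: "hh a = h"
    by (simp add: hh_def arw_mor)
  with h show 1: "cj (hh a)" "bsum (bb a) = ob (hh a)" by simp_all
  obtain q where q: "in1 (bb a) = mor q" "ok C q" "src q = tgt a" "tgt q = tgt (hh a)"
    using Hom_doubleE[of "in1 (bb a)" a "hh a"] b a 1 by auto
  have 2: "i1 a = q" by (simp add: i1_def q arw_mor)
  obtain r where r: "in2 (bb a) = mor r" "ok C r" "src r = io (tgt a)" "tgt r = tgt (hh a)"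
    using Hom_doubleE[of "in2 (bb a)" "icj a" "hh a"] b a 1 by auto
  have 3: "i2 a = r" by (simp add: i2_def r arw_mor)
  obtain u where u: "pr1 (bb a) = mor u" "ok C u" "src u = tgt (hh a)" "tgt u = tgt a"
    using Hom_doubleE[of "pr1 (bb a)" "hh a" a] b a 1 by auto
  have 4: "p1 a = u" by (simp add: p1_def u arw_mor)
  obtain v where v: "pr2 (bb a) = mor v" "ok C v" "src v = tgt (hh a)" "tgt v = io (tgt a)"
    using Hom_doubleE[of "pr2 (bb a)" "hh a" "icj a"] b a 1 by auto
  have 5: "p2 a = v" by (simp add: p2_def v arw_mor)
  show ok: "ok C (i1 a)" "ok C (i2 a)" "ok C (p1 a)" "ok C (p2 a)"
    using 2 3 4 5 q r u v by simp_all
  show "i1 a \<cdot> a = hh a \<cdot> I (i1 a)" "i2 a \<cdot> icj a = hh a \<cdot> I (i2 a)"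
      "p1 a \<cdot> hh a = a \<cdot> I (p1 a)" "p2 a \<cdot> hh a = icj a \<cdot> I (p2 a)"
      "p1 a \<cdot> i1 a = ide (tgt a)" "p2 a \<cdot> i2 a = ide (io (tgt a))"
      "p1 a \<cdot> i2 a = zer (io (tgt a)) (tgt a)" "p2 a \<cdot> i1 a = zer (tgt a) (io (tgt a))"
      "i1 a \<cdot> p1 a \<oplus> i2 a \<cdot> p2 a = ide (tgt (hh a))"
    using b ok a 1 by (simp_all add: mor_bb double_simps to_arrow)
qed

lemma ok_LL [simp]: "cj a \<Longrightarrow> ok C (LL a)"
  by (simp add: LL_def)

lemma ip_reassoc [simp]:
  assumes "cj a"
  shows "\<lbrakk>ok C c; tgt c = tgt a\<rbrakk> \<Longrightarrow> p1 a \<cdot> (i1 a \<cdot> c) = c"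
    "\<lbrakk>ok C c; tgt c = io (tgt a)\<rbrakk> \<Longrightarrow> p2 a \<cdot> (i2 a \<cdot> c) = c"
    "\<lbrakk>ok C c; tgt c = io (tgt a)\<rbrakk> \<Longrightarrow> p1 a \<cdot> (i2 a \<cdot> c) = zer (src c) (tgt a)"
    "\<lbrakk>ok C c; tgt c = tgt a\<rbrakk> \<Longrightarrow> p2 a \<cdot> (i1 a \<cdot> c) = zer (src c) (io (tgt a))"
  using assms acmp_reassoc[OF ip(1)[OF assms]] acmp_reassoc[OF ip(2)[OF assms]]
    acmp_reassoc[OF ip(3)[OF assms]] acmp_reassoc[OF ip(4)[OF assms]] by simp_all

lemma fob_F_double:
  assumes "cj a" "tgt a = X"
  shows "fob (F_fun (double K) B') (X, mor a) = ob2 (hh a) (LL a)"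
proof -
  have "X \<in> Obj C" using assms by auto
  then show ?thesis
    using assms
    by (simp add: F_fun_def dsum_double bsum_bb Lambda_mat_def Let_def mat_def bip_cov_def mor_bb double_simps to_arrow LL_def)
qed

text \<open>
  Here and in \<open>dd_squares\<close> and \<open>fh_squares\<close>, equations between arrows of \<open>\<C>\<close> are read off from known facts about the
  functor \<open>F'\<close> and its duality morphisms: that their values are objects and morphisms of \<open>\<C>''\<close>.
\<close>

lemma cj2_LL [simp]: "cj a \<Longrightarrow> cj2 (hh a) (LL a)"
proof -
  assume a: "cj a"
  interpret F: conj_dual_sums "double K" B'
    using conj_dual_double B' by (intro conj_dual_sums.intro) (simp_all add: conj_dual_sums_axioms_def)
  have "fob (F_fun (double K) B') (ob a) \<in> Obj C''"
    using F.F_functor a by (simp add: covariant_functor_def)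
  then show "cj2 (hh a) (LL a)"
    using a by (simp add: fob_F_double ob2_in_iff)
qed

text \<open>
  \<open>dd\<close> is the action of \<open>F'\<close> on morphisms, \<open>fh\<close> and \<open>fc\<close> are the components of \<open>F_hat (double K)\<close> and
  \<open>F_check (double K)\<close>.
\<close>

definition "dd a c p = i1 c \<cdot> p \<cdot> p1 a \<oplus> i2 c \<cdot> I p \<cdot> p2 a"
definition "fh a = D (p1 a) \<cdot> p1 (dcj a) \<oplus> D (p2 a) \<cdot> al (tgt a) \<cdot> p2 (dcj a)"
definition "fc a = I (D (p1 a)) \<cdot> p1 (icj (dcj a)) \<oplus> (- 1) \<odot> (I (D (p2 a)) \<cdot> I (al (tgt a)) \<cdot> p2 (icj (dcj a)))"

lemma dd_typed [simp]:
  "src (dd a c p) = tgt (hh a)" "tgt (dd a c p) = tgt (hh c)"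
  "src (fh a) = tgt (hh (dcj a))" "tgt (fh a) = dob (tgt (hh a))" "cj a \<Longrightarrow> ok C (fh a)"
  "src (fc a) = tgt (hh (icj (dcj a)))" "tgt (fc a) = io (dob (tgt (hh a)))" "cj a \<Longrightarrow> ok C (fc a)"
  "\<lbrakk>cj a; cj c; ok C p; src p = tgt a; tgt p = tgt c\<rbrakk> \<Longrightarrow> ok C (dd a c p)"
  by (simp_all add: dd_def fh_def fc_def)

lemma fmor_F_double:
  assumes "cj a" "cj c" "ok C p" "src p = X" "tgt p = Y" "tgt a = X" "tgt c = Y"
  shows "fmor (F_fun (double K) B') (X, mor a) (Y, mor c) (mor p) = mor (dd a c p)"
proof -
  have "X \<in> Obj C" "Y \<in> Obj C" using assms by auto
  then show ?thesis
    using assms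
    by (simp add: F_fun_def diag_mor_def dsum_double Let_def mat_def mor_bb double_simps to_arrow dd_def)
qed

lemma F_double_snd:
  assumes "cj a" "tgt a = X"
  shows "snd (F_hat (double K) B') (X, mor a) = mor (fh a)" "snd (F_check (double K) B') (X, mor a) = mor (fc a)"
proof -
  have "X \<in> Obj C" using assms by auto
  then show "snd (F_hat (double K) B') (X, mor a) = mor (fh a)" "snd (F_check (double K) B') (X, mor a) = mor (fc a)"
    using assms
    by (simp_all add: F_hat_def F_check_def D_sum_def ID_sum_def bip_con_def dsum_double Let_def mat_def mor_bb bsum_bb
        fmor_simps double_simps to_arrow fh_def fc_def)
qed

lemma dd_squares:
  assumes "cj a" "cj c" "ok C p" "src p = tgt a" "tgt p = tgt c" "p \<cdot> a = c \<cdot> I p"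
  shows "dd a c p \<cdot> hh a = hh c \<cdot> I (dd a c p)" "dd a c p \<cdot> LL a = LL c \<cdot> I (dd a c p)"
proof -
  interpret F: conj_dual_sums "double K" B'
    using conj_dual_double B' by (intro conj_dual_sums.intro) (simp_all add: conj_dual_sums_axioms_def)
  have "fmor (F_fun (double K) B') (ob a) (ob c) (mor p) \<in> Hom C'' (fob (F_fun (double K) B') (ob a)) (fob (F_fun (double K) B') (ob c))"
    using F.F_functor assms by (simp add: covariant_functor_def)
  then show "dd a c p \<cdot> hh a = hh c \<cdot> I (dd a c p)" "dd a c p \<cdot> LL a = LL c \<cdot> I (dd a c p)"
    using assms by (simp_all add: fob_F_double fmor_F_double)
qed

lemma fh_squares:
  assumes "cj a"
  shows "fh a \<cdot> hh (dcj a) = dcj (hh a) \<cdot> I (fh a)" "fh a \<cdot> LL (dcj a) = (- 1) \<odot> dcj (LL a) \<cdot> I (fh a)"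
    "fc a \<cdot> hh (icj (dcj a)) = icj (dcj (hh a)) \<cdot> I (fc a)"
    "fc a \<cdot> LL (icj (dcj a)) = icj ((- 1) \<odot> dcj (LL a)) \<cdot> I (fc a)"
proof -
  interpret F: conj_dual_sums "double K" B'
    using conj_dual_double B' by (intro conj_dual_sums.intro) (simp_all add: conj_dual_sums_axioms_def)
  interpret K'': conj_dual "double (double K)" by (rule conj_dual_double2)
  from dmorphism_in_Hom[OF F.F_hat, of "ob a"] dmorphism_in_Hom[OF F.F_check, of "ob a"]
  show "fh a \<cdot> hh (dcj a) = dcj (hh a) \<cdot> I (fh a)" "fh a \<cdot> LL (dcj a) = (- 1) \<odot> dcj (LL a) \<cdot> I (fh a)"
    "fc a \<cdot> hh (icj (dcj a)) = icj (dcj (hh a)) \<cdot> I (fc a)"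
    "fc a \<cdot> LL (icj (dcj a)) = icj ((- 1) \<odot> dcj (LL a)) \<cdot> I (fc a)"
    using assms by (simp_all add: F_double_snd fob_F_double)
qed

abbreviation "ut a \<equiv> tt (hh a) (LL a)"
abbreviation "us a \<equiv> ss (hh a) (LL a)"

lemma ip_inv_squares:
  assumes "cj a"
  shows "I (p1 a) \<cdot> iv (hh a) = iv a \<cdot> p1 a" "I (p2 a) \<cdot> iv (hh a) = (- 1) \<odot> (I (iv a) \<cdot> p2 a)"
    "iv (hh a) \<cdot> i1 a = I (i1 a) \<cdot> iv a"
proof -
  have "iv (icj a) = (- 1) \<odot> I (iv a)"
    using assms by (simp add: icj_def)
  then show "I (p1 a) \<cdot> iv (hh a) = iv a \<cdot> p1 a" "I (p2 a) \<cdot> iv (hh a) = (- 1) \<odot> (I (iv a) \<cdot> p2 a)"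
    "iv (hh a) \<cdot> i1 a = I (i1 a) \<cdot> iv a"
    using square_inv[OF ip_squares(3)[OF assms, symmetric]] square_inv[OF ip_squares(4)[OF assms, symmetric]]
      square_inv[OF ip_squares(1)[OF assms, symmetric]] assms by simp_all
qed

text \<open>
  The involution \<open>\<Lambda> h\<^sup>-\<^sup>1\<close> of \<open>F'(X, f)\<close> exchanges the two summands, up to \<open>f\<close>. Being \<open>-1\<close> on \<open>t\<close>, it expresses
  the second component of \<open>t\<close> by the first.
\<close>

lemma p2_ut:
  assumes "cj a"
  shows "p2 a \<cdot> ut a = (- 1) \<odot> (iv a \<cdot> p1 a \<cdot> ut a)"
proof -
  have "iv a \<cdot> p1 a \<cdot> ut a = (p2 a \<cdot> LL a) \<cdot> iv (hh a) \<cdot> ut a"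
    using assms acmp_reassoc[OF ip_inv_squares(1)[OF assms]] by (simp add: LL_def)
  also have "\<dots> = (- 1) \<odot> (p2 a \<cdot> ut a)"
    using b_inv_a_tt[OF cj2_LL[OF assms]] by simp
  finally have "(- 1) \<odot> (p2 a \<cdot> ut a) = iv a \<cdot> p1 a \<cdot> ut a" ..
  then show ?thesis
    by (rule neg_eqD) (use assms in simp)
qed

lemma LL_I_i1:
  assumes "cj a" "ok C c" "tgt c = io (tgt a)"
  shows "LL a \<cdot> (I (i1 a) \<cdot> c) = i2 a \<cdot> c"
  using assms by (simp add: LL_def cancel vanish)

lemma us_i2:
  assumes "cj a"
  shows "us a \<cdot> i2 a \<cdot> iv a = (- 1) \<odot> (us a \<cdot> i1 a)"
proof -
  have "us a \<cdot> i2 a \<cdot> iv a = (us a \<cdot> LL a \<cdot> iv (hh a)) \<cdot> i1 a"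
    using assms by (simp add: ip_inv_squares LL_I_i1)
  also have "\<dots> = (- 1) \<odot> (us a \<cdot> i1 a)"
    unfolding ss_b_inv_a[OF cj2_LL[OF assms]] by simp
  finally show ?thesis .
qed

lemma aiso_p1_ut [simp]:
  assumes "cj a"
  shows "aiso C (p1 a \<cdot> ut a)"
proof (rule aisoI)
  \<comment> \<open>The inverse is \<open>2 s i\<^sub>1\<close>: the idempotent \<open>t s\<close> has \<open>1 / 2\<close> as its first diagonal entry.\<close>
  let ?x = "us a \<cdot> i1 a \<cdot> p1 a \<cdot> ut a"
  have h: "(1 + 1) * half = 1" by (rule half)
  have "p1 a \<cdot> (ee (hh a) (LL a) \<cdot> i1 a) = half \<odot> ide (tgt a)"
    using assms by (simp add: ee_def ip_inv_squares LL_def vanish)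
  then show "(p1 a \<cdot> ut a) \<cdot> ((1 + 1) \<odot> (us a \<cdot> i1 a)) = ide (tgt (p1 a \<cdot> ut a))"
    using assms h by (simp add: tt_ss_reassoc)
  have "us a \<cdot> i2 a \<cdot> p2 a \<cdot> ut a = ?x"
    using acmp_reassoc[OF us_i2[OF assms, folded acmp_assoc]] assms by (simp add: p2_ut)
  moreover have "us a \<cdot> (i1 a \<cdot> p1 a \<oplus> i2 a \<cdot> p2 a) \<cdot> ut a = ide (src (ut a))"
    unfolding ip_sum[OF assms] using assms by simp
  ultimately have "?x \<oplus> ?x = ide (src (ut a))"
    by simp
  then show "((1 + 1) \<odot> (us a \<cdot> i1 a)) \<cdot> (p1 a \<cdot> ut a) = ide (src (p1 a \<cdot> ut a))"
    using assms by (simp flip: ascl_add)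
qed (use assms in simp_all)

lemma p1_ut_nat:
  assumes "cj a" "cj c" "ok C p" "src p = tgt a" "tgt p = tgt c" "p \<cdot> a = c \<cdot> I p"
  shows "p1 c \<cdot> ut c \<cdot> us c \<cdot> dd a c p \<cdot> ut a = p \<cdot> p1 a \<cdot> ut a"
proof -
  have "ee (hh c) (LL c) \<cdot> dd a c p = dd a c p \<cdot> ee (hh a) (LL a)"
    using assms dd_squares[OF assms] by (intro ee_nat) simp_all
  from acmp_reassoc[OF this, of "ut a"] have "ee (hh c) (LL c) \<cdot> (dd a c p \<cdot> ut a) = dd a c p \<cdot> ut a"
    using assms by simp
  then have "p1 c \<cdot> ut c \<cdot> us c \<cdot> dd a c p \<cdot> ut a = p1 c \<cdot> dd a c p \<cdot> ut a"
    using assms by (simp add: tt_ss_reassoc)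
  then show ?thesis
    using assms by (simp add: dd_def)
qed

text \<open>
  The natural isomorphism \<open>\<Theta>F' \<cong> G\<close>: the first component of \<open>t\<close>.
\<close>

definition "rhG P = (case P of (X, f) \<Rightarrow> mor (p1 (arw (io X) X f) \<cdot> ut (arw (io X) X f)))"

lemma rhG: "\<lbrakk>cj a; tgt a = X\<rbrakk> \<Longrightarrow> rhG (X, mor a) = mor (p1 a \<cdot> ut a)"
  by (simp add: rhG_def arw_mor)

lemma rhG_nat_iso: "nat_iso_cov C' C (comp_cov (Theta_fun K T t s) (F_fun (double K) B')) G_fun rhG"
  unfolding nat_iso_cov_def
  by (auto elim!: double_elims simp: fob_F_double fmor_F_double Theta_simps rhG G_fun_def fmor_simps double_simps
      to_arrow dd_squares p1_ut_nat)

lemma D_ip_squares: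
  assumes "cj a"
  shows "D (iv (hh a)) \<cdot> (D (I (p1 a)) \<cdot> c) = D (p1 a) \<cdot> (D (iv a) \<cdot> c)"
    "D (iv (hh a)) \<cdot> (D (I (p2 a)) \<cdot> c) = (- 1) \<odot> (D (p2 a) \<cdot> (D (I (iv a)) \<cdot> c))"
    "D (hh a) \<cdot> (D (p1 a) \<cdot> c) = D (I (p1 a)) \<cdot> (D a \<cdot> c)"
    "D (hh a) \<cdot> (D (p2 a) \<cdot> c) = (- 1) \<odot> (D (I (p2 a)) \<cdot> (D (I a) \<cdot> c))"
    "D (ut a) \<cdot> (D (p2 a) \<cdot> c) = (- 1) \<odot> (D (ut a) \<cdot> (D (p1 a) \<cdot> (D (iv a) \<cdot> c)))"
    "I (D (ut a)) \<cdot> (I (D (p2 a)) \<cdot> c) = (- 1) \<odot> (I (D (ut a)) \<cdot> (I (D (p1 a)) \<cdot> (I (D (iv a)) \<cdot> c)))"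
proof -
  have 1: "D (iv (hh a)) \<cdot> D (I (p1 a)) = D (p1 a) \<cdot> D (iv a)"
    "D (iv (hh a)) \<cdot> D (I (p2 a)) = (- 1) \<odot> (D (p2 a) \<cdot> D (I (iv a)))"
    using arg_cong[OF ip_inv_squares(1)[OF assms], of D] arg_cong[OF ip_inv_squares(2)[OF assms], of D] assms by simp_all
  have 2: "D (hh a) \<cdot> D (p1 a) = D (I (p1 a)) \<cdot> D a" "D (hh a) \<cdot> D (p2 a) = (- 1) \<odot> (D (I (p2 a)) \<cdot> D (I a))"
    using arg_cong[OF ip_squares(3)[OF assms], of D] arg_cong[OF ip_squares(4)[OF assms], of D] assms
    by (simp_all add: icj_def)
  have 3: "D (ut a) \<cdot> D (p2 a) = (- 1) \<odot> (D (ut a) \<cdot> D (p1 a) \<cdot> D (iv a))"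
    using arg_cong[OF p2_ut[OF assms], of D] assms by simp
  have 4: "I (D (ut a)) \<cdot> I (D (p2 a)) = (- 1) \<odot> (I (D (ut a)) \<cdot> I (D (p1 a)) \<cdot> I (D (iv a)))"
    using arg_cong[OF 3, of I] assms by simp
  from 1[THEN acmp_reassoc, of c] 2[THEN acmp_reassoc, of c] 3[THEN acmp_reassoc, of c] 4[THEN acmp_reassoc, of c]
  show "D (iv (hh a)) \<cdot> (D (I (p1 a)) \<cdot> c) = D (p1 a) \<cdot> (D (iv a) \<cdot> c)"
    "D (iv (hh a)) \<cdot> (D (I (p2 a)) \<cdot> c) = (- 1) \<odot> (D (p2 a) \<cdot> (D (I (iv a)) \<cdot> c))"
    "D (hh a) \<cdot> (D (p1 a) \<cdot> c) = D (I (p1 a)) \<cdot> (D a \<cdot> c)"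
    "D (hh a) \<cdot> (D (p2 a) \<cdot> c) = (- 1) \<odot> (D (I (p2 a)) \<cdot> (D (I a) \<cdot> c))"
    "D (ut a) \<cdot> (D (p2 a) \<cdot> c) = (- 1) \<odot> (D (ut a) \<cdot> (D (p1 a) \<cdot> (D (iv a) \<cdot> c)))"
    "I (D (ut a)) \<cdot> (I (D (p2 a)) \<cdot> c) = (- 1) \<odot> (I (D (ut a)) \<cdot> (I (D (p1 a)) \<cdot> (I (D (iv a)) \<cdot> c)))"
    by simp_all
qed

text \<open>
  The idempotent \<open>t s\<close> commutes with the component of \<open>F'\<close> and is absorbed by \<open>t\<close>. By \<open>p2_ut\<close> the two
  summands of that diagonal component contribute equally, so the duality morphism of \<open>\<Theta>F'\<close> is twice
  that of \<open>G\<close>, up to sign.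
\<close>

lemma thc_double:
  assumes "cj a"
  shows "half \<odot> (thc (hh a) (LL a) \<cdot> ss (icj (dcj (hh a))) (icj ((- 1) \<odot> dcj (LL a))) \<cdot> fc a \<cdot> ut (icj (dcj a)))
    = (- 1) \<odot> (D (p1 a \<cdot> ut a) \<cdot> dcj a \<cdot> p1 (icj (dcj a)) \<cdot> ut (icj (dcj a)))"
proof -
  let ?a = "icj (dcj (hh a))" and ?b = "icj ((- 1) \<odot> dcj (LL a))" and ?c = "icj (dcj a)"
  let ?y = "D (p1 a \<cdot> ut a) \<cdot> D (iv a) \<cdot> al (tgt a) \<cdot> p1 ?c \<cdot> ut ?c"
  have 2: "cj2 ?a ?b" and c: "cj ?c" using assms by simp_all
  have "ee ?a ?b \<cdot> fc a = fc a \<cdot> ee (hh ?c) (LL ?c)"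
    using assms fh_squares(3,4)[OF assms] by (intro ee_nat 2) simp_all
  from acmp_reassoc[OF this, of "ut ?c"] have e: "ee ?a ?b \<cdot> (fc a \<cdot> ut ?c) = fc a \<cdot> ut ?c"
    using assms by simp
  have "iv ?c = I (iv (al (tgt a))) \<cdot> I (D a)"
    using assms by (simp add: icj_def dcj_def)
  then have p2: "p2 ?c \<cdot> ut ?c = (- 1) \<odot> (I (iv (al (tgt a))) \<cdot> I (D a) \<cdot> p1 ?c \<cdot> ut ?c)"
    using p2_ut[OF c] by simp
  have "thc (hh a) (LL a) \<cdot> ss ?a ?b \<cdot> fc a \<cdot> ut ?c
      = D (ut a) \<cdot> D (iv (hh a)) \<cdot> al (tgt (hh a)) \<cdot> fc a \<cdot> ut ?c"
    using assms by (simp add: thc_def tt_ss_reassoc[OF 2] e)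
  also have "\<dots> = ?y \<oplus> ?y"
    using assms by (simp add: fc_def p2 al_nat D_ip_squares cancel)
  finally have "thc (hh a) (LL a) \<cdot> ss ?a ?b \<cdot> fc a \<cdot> ut ?c = ?y \<oplus> ?y" .
  moreover have "dcj a \<cdot> x = (- 1) \<odot> (D (iv a) \<cdot> al (tgt a) \<cdot> x)" for x
    by (simp add: dcj_def)
  ultimately show ?thesis
    using half_twice[of ?y] assms by simp
qed

lemma thh_double:
  assumes "cj a"
  shows "(- half) \<odot> (thh (hh a) (LL a) \<cdot> ss (dcj (hh a)) ((- 1) \<odot> dcj (LL a)) \<cdot> fh a \<cdot> ut (dcj a))
    = I (D (p1 a \<cdot> ut a)) \<cdot> gh a \<cdot> p1 (dcj a) \<cdot> ut (dcj a)"
proof -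
  let ?a = "dcj (hh a)" and ?b = "(- 1) \<odot> dcj (LL a)" and ?c = "dcj a"
  let ?y = "I (D (p1 a \<cdot> ut a)) \<cdot> iv (al (tgt a)) \<cdot> D a \<cdot> p1 ?c \<cdot> ut ?c"
  have 2: "cj2 ?a ?b" and c: "cj ?c" using assms by simp_all
  have "ee ?a ?b \<cdot> fh a = fh a \<cdot> ee (hh ?c) (LL ?c)"
    using assms fh_squares(1,2)[OF assms] by (intro ee_nat 2) simp_all
  from acmp_reassoc[OF this, of "ut ?c"] have e: "ee ?a ?b \<cdot> (fh a \<cdot> ut ?c) = fh a \<cdot> ut ?c"
    using assms by simp
  have "iv ?c = (- 1) \<odot> (iv (al (tgt a)) \<cdot> D a)"
    using assms by (simp add: dcj_def)
  then have p2: "p2 ?c \<cdot> ut ?c = iv (al (tgt a)) \<cdot> D a \<cdot> p1 ?c \<cdot> ut ?c"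
    using p2_ut[OF c] assms by simp
  have "thh (hh a) (LL a) \<cdot> ss ?a ?b \<cdot> fh a \<cdot> ut ?c
      = (- 1) \<odot> (I (D (ut a)) \<cdot> iv (al (tgt (hh a))) \<cdot> D (hh a) \<cdot> fh a \<cdot> ut ?c)"
    using assms by (simp add: thh_def tt_ss_reassoc[OF 2] e)
  also have "\<dots> = (- 1) \<odot> (?y \<oplus> ?y)"
    using assms by (simp add: fh_def p2 inv_al_nat D_ip_squares cancel)
  finally show ?thesis
    using half_twice[of ?y] assms by (simp add: gh_def)
qed

text \<open>
  The similarity factors are \<open>-1 / 2\<close> and \<open>1 / 2\<close>; these are units of \<open>k\<close> with inverses \<open>-2\<close> and \<open>2\<close>.
\<close>

lemma Theta_F:
  assumes e: "\<epsilon> * \<epsilon> = 1"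
  shows Theta_F_hat: "dsimilar (signed \<epsilon> (dualD (double K))) (signed (- \<epsilon>) (dualID K))
      (dcomp (signed \<epsilon> (dualD (double K))) (signed \<epsilon> (dualD (double (double K)))) (signed (- \<epsilon>) (dualID K))
        (Theta_hat K T t s) (F_hat (double K) B')) (G_hat K)" (is "dsimilar ?A ?C ?P _")
    and Theta_F_check: "dsimilar (signed \<epsilon> (dualID (double K))) (signed \<epsilon> (dualD K))
      (dcomp (signed \<epsilon> (dualID (double K))) (signed \<epsilon> (dualID (double (double K)))) (signed \<epsilon> (dualD K))
        (Theta_check K T t s) (F_check (double K) B')) (G_check K)" (is "dsimilar ?A' ?C' ?P' _")
proof -
  interpret F: conj_dual_sums "double K" B'
    using conj_dual_double B' by (intro conj_dual_sums.intro) (simp_all add: conj_dual_sums_axioms_def)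
  interpret K'': conj_dual "double (double K)" by (rule conj_dual_double2)
  have e': "- \<epsilon> * - \<epsilon> = 1" using e by simp
  have "1 = half * (1 + 1)" "1 = - half * - (1 + 1)"
    using half by (simp_all only: minus_mult_minus mult.commute)
  then have dvd: "half dvd 1" "- half dvd 1"
    by (auto intro: dvdI)
  have P: "dmorphism ?A ?C ?P"
    by (rule dmorphism_dcomp[OF F.F_signed(1)[OF e] Theta_hat_signed[OF e', unfolded minus_minus]])
  have P': "dmorphism ?A' ?C' ?P'"
    by (rule dmorphism_dcomp[OF F.F_signed(2)[OF e] Theta_check_signed[OF e]])
  have "similar_via (- half) ?A ?C ?P (G_hat K)"
  proof (rule similar_viaI[OF P G_signed(1)[OF e], where \<rho> = rhG], goal_cases)
    case (2 Q)
    then show ?case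
      using thh_double
      by (auto elim!: Obj_doubleE simp: dcomp_simps fob_F_double F_double_snd Theta_simps Theta_snd rhG G_fun_def G_snd
          fmor_simps double_simps to_arrow fh_squares)
  qed (use rhG_nat_iso in \<open>simp add: dcomp_simps\<close>)
  then show "dsimilar ?A ?C ?P (G_hat K)"
    unfolding dsimilar_def using dvd(2) by blast
  have "similar_via half ?A' ?C' ?P' (G_check K)"
  proof (rule similar_viaI[OF P' G_signed(2)[OF e], where \<rho> = rhG], goal_cases)
    case (2 Q)
    then show ?case
      using thc_double
      by (auto elim!: Obj_doubleE simp: dcomp_simps fob_F_double F_double_snd Theta_simps Theta_snd rhG G_fun_def G_snd
          fmor_simps double_simps to_arrow fh_squares)
  qed (use rhG_nat_iso in \<open>simp add: dcomp_simps\<close>)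
  then show "dsimilar ?A' ?C' ?P' (G_check K)"
    unfolding dsimilar_def using dvd(1) by blast
qed

end

theorem theorem2p3:
  fixes K :: "('o, 'm, 'k::{comm_ring, comm_monoid_mult}) cdcat"
    and half \<epsilon> :: 'k
    and B :: "'o \<Rightarrow> 'o \<Rightarrow> ('o, 'm) bip"
    and T :: "('o \<times> 'm) \<times> 'm \<Rightarrow> 'o"
    and t s :: "('o \<times> 'm) \<times> 'm \<Rightarrow> 'm"
  assumes half: "(1 + 1) * half = 1"
    and K: "conjugation_duality_category K"
    and B: "direct_sums (ucat K) B"
    and Theta: "Theta_choice K half T t s"
    and sign: "\<epsilon> = 1 \<or> \<epsilon> = - 1"
  shows "mutually_inverse_equivalences
           (signed \<epsilon> (dualD K)) (signed \<epsilon> (dualID (double (double K))))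
           (Psi_hat K B) (Theta_check K T t s)
       \<and> mutually_inverse_equivalences
           (signed \<epsilon> (dualID K)) (signed (- \<epsilon>) (dualD (double (double K))))
           (Psi_check K B) (Theta_hat K T t s)
       \<and> dmor_eq (signed \<epsilon> (dualD K)) (signed \<epsilon> (dualD (double K)))
           (dcomp (signed \<epsilon> (dualD K)) (signed \<epsilon> (dualID (double (double K)))) (signed \<epsilon> (dualD (double K)))
              (G_check (double K)) (Psi_hat K B))
           (F_hat K B)
       \<and> dmor_eq (signed \<epsilon> (dualID K)) (signed \<epsilon> (dualID (double K)))
           (dcomp (signed \<epsilon> (dualID K)) (signed (- \<epsilon>) (dualD (double (double K)))) (signed \<epsilon> (dualID (double K)))
              (G_hat (double K)) (Psi_check K B))
           (F_check K B)
       \<and> (\<forall>B'. direct_sums (ucat (double K)) B' \<longrightarrow>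
           dsimilar (signed \<epsilon> (dualD (double K))) (signed (- \<epsilon>) (dualID K))
             (dcomp (signed \<epsilon> (dualD (double K))) (signed \<epsilon> (dualD (double (double K)))) (signed (- \<epsilon>) (dualID K))
                (Theta_hat K T t s) (F_hat (double K) B'))
             (G_hat K)
         \<and> dsimilar (signed \<epsilon> (dualID (double K))) (signed \<epsilon> (dualD K))
             (dcomp (signed \<epsilon> (dualID (double K))) (signed \<epsilon> (dualID (double (double K)))) (signed \<epsilon> (dualD K))
                (Theta_check K T t s) (F_check (double K) B'))
             (G_check K))"
proof -
  interpret conj_dual_split K B half T t s
    using assms by (intro conj_dual_split.intro conj_dual_sums.intro conj_dual.intro)
      (simp_all only: conj_dual_sums_axioms_def conj_dual_split_axioms_def)
  have e: "\<epsilon> * \<epsilon> = 1"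
    using sign by auto
  show ?thesis
  proof (intro conjI allI impI)
    show "mutually_inverse_equivalences (signed \<epsilon> (dualD K)) (signed \<epsilon> (dualID (double (double K))))
        (Psi_hat K B) (Theta_check K T t s)"
      unfolding mutually_inverse_equivalences_def
      by (intro conjI Psi_hat_signed[OF e] Theta_check_signed[OF e] Theta_Psi_check[OF e] Psi_Theta_check[OF e])
    show "mutually_inverse_equivalences (signed \<epsilon> (dualID K)) (signed (- \<epsilon>) (dualD (double (double K))))
        (Psi_check K B) (Theta_hat K T t s)"
      unfolding mutually_inverse_equivalences_def
      by (intro conjI Psi_check_signed[OF e] Theta_hat_signed[OF e] Theta_Psi_hat[OF e] Psi_Theta_hat[OF e])
  next
    fix B'
    assume "direct_sums (ucat (double K)) B'"
    then interpret S: conj_dual_double_sums K B half T t s B'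
      by (intro conj_dual_double_sums.intro conj_dual_double_sums_axioms.intro conj_dual_split_axioms)
    show "dsimilar (signed \<epsilon> (dualD (double K))) (signed (- \<epsilon>) (dualID K))
        (dcomp (signed \<epsilon> (dualD (double K))) (signed \<epsilon> (dualD (double (double K)))) (signed (- \<epsilon>) (dualID K))
          (Theta_hat K T t s) (F_hat (double K) B')) (G_hat K)"
      and "dsimilar (signed \<epsilon> (dualID (double K))) (signed \<epsilon> (dualD K))
        (dcomp (signed \<epsilon> (dualID (double K))) (signed \<epsilon> (dualID (double (double K)))) (signed \<epsilon> (dualD K))
          (Theta_check K T t s) (F_check (double K) B')) (G_check K)"
      by (rule S.Theta_F_hat[OF e], rule S.Theta_F_check[OF e])
  qed (rule G_Psi_hat[OF e] G_Psi_check[OF e])+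
qed

end
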